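(* Let $d\ge1$, $\Omega=[0,1]^d$, $p\in[1,\infty)$, $p',q\in[1,\infty]$ and $s\ge0$. There is $L_0>0$ such that for every $L\ge L_0$ there is a constant $c>0$, not depending on $n$, with, for all $n\ge1$, $$\inf_{\tilde\mu}\ \sup_{f\in\mathcal B^{s}_{p',q}(L)}\mathbb E\,W_p(f,\tilde\mu)\ \ge\ c\cdot\begin{cases} n^{-\frac{1+s/p}{d+s}} & d-s\ge 2p,\\ n^{-\frac1{2p}} & d-s<2p,\end{cases}$$ where the infimum is over all estimators $\tilde\mu$ (probability measures on $\Omega$ that are measurable functions of the data) based on $n$ i.i.d. observations with density $f$.
   Context: $W_p$ denotes the $p$-Wasserstein distance: $W_p^p(\mu,\nu)=\inf_\pi\int\|x-y\|^p\,d\pi(x,y)$ over couplings $\pi$ of $\mu$ and $\nu$, with $\|\cdot\|$ the Euclidean norm; a density is identified with the measure having that density. $\mathbb E$ is expectation over $X_1,\dots,X_n$ i.i.d. with density $f$. Wavelet system. Fix sets $\Phi$ and $\Psi_j$ ($j\ge0$) of functions in $L_2(\Omega)$, of regularity $r>\max\{s,1\}$, such that, with constants depending only on the system: (i) $\Phi\cup\bigcup_{j\ge0}\Psi_j$ is an orthonormal basis of $L_2(\Omega)$; (ii) all these functions lie in $C^r(\Omega)$, and polynomials of degree at most $r$ on $\Omega$ lie in $\mathrm{span}(\Phi)$; (iii) each $\psi\in\Psi_j$ has the form $\psi(x)=\prod_{i=1}^d\psi_i(x_i)$ with univariate $\psi_i$; (iv) for each $\psi\in\Psi_j$ there is a rectangle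 $I_\psi\subseteq\Omega$ with $\mathrm{supp}(\psi)\subseteq I_\psi$, $\mathrm{diam}(I_\psi)\lesssim 2^{-j}$, and $\|\sum_{\psi\in\Psi_j}\mathbf 1\{x\in I_\psi\}\|_{L_\infty}\lesssim1$; (v) $\|\psi\|_{L_t(\Omega)}\asymp2^{dj(\frac12-\frac1t)}$ for all $\psi\in\Psi_j$ and $t\in[1,\infty]$; (vi) $\|\nabla u\|_{L_t(\Omega)}\lesssim 2^j\|u\|_{L_t(\Omega)}$ for $u\in\mathrm{span}(\Phi\cup\bigcup_{0\le k<j}\Psi_k)$. Consequently $|\Phi|\lesssim1$ and $|\Psi_j|\lesssim2^{dj}$. Besov norm. For a function $f$ put $\alpha=(\int f\phi)_{\phi\in\Phi}$ and $\beta_j=(\int f\psi)_{\psi\in\Psi_j}$, and $$\|f\|_{\mathcal B^s_{p,q}}=\|\alpha\|_{\ell_p}+\Big\|\big(2^{js}2^{dj(\frac12-\frac1p)}\|\beta_j\|_{\ell_p}\big)_{j\ge0}\Big\|_{\ell_q}.$$ For $s>0$ this is equivalent to the norm $\|f\|_{L_p}+\|(2^{sj}\omega_N(f,2^{-j})_p)_{j\ge0}\|_{\ell_q}$, where $N>s$ is an integer and $\omega_N(f,t)_p=\sup_{\|h\|\le t}\|\Delta_h^Nf\|_{L_p(\{x\in\Omega:\,x+Nh\in\Omega\})}$ with $\Delta_h^N$ the $N$-th order forward difference. Class. $\mathcal B^s_{p,q}(L)=\{f\in L_p(\Omega):\|f\|_{\mathcal B^s_{p,q}}\le L,\ \int_\Omega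 f=1,\ f\ge0\}$. *)

theory Defs
  imports "HOL-Probability.Probability" "HOL-Probability.Essential_Supremum"
begin

text \<open>Real power on the extended nonnegative reals, used only with a positive exponent.\<close>

definition ennpowr :: "ennreal \<Rightarrow> real \<Rightarrow> ennreal" where
  "ennpowr x a = (if x = \<top> then \<top> else ennreal (enn2real x powr a))"

text \<open>The norm of \<open>L\<^sub>t(M)\<close>, \<open>1 \<le> t \<le> \<infinity>\<close>, of a function given by its absolute value.
  With \<open>M = count_space A\<close> this is the norm of \<open>\<ell>\<^sub>t(A)\<close>.\<close>

definition Lnorm :: "ennreal \<Rightarrow> 'a measure \<Rightarrow> ('a \<Rightarrow> ennreal) \<Rightarrow> ennreal" where
  "Lnorm t M g =
     (if t = \<top> then esssup M g
      else ennpowr (\<integral>\<^sup>+x. ennpowr (g x) (enn2real t) \<partial>M) (1 / enn2real t))"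

definition Lspace :: "ennreal \<Rightarrow> 'a measure \<Rightarrow> ('a \<Rightarrow> real) set" where
  "Lspace t M = {f \<in> borel_measurable M. Lnorm t M (\<lambda>x. ennreal \<bar>f x\<bar>) < \<top>}"

abbreviation Omega :: "(real^'n) set" where
  "Omega \<equiv> cbox 0 1"

abbreviation leb_Omega :: "(real^'n) measure" where
  "leb_Omega \<equiv> restrict_space lborel Omega"

abbreviation Lnorm_Omega :: "ennreal \<Rightarrow> (real^'n \<Rightarrow> real) \<Rightarrow> ennreal" where
  "Lnorm_Omega t f \<equiv> Lnorm t leb_Omega (\<lambda>x. ennreal \<bar>f x\<bar>)"

abbreviation inner_Omega :: "(real^'n \<Rightarrow> real) \<Rightarrow> (real^'n \<Rightarrow> real) \<Rightarrow> real" where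
  "inner_Omega f g \<equiv> (\<integral>x. f x * g x \<partial>leb_Omega)"

text \<open>\<open>Ck_Holder k a S f\<close>: all partial derivatives of \<open>f\<close> of order at most \<open>k\<close> exist and are
  continuous on \<open>S\<close> (derivatives being taken within \<open>S\<close>), and for \<open>a > 0\<close> those of order \<open>k\<close> are
  moreover Hoelder continuous with exponent \<open>a\<close>.\<close>

fun Ck_Holder :: "nat \<Rightarrow> real \<Rightarrow> (real^'n) set \<Rightarrow> (real^'n \<Rightarrow> real) \<Rightarrow> bool" where
  "Ck_Holder 0 a S f \<longleftrightarrow>
     continuous_on S f \<and>
     (a > 0 \<longrightarrow> (\<exists>C. \<forall>x\<in>S. \<forall>y\<in>S. \<bar>f x - f y\<bar> \<le> C * norm (x - y) powr a))"
| "Ck_Holder (Suc k) a S f \<longleftrightarrow>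
     (\<exists>D. (\<forall>x\<in>S. (f has_derivative (\<lambda>h. \<Sum>i\<in>UNIV. D i x * h $ i)) (at x within S)) \<and>
          (\<forall>i. Ck_Holder k a S (D i)))"

text \<open>For a natural number \<open>r\<close> this is the usual space of \<open>r\<close> times continuously
  differentiable functions.\<close>

definition Cr_on :: "real \<Rightarrow> (real^'n) set \<Rightarrow> (real^'n \<Rightarrow> real) set" where
  "Cr_on r S = {f. Ck_Holder (nat \<lfloor>r\<rfloor>) (frac r) S f}"

definition grad_within :: "(real^'n) set \<Rightarrow> (real^'n \<Rightarrow> real) \<Rightarrow> real^'n \<Rightarrow> real^'n" where
  "grad_within S u x = (\<chi> i. frechet_derivative u (at x within S) (axis i 1))"

definition polys_deg_le :: "real \<Rightarrow> (real^'n \<Rightarrow> real) set" where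
  "polys_deg_le r =
     {f. \<exists>c. \<forall>x. f x = (\<Sum>\<alpha> | real (\<Sum>i\<in>UNIV. \<alpha> i) \<le> r. c \<alpha> * (\<Prod>i\<in>UNIV. (x $ i) ^ \<alpha> i))}"

text \<open>Only values on \<open>S\<close> matter; elements of the span are arbitrary outside \<open>S\<close>.\<close>

definition span_on :: "'a set \<Rightarrow> ('a \<Rightarrow> real) set \<Rightarrow> ('a \<Rightarrow> real) set" where
  "span_on S B =
     {u. \<exists>F c. finite F \<and> F \<subseteq> B \<and> (\<forall>x\<in>S. u x = (\<Sum>v\<in>F. c v * v x))}"

definition orthonormal_basis_Omega :: "(real^'n \<Rightarrow> real) set \<Rightarrow> bool" where
  "orthonormal_basis_Omega B \<longleftrightarrow>
     B \<subseteq> Lspace 2 leb_Omega \<and>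
     (\<forall>u\<in>B. \<forall>v\<in>B. inner_Omega u v = (if u = v then 1 else 0)) \<and>
     (\<forall>f\<in>Lspace 2 leb_Omega. \<forall>\<epsilon>>0. \<exists>u\<in>span_on Omega B. Lnorm_Omega 2 (\<lambda>x. f x - u x) < \<epsilon>)"

text \<open>The two disjointness assumptions say that the basis is listed without repetition. Since
  \<open>1 / t\<close> is computed in \<^typ>\<open>ennreal\<close>, it is \<open>0\<close> for \<open>t = \<infinity>\<close>. The support of a
  function on \<open>Omega\<close> lies in a closed box iff all points of \<open>Omega\<close> where it is nonzero do.\<close>

locale wavelet_system =
  fixes r :: real
    and \<Phi> :: "(real^'n \<Rightarrow> real) set"
    and \<Psi> :: "nat \<Rightarrow> (real^'n \<Rightarrow> real) set"
  assumes basis: "orthonormal_basis_Omega (\<Phi> \<union> (\<Union>j. \<Psi> j))"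
    and disjoint_scaling: "\<And>j. \<Phi> \<inter> \<Psi> j = {}"
    and disjoint_levels: "\<And>j k. j \<noteq> k \<Longrightarrow> \<Psi> j \<inter> \<Psi> k = {}"
    and regularity: "\<Phi> \<union> (\<Union>j. \<Psi> j) \<subseteq> Cr_on r Omega"
    and polynomials: "polys_deg_le r \<subseteq> span_on Omega \<Phi>"
    and tensor: "\<And>j \<psi>. \<psi> \<in> \<Psi> j \<Longrightarrow>
      \<exists>\<psi>1 :: 'n \<Rightarrow> real \<Rightarrow> real. \<forall>x\<in>Omega. \<psi> x = (\<Prod>i\<in>UNIV. \<psi>1 i (x $ i))"
    and locality: "\<exists>C::real. \<exists>I :: nat \<Rightarrow> (real^'n \<Rightarrow> real) \<Rightarrow> (real^'n) set. \<forall>j.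
      (\<forall>\<psi>\<in>\<Psi> j. (\<exists>a b. I j \<psi> = cbox a b) \<and> I j \<psi> \<subseteq> Omega \<and>
         {x \<in> Omega. \<psi> x \<noteq> 0} \<subseteq> I j \<psi> \<and> diameter (I j \<psi>) \<le> C * 2 powr (- real j)) \<and>
      Lnorm \<infinity> leb_Omega (\<lambda>x. \<integral>\<^sup>+\<psi>. indicator (I j \<psi>) x \<partial>count_space (\<Psi> j)) \<le> ennreal C"
    and normalization: "\<exists>c>0. \<exists>C::real. \<forall>j. \<forall>\<psi>\<in>\<Psi> j. \<forall>t\<ge>1.
      (let w = 2 powr (real CARD('n) * real j * (1 / 2 - enn2real (1 / t)))
       in ennreal (c * w) \<le> Lnorm_Omega t \<psi> \<and> Lnorm_Omega t \<psi> \<le> ennreal (C * w))"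
    and bernstein: "\<exists>C::real. \<forall>j. \<forall>t\<ge>1. \<forall>u\<in>span_on Omega (\<Phi> \<union> (\<Union>k<j. \<Psi> k)).
      Lnorm t leb_Omega (\<lambda>x. ennreal (norm (grad_within Omega u x)))
        \<le> ennreal (C * 2 ^ j) * Lnorm_Omega t u"

definition besov_norm ::
  "(real^'n \<Rightarrow> real) set \<Rightarrow> (nat \<Rightarrow> (real^'n \<Rightarrow> real) set) \<Rightarrow> real \<Rightarrow> ennreal \<Rightarrow> ennreal
    \<Rightarrow> (real^'n \<Rightarrow> real) \<Rightarrow> ennreal" where
  "besov_norm \<Phi> \<Psi> s p q f =
     Lnorm p (count_space \<Phi>) (\<lambda>\<phi>. ennreal \<bar>inner_Omega f \<phi>\<bar>) +
     Lnorm q (count_space UNIV) (\<lambda>j.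
       ennreal (2 powr (real j * s) *
                2 powr (real CARD('n) * real j * (1 / 2 - enn2real (1 / p)))) *
       Lnorm p (count_space (\<Psi> j)) (\<lambda>\<psi>. ennreal \<bar>inner_Omega f \<psi>\<bar>))"

definition besov_class ::
  "(real^'n \<Rightarrow> real) set \<Rightarrow> (nat \<Rightarrow> (real^'n \<Rightarrow> real) set) \<Rightarrow> real \<Rightarrow> ennreal \<Rightarrow> ennreal
    \<Rightarrow> real \<Rightarrow> (real^'n \<Rightarrow> real) set" where
  "besov_class \<Phi> \<Psi> s p q L =
     {f \<in> Lspace p leb_Omega.
        besov_norm \<Phi> \<Psi> s p q f \<le> ennreal L \<and>
        (\<integral>x. f x \<partial>leb_Omega) = 1 \<and> (AE x in leb_Omega. 0 \<le> f x)}"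

definition couplings :: "'a measure \<Rightarrow> 'a measure \<Rightarrow> ('a \<times> 'a) measure set" where
  "couplings \<mu> \<nu> =
     {\<pi>. sets \<pi> = sets (\<mu> \<Otimes>\<^sub>M \<nu>) \<and> distr \<pi> \<mu> fst = \<mu> \<and> distr \<pi> \<nu> snd = \<nu>}"

definition wasserstein ::
  "real \<Rightarrow> 'a::real_normed_vector measure \<Rightarrow> 'a measure \<Rightarrow> ennreal" where
  "wasserstein p \<mu> \<nu> =
     ennpowr (INF \<pi>\<in>couplings \<mu> \<nu>. \<integral>\<^sup>+(x, y). ennreal (norm (x - y) powr p) \<partial>\<pi>) (1 / p)"

definition law :: "(real^'n \<Rightarrow> real) \<Rightarrow> (real^'n) measure" where
  "law f = density leb_Omega (\<lambda>x. ennreal (f x))"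

text \<open>The target carries the sigma-algebra generated by the evaluations at Borel sets, which is the
  Borel sigma-algebra of the weak topology.\<close>

definition estimators :: "nat \<Rightarrow> ((nat \<Rightarrow> real^'n) \<Rightarrow> (real^'n) measure) set" where
  "estimators n =
     PiM {..<n} (\<lambda>_. restrict_space borel Omega) \<rightarrow>\<^sub>M prob_algebra (restrict_space borel Omega)"

end

theory Submission
  imports Defs
begin

text \<open>The bound comes from Assouad's method. If a set has mass larger by \<open>\<Delta>\<close> under one measure than its
  \<open>t\<close>-neighbourhood has under another, then every coupling moves mass \<open>\<Delta>\<close> over a distance \<open>t\<close>. So an
  estimator that misjudges a fixed fraction of \<open>M\<close> cells pays at least \<open>t (M \<Delta>)\<^sup>1\<^sup>/\<^sup>p\<close> up to a constant, and
  no test recognises the state of a cell from \<open>n\<close> observations if the two densities that differ only in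
  that cell have chi-square distance at most \<open>1/n\<close>.

  If \<open>d - s < 2p\<close> one cell is enough: mass of order \<open>n\<^sup>-\<^sup>1\<^sup>/\<^sup>2\<close> is moved between two fixed bumps. Otherwise
  choose a power of two \<open>m\<close> with \<open>m\<^sup>d\<^sup>+\<^sup>s\<close> of order \<open>n\<close>. The density is a fixed bump plus a background of height
  \<open>m\<^sup>-\<^sup>s/2\<close>, which is perturbed in each of \<open>m\<^sup>d\<close> cells of side \<open>1/(4m)\<close> by a dipole of the same height.

  The Besov norm is estimated through the wavelet coefficients, which also covers \<open>s = 0\<close>. At levels with
  \<open>2\<^sup>k \<ge> m\<close> the wavelets are orthogonal to the Taylor polynomials of the bumps, which gives a factor
  \<open>(m 2\<^sup>-\<^sup>k)\<^sup>N\<close> with \<open>N > s\<close>; at levels with \<open>2\<^sup>k < m\<close> the cancellation in the dipoles gives a factor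
  \<open>2\<^sup>k/m\<close>. Against the weights \<open>2\<^sup>k\<^sup>s\<close> both sum up to a multiple of \<open>m\<^sup>s\<close>.\<close>

section \<open>Assouad's method for the Wasserstein distance\<close>


text \<open>The low background is what produces the rate. A coupling can respond to an excess of
  mass in a cell by shifting background mass slightly. The excess must therefore still be visible
  after the cell is enlarged by a distance \<open>t\<close>, and this allows \<open>t\<close> of the
  order of the cell size \<open>1/m\<close> only if the background is no higher than the excess,
  here \<open>h = m^(-s)\<close>. Mass of total order \<open>h\<close> then travels over a distance
  of order \<open>1/m\<close>, which costs \<open>m^(-1) h^(1/p)\<close>. The price is a larger
  chi-square distance: the squared change \<open>h^2\<close> is divided by the background
  \<open>h\<close>, so flipping one cell costs \<open>h m^(-d)\<close>. Equating this with
  \<open>1/n\<close> gives \<open>m^(d+s) = n\<close> and the exponent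
  \<open>(1 + s/p) / (d + s)\<close>. Since the background carries little mass, the rest sits in the
  fixed bump, which is the same for all configurations and away from all cells.

  Both constructions work for all parameters. The exponents \<open>(1 + s/p) / (d + s)\<close> and
  \<open>1 / (2p)\<close> agree for \<open>d - s = 2p\<close>, and the case distinction selects the
  smaller one, that is, the stronger bound.\<close>

lemma ennpowr_mono:
  assumes "x \<le> y" "0 \<le> a"
  shows "ennpowr x a \<le> ennpowr y a"
proof (cases "y = \<top>")
  case False
  then have "x < \<top>" "y < \<top>" using assms by (auto simp: top.not_eq_extremum)
  then show ?thesis using False assms unfolding ennpowr_def
    by (auto intro!: ennreal_leI powr_mono2 enn2real_mono)
qed (auto simp: ennpowr_def)

lemma ennpowr_ennreal: "0 \<le> x \<Longrightarrow> ennpowr (ennreal x) a = ennreal (x powr a)"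
  by (simp add: ennpowr_def)

lemma wasserstein_ge:
  assumes "1 \<le> p" "0 \<le> c"
    and "\<And>\<pi>. \<pi> \<in> couplings \<mu> \<nu> \<Longrightarrow> ennreal c \<le> (\<integral>\<^sup>+(x, y). ennreal (norm (x - y) powr p) \<partial>\<pi>)"
  shows "ennreal (c powr (1 / p)) \<le> wasserstein p \<mu> \<nu>"
proof -
  have "ennpowr (ennreal c) (1 / p) \<le> wasserstein p \<mu> \<nu>"
    unfolding wasserstein_def using assms by (intro ennpowr_mono INF_greatest) auto
  then show ?thesis using assms by (simp add: ennpowr_ennreal)
qed

text \<open>\<open>A Q\<close>, \<open>N Q\<close> and \<open>N' Q\<close> are nested with gaps of
  width \<open>t\<close>, and \<tau> is the mass from which \<open>N Q\<close> counts as full. If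
  \<nu> wrongly leaves it below \<tau>, mass \<Delta> must travel from \<open>A Q\<close> out of
  \<open>N Q\<close>; if \<nu> wrongly fills it, mass \<Delta> must arrive from outside
  \<open>N' Q\<close>.\<close>

lemma coupling_cost:
  fixes \<mu> \<nu> :: "'a::real_normed_vector measure"
  assumes \<pi>: "\<pi> \<in> couplings \<mu> \<nu>" and \<mu>: "prob_space \<mu>" and sets: "sets \<nu> = sets \<mu>"
    and fin: "finite W" and t: "0 < t" and \<Delta>: "0 \<le> \<Delta>" and p: "1 \<le> p"
    and meas: "\<And>Q. Q \<in> W \<Longrightarrow> A Q \<in> sets \<mu> \<and> N Q \<in> sets \<mu> \<and> N' Q \<in> sets \<mu>"
    and sep: "\<And>Q x y. Q \<in> W \<Longrightarrow> x \<in> A Q \<Longrightarrow> y \<in> space \<mu> - N Q \<Longrightarrow> t \<le> norm (x - y)"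
    and sep': "\<And>Q x y. Q \<in> W \<Longrightarrow> x \<in> space \<mu> - N' Q \<Longrightarrow> y \<in> N Q \<Longrightarrow> t \<le> norm (x - y)"
    and disj: "disjoint_family_on N W" and AN: "\<And>Q. Q \<in> W \<Longrightarrow> A Q \<subseteq> N Q"
    and wrong: "\<And>Q. Q \<in> W \<Longrightarrow>
      measure \<mu> (A Q) \<ge> \<tau> + \<Delta> \<and> measure \<nu> (N Q) < \<tau> \<or>
      measure \<mu> (N' Q) \<le> \<tau> - \<Delta> \<and> \<tau> \<le> measure \<nu> (N Q)"
  shows "ennreal (t powr p * (\<Delta> / 2) * card W)
    \<le> (\<integral>\<^sup>+(x, y). ennreal (norm (x - y) powr p) \<partial>\<pi>)"
proof -
  interpret \<mu>: prob_space \<mu> by fact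
  from \<pi> have s\<pi>: "sets \<pi> = sets (\<mu> \<Otimes>\<^sub>M \<nu>)" and d1: "distr \<pi> \<mu> fst = \<mu>"
    and d2: "distr \<pi> \<nu> snd = \<nu>" by (auto simp: couplings_def)
  have sp: "space \<nu> = space \<mu>" using sets by (rule sets_eq_imp_space_eq)
  have sp\<pi>: "space \<pi> = space \<mu> \<times> space \<mu>"
    using sets_eq_imp_space_eq[OF s\<pi>] by (simp add: space_pair_measure sp)
  have m1: "fst \<in> \<pi> \<rightarrow>\<^sub>M \<mu>" and m2: "snd \<in> \<pi> \<rightarrow>\<^sub>M \<nu>"
    using measurable_cong_sets[OF s\<pi> refl] by auto
  have "prob_space (distr \<pi> \<mu> fst)" using d1 \<mu> by simp
  then interpret \<pi>: prob_space \<pi> using m1 by (rule prob_space_distrD[rotated])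
  define E1 where "E1 Q = {z \<in> space \<pi>. fst z \<in> A Q \<and> snd z \<notin> N Q}" for Q
  define E2 where "E2 Q = {z \<in> space \<pi>. fst z \<notin> N' Q \<and> snd z \<in> N Q}" for Q
  define E where "E Q = (if measure \<nu> (N Q) < \<tau> then E1 Q else E2 Q)" for Q
  have mE: "E Q \<in> sets \<pi>" if "Q \<in> W" for Q
  proof -
    have [measurable]: "A Q \<in> sets \<mu>" "N Q \<in> sets \<nu>" "N' Q \<in> sets \<mu>"
      using meas[OF that] sets by auto
    note m1[measurable] m2[measurable]
    show ?thesis unfolding E_def E1_def E2_def by auto
  qed
  have fst_m: "measure \<mu> B = measure \<pi> (fst -` B \<inter> space \<pi>)" if "B \<in> sets \<mu>" for B
    using measure_distr[OF m1 that] d1 by simp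
  have snd_m: "measure \<nu> B = measure \<pi> (snd -` B \<inter> space \<pi>)" if "B \<in> sets \<nu>" for B
    using measure_distr[OF m2 that] d2 by simp
  have E\<Delta>: "\<Delta> \<le> measure \<pi> (E Q)" if Q: "Q \<in> W" for Q
  proof (cases "measure \<nu> (N Q) < \<tau>")
    case True
    then have A: "\<tau> + \<Delta> \<le> measure \<mu> (A Q)" using wrong[OF Q] by auto
    have "measure \<mu> (A Q) \<le> measure \<pi> (E Q \<union> (snd -` N Q \<inter> space \<pi>))"
      using fst_m[of "A Q"] meas[OF Q] mE[OF Q] sets True m2
      by (auto intro!: \<pi>.finite_measure_mono sets.Un simp: E_def E1_def dest: measurable_sets)
    also have "\<dots> \<le> measure \<pi> (E Q) + measure \<nu> (N Q)"
      using snd_m[of "N Q"] meas[OF Q] mE[OF Q] sets m2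
      by (auto intro!: measure_Un_le dest: measurable_sets)
    finally show ?thesis using A True by linarith
  next
    case False
    then have A: "measure \<mu> (N' Q) \<le> \<tau> - \<Delta>" using wrong[OF Q] by auto
    have "measure \<nu> (N Q) \<le> measure \<pi> (E Q \<union> (fst -` N' Q \<inter> space \<pi>))"
      using snd_m[of "N Q"] meas[OF Q] mE[OF Q] sets False m1
      by (auto intro!: \<pi>.finite_measure_mono sets.Un simp: E_def E2_def dest: measurable_sets)
    also have "\<dots> \<le> measure \<pi> (E Q) + measure \<mu> (N' Q)"
      using fst_m[of "N' Q"] meas[OF Q] mE[OF Q] sets m1
      by (auto intro!: measure_Un_le dest: measurable_sets)
    finally show ?thesis using A False by linarith
  qed
  have le1: "(\<Sum>Q\<in>W. indicator (N Q) y :: real) \<le> 1" for y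
  proof -
    have "disjoint_family_on N W" by fact
    then have "(\<Sum>Q\<in>W. indicator (N Q) y :: real) = indicator (\<Union>Q\<in>W. N Q) y"
      using fin by (intro indicator_UN_disjoint[symmetric])
    then show ?thesis by (simp add: indicator_def)
  qed
  have pt: "(\<Sum>Q\<in>W. t powr p / 2 * indicator (E Q) z) \<le> norm (fst z - snd z) powr p" 
    if z: "z \<in> space \<pi>" for z
  proof (cases "\<exists>Q\<in>W. z \<in> E Q")
    case True
    then obtain Q where Q: "Q \<in> W" "z \<in> E Q" by auto
    have "t \<le> norm (fst z - snd z)"
      using Q z sep[of Q "fst z" "snd z"] sep'[of Q "fst z" "snd z"]
      by (auto simp: E_def E1_def E2_def sp\<pi> split: if_splits)
    then have tp: "t powr p \<le> norm (fst z - snd z) powr p" using t p by (intro powr_mono2) auto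
    \<comment> \<open>Each event forces one endpoint of the pair into \<open>N Q\<close>. These sets
      are disjoint, so a pair belongs to at most two events; this is the factor 1/2 in the
      bound.\<close>
    have "(\<Sum>Q\<in>W. indicator (E Q) z :: real) \<le> (\<Sum>Q\<in>W. indicator (N Q) (fst z) + indicator (N Q) (snd z))"
      using AN by (intro sum_mono) (auto simp: E_def E1_def E2_def indicator_def)
    also have "\<dots> \<le> 2" using le1[of "fst z"] le1[of "snd z"] by (simp add: sum.distrib)
    finally have "t powr p / 2 * (\<Sum>Q\<in>W. indicator (E Q) z :: real) \<le> t powr p / 2 * 2"
      by (intro mult_left_mono) auto
    then show ?thesis using tp by (simp add: sum_distrib_left)
  next
    case False
    then have "(\<Sum>Q\<in>W. t powr p / 2 * indicator (E Q) z) = 0"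
      by (intro sum.neutral) (auto simp: indicator_def)
    then show ?thesis by simp
  qed
  have "t powr p * (\<Delta> / 2) * card W = (\<Sum>Q\<in>W. t powr p / 2 * \<Delta>)" by simp
  also have "\<dots> \<le> (\<Sum>Q\<in>W. t powr p / 2 * measure \<pi> (E Q))"
    using E\<Delta> by (intro sum_mono mult_left_mono) auto
  finally have "ennreal (t powr p * (\<Delta> / 2) * card W) \<le> ennreal (\<Sum>Q\<in>W. t powr p / 2 * measure \<pi> (E Q))"
    by (rule ennreal_leI)
  also have "\<dots> = (\<Sum>Q\<in>W. ennreal (t powr p / 2) * emeasure \<pi> (E Q))"
    by (subst sum_ennreal[symmetric]) (auto simp only: \<pi>.emeasure_eq_measure intro!: sum.cong ennreal_mult mult_nonneg_nonneg, auto)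
  also have "\<dots> = (\<integral>\<^sup>+z. (\<Sum>Q\<in>W. ennreal (t powr p / 2) * indicator (E Q) z) \<partial>\<pi>)"
    using mE by (subst nn_integral_sum) (auto simp: nn_integral_cmult_indicator)
  also have "\<dots> = (\<integral>\<^sup>+z. ennreal (\<Sum>Q\<in>W. t powr p / 2 * indicator (E Q) z) \<partial>\<pi>)"
  proof (rule nn_integral_cong)
    fix z
    have "(\<Sum>Q\<in>W. ennreal (t powr p / 2) * indicator (E Q) z) = (\<Sum>Q\<in>W. ennreal (t powr p / 2 * indicator (E Q) z))"
      by (intro sum.cong) (auto simp: indicator_def)
    then show "(\<Sum>Q\<in>W. ennreal (t powr p / 2) * indicator (E Q) z) = ennreal (\<Sum>Q\<in>W. t powr p / 2 * indicator (E Q) z)"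
      by (subst sum_ennreal[symmetric]) auto
  qed
  also have "\<dots> \<le> (\<integral>\<^sup>+(x, y). ennreal (norm (x - y) powr p) \<partial>\<pi>)"
    using pt by (intro nn_integral_mono) (auto simp: split_beta intro!: ennreal_leI)
  finally show ?thesis .
qed

section \<open>Product densities and testing between two laws\<close>

lemma PiM_density:
  fixes h :: "'a \<Rightarrow> real"
  assumes M: "prob_space M" and h [measurable]: "h \<in> borel_measurable M"
    and M1: "prob_space (density M (\<lambda>x. ennreal (h x)))" and fin: "finite I"
  shows "PiM I (\<lambda>_. density M (\<lambda>x. ennreal (h x))) = density (PiM I (\<lambda>_. M)) (\<lambda>X. \<Prod>i\<in>I. ennreal (h (X i)))"
proof -
  interpret P1: product_prob_space "\<lambda>_. density M (\<lambda>x. ennreal (h x))" UNIV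
    by (simp add: product_prob_space_def product_prob_space_axioms_def product_sigma_finite_def M1 prob_space_imp_sigma_finite)
  interpret P: product_prob_space "\<lambda>_. M" UNIV
    by (simp add: product_prob_space_def product_prob_space_axioms_def product_sigma_finite_def M prob_space_imp_sigma_finite)
  note fin [simp]
  \<comment> \<open>Rectangles determine a measure on a finite product, and on a rectangle the
    integral of a product of one-variable functions factorises.\<close>
  show ?thesis
  proof (rule P1.PiM_eqI[symmetric, OF fin])
    show "sets (density (PiM I (\<lambda>_. M)) (\<lambda>X. \<Prod>i\<in>I. ennreal (h (X i)))) = sets (PiM I (\<lambda>_. density M (\<lambda>x. ennreal (h x))))"
      by (simp cong: sets_PiM_cong)
    fix A assume A: "\<And>i. i \<in> I \<Longrightarrow> A i \<in> sets (density M (\<lambda>x. ennreal (h x)))"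
    then have A': "\<And>i. i \<in> I \<Longrightarrow> A i \<in> sets M" by simp
    have [measurable]: "Pi\<^sub>E I A \<in> sets (PiM I (\<lambda>_. M))" using A' by (intro sets_PiM_I_finite) auto
    have "emeasure (density (PiM I (\<lambda>_. M)) (\<lambda>X. \<Prod>i\<in>I. ennreal (h (X i)))) (Pi\<^sub>E I A)
       = (\<integral>\<^sup>+X. (\<Prod>i\<in>I. ennreal (h (X i))) * indicator (Pi\<^sub>E I A) X \<partial>PiM I (\<lambda>_. M))"
      by (subst emeasure_density) auto
    also have "\<dots> = (\<integral>\<^sup>+X. (\<Prod>i\<in>I. ennreal (h (X i)) * indicator (A i) (X i)) \<partial>PiM I (\<lambda>_. M))"
    proof (intro nn_integral_cong)
      fix X assume "X \<in> space (PiM I (\<lambda>_. M))"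
      then have X: "X \<in> extensional I" by (auto simp: space_PiM PiE_def)
      show "(\<Prod>i\<in>I. ennreal (h (X i))) * indicator (Pi\<^sub>E I A) X = (\<Prod>i\<in>I. ennreal (h (X i)) * indicator (A i) (X i))"
      proof (cases "X \<in> Pi\<^sub>E I A")
        case True
        then show ?thesis by (auto simp: prod.distrib indicator_def PiE_iff intro!: prod.cong)
      next
        case False
        then obtain i where "i \<in> I" "X i \<notin> A i" using X by (auto simp: PiE_iff)
        then have "(\<Prod>i\<in>I. ennreal (h (X i)) * indicator (A i) (X i)) = 0"
          using fin by (intro prod_zero) (auto intro!: bexI[of _ i])
        then show ?thesis using False by simp
      qed
    qed
    also have "\<dots> = (\<Prod>i\<in>I. \<integral>\<^sup>+x. ennreal (h x) * indicator (A i) x \<partial>M)"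
      using A' by (intro P.product_nn_integral_prod) auto
    also have "\<dots> = (\<Prod>i\<in>I. emeasure (density M (\<lambda>x. ennreal (h x))) (A i))"
      using A' by (intro prod.cong) (auto simp: emeasure_density)
    finally show "emeasure (density (PiM I (\<lambda>_. M)) (\<lambda>X. \<Prod>i\<in>I. ennreal (h (X i)))) (Pi\<^sub>E I A)
      = (\<Prod>i\<in>I. emeasure (density M (\<lambda>x. ennreal (h x))) (A i))" .
  qed
qed

text \<open>Le Cam's two-point bound: the likelihood ratio \<open>\<Lambda>\<close> of the samples satisfies
  \<open>min 1 \<Lambda> \<ge> \<Lambda> - \<Lambda>\<^sup>2 / 4\<close>, and its second moment is at most \<open>(1 + 1/n)\<^sup>n \<le> e\<close>.\<close>

lemma two_point_testing:
  fixes h :: "'a \<Rightarrow> real"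
  assumes M: "prob_space M" and h [measurable]: "h \<in> borel_measurable M" and h0: "\<And>x. 0 \<le> h x"
    and M1: "prob_space (density M (\<lambda>x. ennreal (h x)))"
    and sq: "(\<integral>\<^sup>+x. ennreal ((h x)\<^sup>2) \<partial>M) \<le> ennreal (1 + 1 / real n)" and n: "n \<ge> 1"
    and W: "W \<in> sets (PiM {..<n} (\<lambda>_. M))"
  shows "1 - exp 1 / 4 \<le> measure (PiM {..<n} (\<lambda>_. density M (\<lambda>x. ennreal (h x)))) W
     + measure (PiM {..<n} (\<lambda>_. M)) (space (PiM {..<n} (\<lambda>_. M)) - W)"
proof -
  define P where "P = PiM {..<n} (\<lambda>_. M)"
  define \<Lambda> where "\<Lambda> X = (\<Prod>i<n. h (X i))" for X
  have P1: "PiM {..<n} (\<lambda>_. density M (\<lambda>x. ennreal (h x))) = density P (\<lambda>X. ennreal (\<Lambda> X))"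
    using PiM_density[OF M h M1, of "{..<n}"] h0 by (simp add: P_def \<Lambda>_def prod_ennreal)
  interpret PP: product_prob_space "\<lambda>_. M" UNIV
    by (simp add: product_prob_space_def product_prob_space_axioms_def product_sigma_finite_def M prob_space_imp_sigma_finite)
  interpret P: prob_space P unfolding P_def by (rule prob_space_PiM) (rule M)
  interpret P1: prob_space "density P (\<lambda>X. ennreal (\<Lambda> X))" unfolding P1[symmetric]
    by (rule prob_space_PiM) (rule M1)
  have [measurable]: "\<Lambda> \<in> borel_measurable P" unfolding \<Lambda>_def P_def by measurable
  have [measurable]: "W \<in> sets P" using W by (simp add: P_def)
  have \<Lambda>0: "0 \<le> \<Lambda> X" for X unfolding \<Lambda>_def using h0 by (intro prod_nonneg) auto
  have e1: "(\<integral>\<^sup>+X. ennreal (\<Lambda> X) \<partial>P) = 1"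
    using P1.emeasure_space_1 by (simp add: emeasure_density cong: nn_integral_cong)
  have "(\<integral>\<^sup>+X. ennreal ((\<Lambda> X)\<^sup>2) \<partial>P) = (\<integral>\<^sup>+X. (\<Prod>i<n. ennreal ((h (X i))\<^sup>2)) \<partial>P)"
    using h0 by (simp add: \<Lambda>_def prod_ennreal prod_power_distrib)
  also have "\<dots> = (\<Prod>i<n. \<integral>\<^sup>+x. ennreal ((h x)\<^sup>2) \<partial>M)"
    unfolding P_def by (intro PP.product_nn_integral_prod) auto
  also have "\<dots> \<le> (\<Prod>i<n. ennreal (1 + 1 / real n))" using sq by (intro prod_mono_ennreal) auto
  also have "\<dots> = ennreal ((1 + 1 / real n) ^ n)"
    by (simp add: ennreal_power del: ennreal_plus)
  also have "\<dots> \<le> ennreal (exp 1)"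
  proof (rule ennreal_leI)
    have "(1 + 1 / real n) ^ n \<le> exp (1 / real n) ^ n"
      by (intro power_mono exp_ge_add_one_self) auto
    also have "\<dots> = exp 1" using n by (simp add: exp_of_nat_mult[symmetric])
    finally show "(1 + 1 / real n) ^ n \<le> exp 1" .
  qed
  finally have e2: "(\<integral>\<^sup>+X. ennreal ((\<Lambda> X)\<^sup>2) \<partial>P) \<le> ennreal (exp 1)" .
  have i1: "integrable P \<Lambda>" using e1 \<Lambda>0 by (intro integrableI_nonneg) auto
  have I1: "integral\<^sup>L P \<Lambda> = 1" using e1 \<Lambda>0 by (subst integral_eq_nn_integral) auto
  have i2: "integrable P (\<lambda>X. (\<Lambda> X)\<^sup>2)"
    using e2 by (intro integrableI_nonneg) (auto intro: le_less_trans)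
  have I2: "(\<integral>X. (\<Lambda> X)\<^sup>2 \<partial>P) \<le> exp 1"
    using e2 by (subst integral_eq_nn_integral) (auto intro!: enn2real_leI)
  have iW: "integrable P (\<lambda>X. \<Lambda> X * indicator W X)"
    using i1 by (rule integrable_mult_indicator[of W P \<Lambda>, simplified mult.commute real_scaleR_def, rotated]) simp
  have "measure (density P (\<lambda>X. ennreal (\<Lambda> X))) W = (\<integral>X. \<Lambda> X * indicator W X \<partial>P)"
    using \<Lambda>0 by (subst integral_eq_nn_integral)
      (auto simp: measure_def emeasure_density ennreal_mult' ennreal_indicator)
  moreover have "measure P (space P - W) = (\<integral>X. indicator (space P - W) X \<partial>P)"
    by simp
  ultimately have "measure (density P (\<lambda>X. ennreal (\<Lambda> X))) W + measure P (space P - W)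
     = (\<integral>X. \<Lambda> X * indicator W X + indicator (space P - W) X \<partial>P)"
    using iW by (subst Bochner_Integration.integral_add) (auto simp: P.emeasure_eq_measure)
  also have "\<dots> \<ge> (\<integral>X. \<Lambda> X - (\<Lambda> X)\<^sup>2 / 4 \<partial>P)"
  proof (intro integral_mono)
    fix X assume X: "X \<in> space P"
    \<comment> \<open>This settles the points outside \<open>W\<close>; on \<open>W\<close> the
      square is simply dropped. The coefficient 1/4 is the smallest for which the bound by 1 holds
      for all values of \<Lambda>.\<close>
    have "0 \<le> (\<Lambda> X / 2 - 1)\<^sup>2" by simp
    also have "\<dots> = 1 - (\<Lambda> X - (\<Lambda> X)\<^sup>2 / 4)" by (simp add: power2_eq_square field_simps)
    finally show "\<Lambda> X - (\<Lambda> X)\<^sup>2 / 4 \<le> \<Lambda> X * indicator W X + indicator (space P - W) X"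
      using X by (auto simp: indicator_def)
  qed (use i1 i2 iW in \<open>auto simp: P.emeasure_eq_measure intro!: Bochner_Integration.integrable_diff Bochner_Integration.integrable_add\<close>)
  also have "(\<integral>X. \<Lambda> X - (\<Lambda> X)\<^sup>2 / 4 \<partial>P) \<ge> 1 - exp 1 / 4"
    using i1 i2 I1 I2 by simp
  finally show ?thesis using P1 by (simp add: P_def)
qed


section \<open>Reduction of the estimation problem to testing single cells\<close>

lemma sets_law [simp]: "sets (law f) = sets (restrict_space borel Omega)"
  by (simp add: law_def) (metis sets_lborel sets_restrict_space_cong)

lemma space_law [simp]: "space (law f) = Omega"
  by (simp add: law_def space_restrict_space)

text \<open>Pairs each configuration without \<open>Q\<close> with the one that differs from it only
  in \<open>Q\<close>. A sum of errors over all configurations thereby becomes a sum of two-point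
  testing errors.\<close>

lemma sum_Pow_split:
  fixes g :: "'q set \<Rightarrow> real"
  assumes "finite T" "Q \<in> T"
  shows "(\<Sum>\<theta>\<in>Pow T. g \<theta>) = (\<Sum>\<theta>\<in>Pow (T - {Q}). g \<theta> + g (insert Q \<theta>))"
proof -
  have T: "T = insert Q (T - {Q})" using assms by auto
  have inj: "inj_on (insert Q) (Pow (T - {Q}))" by (auto simp: inj_on_def)
  have "(\<Sum>\<theta>\<in>Pow T. g \<theta>) = (\<Sum>\<theta>\<in>Pow (T - {Q}) \<union> insert Q ` Pow (T - {Q}). g \<theta>)"
    by (subst T, subst Pow_insert) simp
  also have "\<dots> = (\<Sum>\<theta>\<in>Pow (T - {Q}). g \<theta>) + (\<Sum>\<theta>\<in>insert Q ` Pow (T - {Q}). g \<theta>)"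
    using assms by (intro sum.union_disjoint) auto
  finally show ?thesis using inj by (simp add: sum.reindex sum.distrib)
qed

text \<open>An estimator is read as a family of tests: it declares the cell \<open>Q\<close>
  switched on if it gives \<open>N Q\<close> mass at least \<tau>. By \<open>coupling_cost\<close>
  the loss is controlled by the number of wrong declarations. Averaged over all configurations, the
  error in each cell is at least half of the bound from \<open>two_point_testing\<close>, so some
  configuration does at least as badly. The function \<open>h\<close> in \<open>chi\<close> is the
  likelihood ratio of two neighbouring configurations.\<close>

lemma assouad_wasserstein:
  fixes f :: "'q set \<Rightarrow> (real^'n) \<Rightarrow> real" and A N N' :: "'q \<Rightarrow> (real^'n) set"
  assumes T: "finite T" "T \<noteq> {}" and p: "1 \<le> p" and n: "n \<ge> 1"
    and fm: "\<And>\<theta>. \<theta> \<subseteq> T \<Longrightarrow> f \<theta> \<in> borel_measurable leb_Omega"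
    and f0: "\<And>\<theta> x. \<theta> \<subseteq> T \<Longrightarrow> 0 \<le> f \<theta> x"
    and prob: "\<And>\<theta>. \<theta> \<subseteq> T \<Longrightarrow> prob_space (law (f \<theta>))"
    and t: "0 < t" and \<Delta>: "0 \<le> \<Delta>"
    and meas: "\<And>Q. Q \<in> T \<Longrightarrow> A Q \<in> sets borel \<and> N Q \<in> sets borel \<and> N' Q \<in> sets borel"
    and sep: "\<And>Q x y. Q \<in> T \<Longrightarrow> x \<in> A Q \<Longrightarrow> y \<notin> N Q \<Longrightarrow> t \<le> norm (x - y)"
    and sep': "\<And>Q x y. Q \<in> T \<Longrightarrow> x \<notin> N' Q \<Longrightarrow> y \<in> N Q \<Longrightarrow> t \<le> norm (x - y)"
    and disj: "disjoint_family_on N T" and AN: "\<And>Q. Q \<in> T \<Longrightarrow> A Q \<subseteq> N Q"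
    and mass1: "\<And>\<theta> Q. \<theta> \<subseteq> T \<Longrightarrow> Q \<in> \<theta> \<Longrightarrow> \<tau> + \<Delta> \<le> measure (law (f \<theta>)) (A Q \<inter> Omega)"
    and mass0: "\<And>\<theta> Q. \<theta> \<subseteq> T \<Longrightarrow> Q \<in> T - \<theta> \<Longrightarrow> measure (law (f \<theta>)) (N' Q \<inter> Omega) \<le> \<tau> - \<Delta>"
    and chi: "\<And>\<theta> Q. Q \<in> T \<Longrightarrow> \<theta> \<subseteq> T - {Q} \<Longrightarrow> \<exists>h. h \<in> borel_measurable leb_Omega \<and> (\<forall>x. 0 \<le> h x)
       \<and> (\<forall>x\<in>Omega. f (insert Q \<theta>) x = f \<theta> x * h x)
       \<and> (\<integral>\<^sup>+x. ennreal (f \<theta> x * (h x)\<^sup>2) \<partial>leb_Omega) \<le> ennreal (1 + 1 / real n)"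
    and est: "\<mu>' \<in> estimators n"
  shows "\<exists>\<theta>\<subseteq>T. ennreal (t * (\<Delta> / 2 * card T) powr (1 / p) * ((1 - exp 1 / 4) / 2))
     \<le> (\<integral>\<^sup>+X. wasserstein p (law (f \<theta>)) (\<mu>' X) \<partial>PiM {..<n} (\<lambda>_. law (f \<theta>)))"
proof -
  define P where "P \<theta> = PiM {..<n} (\<lambda>_. law (f \<theta>))" for \<theta>
  define B :: "(real^'n) measure" where "B = restrict_space borel Omega"
  have sP: "sets (P \<theta>) = sets (PiM {..<n} (\<lambda>_. B))" for \<theta>
    unfolding P_def B_def by (intro sets_PiM_cong) auto
  define \<X> where "\<X> = space (PiM {..<n} (\<lambda>_. B))"
  have spP: "space (P \<theta>) = \<X>" for \<theta> unfolding \<X>_def by (rule sets_eq_imp_space_eq[OF sP])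
  have est': "\<mu>' \<in> PiM {..<n} (\<lambda>_. B) \<rightarrow>\<^sub>M prob_algebra B" using est by (simp add: estimators_def B_def)
  have \<mu>'sets: "sets (\<mu>' X) = sets B" "prob_space (\<mu>' X)" if "X \<in> \<X>" for X
    using measurable_space[OF est' that[unfolded \<X>_def]] by (auto simp: space_prob_algebra)
  \<comment> \<open>The event that \<open>Q\<close> is declared switched on. It is measurable
    because estimators are measurable for the evaluations at Borel sets.\<close>
  define V where "V Q = {X \<in> \<X>. \<tau> \<le> measure (\<mu>' X) (N Q \<inter> Omega)}" for Q
  have NB: "N Q \<inter> Omega \<in> sets B" "A Q \<inter> Omega \<in> sets B" "N' Q \<inter> Omega \<in> sets B" if "Q \<in> T" for Q
    using meas[OF that] by (auto simp: B_def sets_restrict_space)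
  have V: "V Q \<in> sets (PiM {..<n} (\<lambda>_. B))" if "Q \<in> T" for Q
  proof -
    have "(\<lambda>X. measure (\<mu>' X) (N Q \<inter> Omega)) \<in> borel_measurable (PiM {..<n} (\<lambda>_. B))"
      using measurable_compose[OF measurable_prob_algebraD[OF est']
          measurable_measure_subprob_algebra[OF NB(1)[OF that]]] by simp
    then show ?thesis unfolding V_def \<X>_def by measurable
  qed
  define wr where "wr \<theta> Q = (if Q \<in> \<theta> then \<X> - V Q else V Q)" for \<theta> Q
  have wrm: "wr \<theta> Q \<in> sets (P \<theta>')" if "Q \<in> T" for \<theta> \<theta>' Q
    unfolding wr_def sP using V[OF that] unfolding \<X>_def by auto
  define c where "c = card T"
  have c: "0 < c" using T by (simp add: c_def card_gt_0_iff)
  define K where "K = t * (\<Delta> / 2 * c) powr (1 / p)"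
  have K0: "0 \<le> K" unfolding K_def using t by auto
  have pt: "ennreal (K / c * (\<Sum>Q\<in>T. indicator (wr \<theta> Q) X)) \<le> wasserstein p (law (f \<theta>)) (\<mu>' X)"
    if \<theta>: "\<theta> \<subseteq> T" and X: "X \<in> \<X>" for \<theta> X
  proof -
    define W where "W = {Q \<in> T. X \<in> wr \<theta> Q}"
    have W: "finite W" "W \<subseteq> T" using T by (auto simp: W_def)
    have "(\<Sum>Q\<in>T. indicator (wr \<theta> Q) X :: real) = (\<Sum>Q\<in>W. 1)"
      using T by (intro sum.mono_neutral_cong_right) (auto simp: W_def indicator_def)
    then have cW: "(\<Sum>Q\<in>T. indicator (wr \<theta> Q) X) = real (card W)" by simp
    have "ennreal ((t powr p * (\<Delta> / 2) * card W) powr (1 / p)) \<le> wasserstein p (law (f \<theta>)) (\<mu>' X)"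
    proof (rule wasserstein_ge[OF p])
      fix \<pi> assume \<pi>: "\<pi> \<in> couplings (law (f \<theta>)) (\<mu>' X)"
      show "ennreal (t powr p * (\<Delta> / 2) * card W) \<le> (\<integral>\<^sup>+(x, y). ennreal (norm (x - y) powr p) \<partial>\<pi>)"
      proof (rule coupling_cost[OF \<pi> prob[OF \<theta>] _ W(1) t \<Delta> p, where N = "\<lambda>Q. N Q \<inter> Omega" 
            and A = "\<lambda>Q. A Q \<inter> Omega" and N' = "\<lambda>Q. N' Q \<inter> Omega" and \<tau> = \<tau>])
        show "sets (\<mu>' X) = sets (law (f \<theta>))" using \<mu>'sets[OF X] by (simp add: B_def)
        show "disjoint_family_on (\<lambda>Q. N Q \<inter> Omega) W"
          using disj W by (auto simp: disjoint_family_on_def)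
        show "A Q \<inter> Omega \<subseteq> N Q \<inter> Omega" if "Q \<in> W" for Q using AN that W by auto
        show "A Q \<inter> Omega \<in> sets (law (f \<theta>)) \<and> N Q \<inter> Omega \<in> sets (law (f \<theta>)) \<and> N' Q \<inter> Omega \<in> sets (law (f \<theta>))"
          if "Q \<in> W" for Q using NB[of Q] that W by (auto simp: B_def)
        show "t \<le> norm (x - y)" if "Q \<in> W" "x \<in> A Q \<inter> Omega" "y \<in> space (law (f \<theta>)) - N Q \<inter> Omega" for Q x y
          using that W by (intro sep[of Q]) auto
        show "t \<le> norm (x - y)" if "Q \<in> W" "x \<in> space (law (f \<theta>)) - N' Q \<inter> Omega" "y \<in> N Q \<inter> Omega" for Q x y
          using that W by (intro sep'[of Q]) auto
        show "\<tau> + \<Delta> \<le> measure (law (f \<theta>)) (A Q \<inter> Omega) \<and> measure (\<mu>' X) (N Q \<inter> Omega) < \<tau> \<or>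
              measure (law (f \<theta>)) (N' Q \<inter> Omega) \<le> \<tau> - \<Delta> \<and> \<tau> \<le> measure (\<mu>' X) (N Q \<inter> Omega)"
          if Q: "Q \<in> W" for Q
          using Q W mass1[OF \<theta>, of Q] mass0[OF \<theta>, of Q] X by (auto simp: W_def wr_def V_def split: if_splits)
      qed
    qed (use \<Delta> in auto)
    moreover have "K / c * card W \<le> (t powr p * (\<Delta> / 2) * card W) powr (1 / p)"
    proof -
      \<comment> \<open>The fraction of misjudged cells. The inequality \<open>z <= z^(1/p)\<close>
        makes the bound linear in the number of wrong cells, so that its expectation is a sum of
        error probabilities.\<close>
      define z where "z = real (card W) / c"
      have z: "0 \<le> z" "z \<le> 1" using T W c card_mono[of T W] by (auto simp: z_def c_def divide_simps)
      have zp: "z \<le> z powr (1 / p)"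
      proof (cases "z = 0")
        case False
        then have "z powr 1 \<le> z powr (1 / p)" using z p by (intro powr_mono') auto
        then show ?thesis using z by simp
      qed simp
      have "(t powr p * (\<Delta> / 2) * card W) = t powr p * ((\<Delta> / 2 * c) * z)"
        using c by (simp add: z_def)
      then have "(t powr p * (\<Delta> / 2) * card W) powr (1 / p) = (t powr p * ((\<Delta> / 2 * c) * z)) powr (1 / p)"
        by (rule arg_cong)
      also have "\<dots> = (t powr p) powr (1 / p) * ((\<Delta> / 2 * c) powr (1 / p) * z powr (1 / p))"
        using \<Delta> z by (simp only: powr_mult)
      also have "(t powr p) powr (1 / p) = t" using t p by (subst powr_powr) auto
      finally have "(t powr p * (\<Delta> / 2) * card W) powr (1 / p) = t * ((\<Delta> / 2 * c) powr (1 / p) * z powr (1 / p))" .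
      then show ?thesis using zp K0 mult_left_mono[OF zp K0] by (simp add: K_def z_def mult.assoc)
    qed
    ultimately show ?thesis unfolding cW using ennreal_leI order_trans by blast
  qed
  have lower: "ennreal (K / c * (\<Sum>Q\<in>T. measure (P \<theta>) (wr \<theta> Q)))
     \<le> (\<integral>\<^sup>+X. wasserstein p (law (f \<theta>)) (\<mu>' X) \<partial>P \<theta>)" if \<theta>: "\<theta> \<subseteq> T" for \<theta>
  proof -
    interpret P: prob_space "P \<theta>" unfolding P_def by (intro prob_space_PiM prob \<theta>)
    have "ennreal (K / c * (\<Sum>Q\<in>T. measure (P \<theta>) (wr \<theta> Q)))
       = (\<Sum>Q\<in>T. ennreal (K / c) * emeasure (P \<theta>) (wr \<theta> Q))"
      unfolding sum_distrib_left using K0 by (subst sum_ennreal[symmetric]) (auto simp only: P.emeasure_eq_measure intro!: sum.cong ennreal_mult mult_nonneg_nonneg, auto)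
    also have "\<dots> = (\<integral>\<^sup>+X. (\<Sum>Q\<in>T. ennreal (K / c) * indicator (wr \<theta> Q) X) \<partial>P \<theta>)"
      using wrm by (subst nn_integral_sum) (auto simp: nn_integral_cmult_indicator)
    \<comment> \<open>Comparison with a simple function avoids the question whether the distance
      depends measurably on the sample.\<close>
    also have "\<dots> \<le> (\<integral>\<^sup>+X. wasserstein p (law (f \<theta>)) (\<mu>' X) \<partial>P \<theta>)"
    proof (intro nn_integral_mono)
      fix X assume "X \<in> space (P \<theta>)"
      then have "ennreal (K / c * (\<Sum>Q\<in>T. indicator (wr \<theta> Q) X)) \<le> wasserstein p (law (f \<theta>)) (\<mu>' X)"
        by (intro pt \<theta>) (simp add: spP)
      moreover have "(\<Sum>Q\<in>T. ennreal (K / c) * indicator (wr \<theta> Q) X) = (\<Sum>Q\<in>T. ennreal (K / c * indicator (wr \<theta> Q) X))"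
        by (intro sum.cong) (auto simp: indicator_def)
      ultimately show "(\<Sum>Q\<in>T. ennreal (K / c) * indicator (wr \<theta> Q) X) \<le> wasserstein p (law (f \<theta>)) (\<mu>' X)"
        unfolding sum_distrib_left using K0 by (subst (asm) sum_ennreal[symmetric]) auto
    qed
    finally show ?thesis .
  qed
  \<comment> \<open>Under \<theta> the error is \<open>V Q\<close>, a false alarm; under
    \<open>insert Q \<theta>\<close> it is the complement of \<open>V Q\<close>. These are the two
    error probabilities of one and the same test.\<close>
  have test: "1 - exp 1 / 4 \<le> measure (P \<theta>) (wr \<theta> Q) + measure (P (insert Q \<theta>)) (wr (insert Q \<theta>) Q)"
    if Q: "Q \<in> T" and \<theta>: "\<theta> \<subseteq> T - {Q}" for \<theta> Q
  proof -
    obtain h where h: "h \<in> borel_measurable leb_Omega" "\<And>x. 0 \<le> h x"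
       "\<And>x. x \<in> Omega \<Longrightarrow> f (insert Q \<theta>) x = f \<theta> x * h x"
       "(\<integral>\<^sup>+x. ennreal (f \<theta> x * (h x)\<^sup>2) \<partial>leb_Omega) \<le> ennreal (1 + 1 / real n)"
      using chi[OF Q \<theta>] by auto
    have \<theta>T: "\<theta> \<subseteq> T" "insert Q \<theta> \<subseteq> T" using Q \<theta> by auto
    note [measurable] = h(1) fm[OF \<theta>T(1)] fm[OF \<theta>T(2)]
    have hm: "h \<in> borel_measurable (law (f \<theta>))" unfolding law_def by simp
    have eq: "law (f (insert Q \<theta>)) = density (law (f \<theta>)) (\<lambda>x. ennreal (h x))"
      unfolding law_def using h(2,3) f0[OF \<theta>T(1)]
      by (subst density_density_eq) (auto intro!: density_cong AE_I2 simp: ennreal_mult' space_restrict_space)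
    have "(\<integral>\<^sup>+x. ennreal ((h x)\<^sup>2) \<partial>law (f \<theta>)) = (\<integral>\<^sup>+x. ennreal (f \<theta> x * (h x)\<^sup>2) \<partial>leb_Omega)"
      unfolding law_def using f0[OF \<theta>T(1)] by (subst nn_integral_density) (auto simp: ennreal_mult')
    then have sq: "(\<integral>\<^sup>+x. ennreal ((h x)\<^sup>2) \<partial>law (f \<theta>)) \<le> ennreal (1 + 1 / real n)" using h(4) by simp
    have "\<X> - V Q \<in> sets (P \<theta>)" using wrm[OF Q, of "{Q}"] by (simp add: wr_def)
    then have "1 - exp 1 / 4 \<le> measure (P (insert Q \<theta>)) (\<X> - V Q) + measure (P \<theta>) (\<X> - (\<X> - V Q))"
      using two_point_testing[OF prob[OF \<theta>T(1)] hm h(2) _ sq n, of "\<X> - V Q"] prob[OF \<theta>T(2)] spP[of \<theta>]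
      by (simp add: eq[symmetric] P_def)
    moreover have "\<X> - (\<X> - V Q) = V Q" by (auto simp: V_def)
    ultimately show ?thesis using \<theta> by (auto simp: wr_def)
  qed
  define S where "S \<theta> = (\<Sum>Q\<in>T. measure (P \<theta>) (wr \<theta> Q))" for \<theta>
  have "(\<Sum>\<theta>\<in>Pow T. S \<theta>) = (\<Sum>Q\<in>T. \<Sum>\<theta>\<in>Pow T. measure (P \<theta>) (wr \<theta> Q))"
    unfolding S_def by (rule sum.swap)
  also have "\<dots> = (\<Sum>Q\<in>T. \<Sum>\<theta>\<in>Pow (T - {Q}). measure (P \<theta>) (wr \<theta> Q) + measure (P (insert Q \<theta>)) (wr (insert Q \<theta>) Q))"
    using T by (intro sum.cong refl sum_Pow_split) auto
  also have "\<dots> \<ge> (\<Sum>Q\<in>T. \<Sum>\<theta>\<in>Pow (T - {Q}). 1 - exp 1 / 4)"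
    using test by (intro sum_mono) auto
  also have "(\<Sum>Q\<in>T. \<Sum>\<theta>\<in>Pow (T - {Q}). 1 - exp 1 / 4) = (\<Sum>\<theta>\<in>Pow T. c * ((1 - exp 1 / 4) / 2))"
  proof -
    have "real (card (Pow (T - {Q}))) = real (card (Pow T)) / 2" if "Q \<in> T" for Q
    proof -
      have "card T = Suc (card (T - {Q}))" using T that by (metis card_Suc_Diff1)
      then show ?thesis using T by (simp add: card_Pow)
    qed
    then have "(\<Sum>Q\<in>T. \<Sum>\<theta>\<in>Pow (T - {Q}). 1 - exp 1 / 4) = (\<Sum>Q\<in>T. real (card (Pow T)) / 2 * (1 - exp 1 / 4))"
      by (intro sum.cong) (simp_all only: sum_constant)
    then show ?thesis by (simp add: c_def)
  qed
  \<comment> \<open>Were all configurations below the average bound, their sum would be too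
    small.\<close>
  finally have "\<exists>\<theta>\<in>Pow T. c * ((1 - exp 1 / 4) / 2) \<le> S \<theta>"
    using T by (meson not_le sum_strict_mono finite_Pow_iff Pow_not_empty)
  then obtain \<theta> where \<theta>: "\<theta> \<subseteq> T" "c * ((1 - exp 1 / 4) / 2) \<le> S \<theta>" by auto
  have "K * ((1 - exp 1 / 4) / 2) = K / c * (c * ((1 - exp 1 / 4) / 2))" using c by simp
  also have "\<dots> \<le> K / c * S \<theta>" using K0 \<theta> by (intro mult_left_mono) auto
  finally have "ennreal (K * ((1 - exp 1 / 4) / 2)) \<le> (\<integral>\<^sup>+X. wasserstein p (law (f \<theta>)) (\<mu>' X) \<partial>P \<theta>)"
    using lower[OF \<theta>(1)] unfolding S_def by (meson ennreal_leI order_trans)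
  then show ?thesis using \<theta> unfolding P_def K_def c_def by blast
qed


section \<open>Wavelet bounds from the Bernstein inequality\<close>

lemma prob_space_leb_Omega: "prob_space (leb_Omega :: (real^'n) measure)"
proof
  have "emeasure lborel (Omega :: (real^'n) set) = 1"
  proof -
    have "measure lborel (Omega :: (real^'n) set) = 1"
      by (subst content_cbox_cart) (auto simp: interval_ne_empty_cart)
    then show ?thesis using emeasure_lborel_cbox_finite[of 0 "1::real^'n"] by (subst emeasure_eq_ennreal_measure) auto
  qed
  then show "emeasure leb_Omega (space (leb_Omega :: (real^'n) measure)) = 1"
    by (simp add: space_restrict_space emeasure_restrict_space)
qed

lemma space_leb_Omega [simp]: "space leb_Omega = Omega"
  by (simp add: space_restrict_space)

lemma sets_leb_Omega: "sets leb_Omega = sets (restrict_space borel Omega)"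
  by (rule sets_restrict_space_cong) simp

lemma measurable_leb_Omega_continuous:
  fixes g :: "real^'n \<Rightarrow> 'b::topological_space"
  assumes "continuous_on Omega g"
  shows "g \<in> borel_measurable leb_Omega"
  using borel_measurable_continuous_on_restrict[OF assms] measurable_cong_sets[OF sets_leb_Omega refl]
  by blast

lemma integrable_leb_Omega_bounded:
  fixes g :: "real^'n \<Rightarrow> real"
  assumes "g \<in> borel_measurable leb_Omega" and "\<And>x. x \<in> Omega \<Longrightarrow> \<bar>g x\<bar> \<le> M"
  shows "integrable leb_Omega g"
proof -
  interpret prob_space "leb_Omega :: (real^'n) measure" by (rule prob_space_leb_Omega)
  show ?thesis using assms by (intro integrable_const_bound[of _ M]) auto
qed

lemma integrable_leb_Omega_continuous:
  fixes g :: "real^'n \<Rightarrow> real"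
  assumes "continuous_on Omega g"
  shows "integrable leb_Omega g"
proof -
  have "bounded (g ` Omega)" using assms by (intro compact_imp_bounded compact_continuous_image) auto
  then obtain M where "\<forall>x\<in>g ` Omega. norm x \<le> M" unfolding bounded_iff by blast
  then show ?thesis
    using assms by (intro integrable_leb_Omega_bounded[of _ M] measurable_leb_Omega_continuous) auto
qed

lemma Ck_Holder_continuous_on: "Ck_Holder k a S f \<Longrightarrow> continuous_on S f"
proof (cases k)
  case (Suc l)
  moreover assume "Ck_Holder k a S f"
  ultimately obtain D where "\<forall>x\<in>S. (f has_derivative (\<lambda>h. \<Sum>i\<in>UNIV. D i x * h $ i)) (at x within S)"
    by auto
  then show ?thesis by (intro has_derivative_continuous_on) auto
qed auto

text \<open>A continuous function exceeds \<open>b\<close> on an open subset of the interior, and a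
  nonempty open set is not a null set. This turns the Bernstein inequality for
  \<open>t = \<top>\<close>, which speaks of an essential supremum, into a pointwise gradient
  bound.\<close>

lemma AE_leb_Omega_le_imp_interior:
  fixes g :: "real^'n \<Rightarrow> real"
  assumes cont: "continuous_on Omega g" and ae: "AE x in leb_Omega. g x \<le> b" and x: "x \<in> box 0 1"
  shows "g x \<le> b"
proof (rule ccontr)
  assume "\<not> g x \<le> b"
  define U where "U = {y \<in> box 0 1. g y > b}"
  have "continuous_on (box 0 1) g" using cont continuous_on_subset box_subset_cbox by blast
  then have "open (g -` {b<..} \<inter> box 0 1)"
    using continuous_on_open_vimage[OF open_box, of 0 1 g] open_greaterThan by blast
  moreover have "g -` {b<..} \<inter> box 0 1 = U" by (auto simp: U_def)
  ultimately have U: "open U" by simp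
  have "x \<in> U" using x \<open>\<not> g x \<le> b\<close> by (simp add: U_def)
  moreover have "negligible U"
  proof -
    have "AE x in lborel. x \<in> Omega \<longrightarrow> g x \<le> b"
      using ae by (subst (asm) AE_restrict_space_iff) auto
    then have "AE x in lborel. x \<notin> U"
    proof eventually_elim
      case (elim x)
      then show ?case using box_subset_cbox[of 0 "1::real^'n"] by (auto simp: U_def)
    qed
    then have "U \<in> null_sets lborel" using U by (subst AE_iff_null_sets) auto
    then show ?thesis by (simp add: negligible_iff_null_sets null_sets_completionI)
  qed
  ultimately show False using U open_not_negligible by blast
qed

text \<open>In the interior the derivative within the cube is the ordinary one and hence unique, so
  the choice made by \<open>frechet_derivative\<close> must agree with any derivative at
  hand.\<close>

lemma grad_within_eq:
  fixes u :: "real^'n \<Rightarrow> real"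
  assumes "(u has_derivative (\<lambda>h. \<Sum>i\<in>UNIV. D i * h $ i)) (at x within Omega)" and x: "x \<in> box 0 1"
  shows "grad_within Omega u x = (\<chi> i. D i)"
proof -
  have at: "at x within Omega = at x" using x by (intro at_within_interior) (simp add: interior_cbox)
  then have "frechet_derivative u (at x within Omega) = (\<lambda>h. \<Sum>i\<in>UNIV. D i * h $ i)"
    using frechet_derivative_at[of u _ x] assms(1) by metis
  moreover have "(\<Sum>i\<in>UNIV. D i * axis j 1 $ i) = D j" for j
  proof -
    have "(\<Sum>i\<in>UNIV. D i * axis j 1 $ i) = (\<chi> i. D i) \<bullet> axis j 1" unfolding inner_vec_def by simp
    also have "\<dots> = D j" by (simp add: inner_axis)
    finally show ?thesis .
  qed
  ultimately show ?thesis unfolding grad_within_def by simp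
qed

text \<open>The point may lie on the boundary of the unit cube. It therefore becomes a corner of the
  small cube, which extends in every coordinate away from the nearer face.\<close>

lemma quarter_cube:
  fixes x0 :: "real^'n"
  assumes x0: "x0 \<in> Omega" and \<rho>: "0 < \<rho>" "\<rho> \<le> 1 / 2"
  obtains a b where "cbox a b \<subseteq> Omega" "\<And>y. y \<in> cbox a b \<Longrightarrow> norm (y - x0) \<le> \<rho>"
    "measure lborel (cbox a b) = (\<rho> / CARD('n)) ^ CARD('n)"
proof -
  \<comment> \<open>With this side length the sum of the coordinate differences, and with it the
    Euclidean norm, is at most \<rho>.\<close>
  define \<eta> where "\<eta> = \<rho> / CARD('n)"
  have \<eta>: "0 < \<eta>" "\<eta> \<le> 1 / 2"
  proof -
    show "0 < \<eta>" using \<rho> by (simp add: \<eta>_def)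
    have "\<eta> \<le> \<rho>" using \<rho> by (simp add: \<eta>_def divide_le_eq Suc_leI)
    then show "\<eta> \<le> 1 / 2" using \<rho> by simp
  qed
  define a where "a = (\<chi> i. if x0 $ i \<le> 1 / 2 then x0 $ i else x0 $ i - \<eta>)"
  define b where "b = (\<chi> i. if x0 $ i \<le> 1 / 2 then x0 $ i + \<eta> else x0 $ i)"
  have x01: "0 \<le> x0 $ i" "x0 $ i \<le> 1" for i using x0 by (auto simp: mem_box_cart)
  show ?thesis
  proof
    show "cbox a b \<subseteq> Omega"
    proof
      fix y assume y: "y \<in> cbox a b"
      have "0 \<le> y $ i \<and> y $ i \<le> 1" for i
        using y[unfolded mem_box_cart, rule_format, of i] x01[of i] \<eta> by (auto simp: a_def b_def split: if_splits)
      then show "y \<in> Omega" by (simp add: mem_box_cart)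
    qed
    show "norm (y - x0) \<le> \<rho>" if y: "y \<in> cbox a b" for y
    proof -
      have "norm (y - x0) \<le> (\<Sum>i\<in>UNIV. \<bar>(y - x0) $ i\<bar>)" by (rule norm_le_l1_cart)
      also have "\<dots> \<le> (\<Sum>i\<in>(UNIV :: 'n set). \<eta>)"
      proof (rule sum_mono)
        fix i
        show "\<bar>(y - x0) $ i\<bar> \<le> \<eta>"
          using y[unfolded mem_box_cart, rule_format, of i] \<eta> by (auto simp: a_def b_def split: if_splits)
      qed
      finally show ?thesis by (simp add: \<eta>_def)
    qed
    have "b $ i - a $ i = \<eta>" for i by (simp add: a_def b_def)
    moreover have "a \<in> cbox a b" using \<eta> by (auto simp: mem_box_cart a_def b_def)
    ultimately have "measure lborel (cbox a b) = \<eta> ^ CARD('n)" by (subst content_cbox_cart) auto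
    then show "measure lborel (cbox a b) = (\<rho> / CARD('n)) ^ CARD('n)" by (simp add: \<eta>_def)
  qed
qed

section \<open>Lipschitz and sup-norm bounds for spans of the coarse levels\<close>

context wavelet_system
begin

abbreviation coarse :: "nat \<Rightarrow> (real^'n \<Rightarrow> real) set" where
  "coarse j \<equiv> \<Phi> \<union> (\<Union>k<j. \<Psi> k)"

lemma coarse_subset: "coarse j \<subseteq> \<Phi> \<union> (\<Union>j. \<Psi> j)"
  by auto

lemma span_on_coarse_C1:
  assumes r: "1 < r" and u: "u \<in> span_on Omega (coarse j)"
  obtains D where "\<And>x. x \<in> Omega \<Longrightarrow> (u has_derivative (\<lambda>h. \<Sum>i\<in>UNIV. D i x * h $ i)) (at x within Omega)"
    "\<And>i. continuous_on Omega (D i)"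
proof -
  obtain F c where F: "finite F" "F \<subseteq> coarse j" "\<And>x. x \<in> Omega \<Longrightarrow> u x = (\<Sum>v\<in>F. c v * v x)"
    using u by (auto simp: span_on_def)
  have ex: "\<exists>D. (\<forall>x\<in>Omega. (v has_derivative (\<lambda>h. \<Sum>i\<in>UNIV. D i x * h $ i)) (at x within Omega)) \<and>
       (\<forall>i. continuous_on Omega (D i))" if "v \<in> F" for v
  proof -
    \<comment> \<open>Since \<open>r > 1\<close>, at least one derivative can be split off the
      recursion in \<open>Ck_Holder\<close>.\<close>
    obtain k where k: "nat \<lfloor>r\<rfloor> = Suc k" using r by (cases "nat \<lfloor>r\<rfloor>") (auto simp: le_floor_iff)
    have "v \<in> Cr_on r Omega" using that F(2) regularity by blast
    then have "Ck_Holder (Suc k) (frac r) Omega v" by (simp add: Cr_on_def k)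
    then obtain D where "\<forall>x\<in>Omega. (v has_derivative (\<lambda>h. \<Sum>i\<in>UNIV. D i x * h $ i)) (at x within Omega)"
      "\<forall>i. Ck_Holder k (frac r) Omega (D i)" by (auto simp only: Ck_Holder.simps)
    then show ?thesis by (intro exI[of _ D]) (auto intro: Ck_Holder_continuous_on)
  qed
  define R where "R v D \<longleftrightarrow> (\<forall>x\<in>Omega. (v has_derivative (\<lambda>h. \<Sum>i\<in>UNIV. D i x * h $ i)) (at x within Omega)) \<and>
       (\<forall>i. continuous_on Omega (D i))" for v and D :: "'n \<Rightarrow> real^'n \<Rightarrow> real"
  have "\<forall>v\<in>F. \<exists>D. R v D" using ex unfolding R_def by blast
  then obtain D where "\<forall>v\<in>F. R v (D v)" by (auto dest: bchoice)
  then have D: "\<And>v x. v \<in> F \<Longrightarrow> x \<in> Omega \<Longrightarrow>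
      (v has_derivative (\<lambda>h. \<Sum>i\<in>UNIV. D v i x * h $ i)) (at x within Omega)"
    "\<And>v i. v \<in> F \<Longrightarrow> continuous_on Omega (D v i)" unfolding R_def by auto
  show ?thesis
  proof
    fix x :: "real^'n" assume x: "x \<in> Omega"
    have "((\<lambda>x. \<Sum>v\<in>F. c v * v x) has_derivative (\<lambda>h. \<Sum>v\<in>F. c v * (\<Sum>i\<in>UNIV. D v i x * h $ i))) (at x within Omega)"
      using D(1) x by (intro has_derivative_sum has_derivative_mult_right) auto
    moreover have "(\<lambda>h. \<Sum>v\<in>F. c v * (\<Sum>i\<in>UNIV. D v i x * h $ i))
        = (\<lambda>h. \<Sum>i\<in>UNIV. (\<Sum>v\<in>F. c v * D v i x) * h $ i)"
    proof
      fix h :: "real^'n"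
      have "(\<Sum>v\<in>F. c v * (\<Sum>i\<in>UNIV. D v i x * h $ i)) = (\<Sum>v\<in>F. \<Sum>i\<in>UNIV. c v * D v i x * h $ i)"
        by (simp add: sum_distrib_left mult.assoc)
      also have "\<dots> = (\<Sum>i\<in>UNIV. \<Sum>v\<in>F. c v * D v i x * h $ i)" by (rule sum.swap)
      finally show "(\<Sum>v\<in>F. c v * (\<Sum>i\<in>UNIV. D v i x * h $ i)) = (\<Sum>i\<in>UNIV. (\<Sum>v\<in>F. c v * D v i x) * h $ i)"
        by (simp add: sum_distrib_right)
    qed
    ultimately show "(u has_derivative (\<lambda>h. \<Sum>i\<in>UNIV. (\<Sum>v\<in>F. c v * D v i x) * h $ i)) (at x within Omega)"
      using F(3) x by (intro has_derivative_transform[of x Omega u]) auto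
  next
    show "continuous_on Omega (\<lambda>x. \<Sum>v\<in>F. c v * D v i x)" for i
      using D(2) by (intro continuous_intros) auto
  qed
qed

lemma span_on_coarse_continuous:
  assumes "1 < r" "u \<in> span_on Omega (coarse j)"
  shows "continuous_on Omega u"
proof -
  obtain D where "\<And>x. x \<in> Omega \<Longrightarrow> (u has_derivative (\<lambda>h. \<Sum>i\<in>UNIV. D i x * h $ i)) (at x within Omega)"
    using span_on_coarse_C1[OF assms] by blast
  then show ?thesis by (rule has_derivative_continuous_on)
qed

lemma coarse_subset_span: "coarse j \<subseteq> span_on Omega (coarse j)"
proof
  fix v assume "v \<in> coarse j"
  then show "v \<in> span_on Omega (coarse j)"
    unfolding span_on_def by (auto intro!: exI[of _ "{v}"] exI[of _ "\<lambda>_. 1"])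
qed

text \<open>The Bernstein inequality for \<open>t = \<top>\<close> bounds the gradient almost
  everywhere. Continuity of the derivative extends the bound to the interior and then to the closed
  cube, and the mean value inequality on this convex set gives the Lipschitz constant.\<close>

lemma span_on_coarse_Lipschitz:
  assumes r: "1 < r"
  shows "\<exists>C\<ge>1. \<forall>j. \<forall>u\<in>span_on Omega (coarse j). \<forall>M. (\<forall>x\<in>Omega. \<bar>u x\<bar> \<le> M) \<longrightarrow>
    (\<forall>x\<in>Omega. \<forall>y\<in>Omega. \<bar>u x - u y\<bar> \<le> C * 2 ^ j * M * norm (x - y))"
proof -
  obtain C0 :: real where C0: "\<And>j t u. t \<ge> 1 \<Longrightarrow> u \<in> span_on Omega (coarse j) \<Longrightarrow>
    Lnorm t leb_Omega (\<lambda>x. ennreal (norm (grad_within Omega u x))) \<le> ennreal (C0 * 2 ^ j) * Lnorm_Omega t u"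
    using bernstein by blast
  define C where "C = max 1 C0"
  show ?thesis
  proof (intro exI[of _ C] conjI allI ballI impI)
    show "1 \<le> C" by (simp add: C_def)
    fix j u M and x y :: "real^'n"
    assume u: "u \<in> span_on Omega (coarse j)" and M: "\<forall>x\<in>Omega. \<bar>u x\<bar> \<le> M"
      and x: "x \<in> Omega" and y: "y \<in> Omega"
    obtain D where D: "\<And>x. x \<in> Omega \<Longrightarrow> (u has_derivative (\<lambda>h. \<Sum>i\<in>UNIV. D i x * h $ i)) (at x within Omega)"
      "\<And>i. continuous_on Omega (D i)" using span_on_coarse_C1[OF r u] by blast
    have M0: "0 \<le> M" using M x by force
    define b where "b = C * 2 ^ j * M"
    have b0: "0 \<le> b" using M0 by (simp add: b_def C_def)
    have "continuous_on Omega u" using span_on_coarse_continuous[OF r u] .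
    then have "u \<in> borel_measurable leb_Omega" by (rule measurable_leb_Omega_continuous)
    then have "Lnorm_Omega \<top> u \<le> ennreal M"
      using M unfolding Lnorm_def by (auto intro!: esssup_I AE_I2 ennreal_leI)
    then have "Lnorm \<top> leb_Omega (\<lambda>x. ennreal (norm (grad_within Omega u x))) \<le> ennreal (C0 * 2 ^ j) * ennreal M"
      using C0[of \<top> u j] u by (meson order_trans mult_left_mono top_greatest zero_le)
    also have "\<dots> \<le> ennreal (C * 2 ^ j) * ennreal M"
      by (intro mult_right_mono ennreal_leI) (auto simp: C_def)
    also have "\<dots> = ennreal b" using M0 by (simp add: b_def C_def ennreal_mult')
    finally have "esssup leb_Omega (\<lambda>x. ennreal (norm (grad_within Omega u x))) \<le> ennreal b"
      by (simp add: Lnorm_def)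
    note ess = this
    have ae: "AE x in leb_Omega. norm (grad_within Omega u x) \<le> b"
      using esssup_AE[of "\<lambda>x. ennreal (norm (grad_within Omega u x))" leb_Omega]
    proof eventually_elim
      case (elim x)
      then have "ennreal (norm (grad_within Omega u x)) \<le> ennreal b" using ess by (rule order_trans)
      then show ?case using b0 by simp
    qed
    define G where "G x = (\<chi> i. D i x)" for x
    have Gc: "continuous_on Omega G" unfolding G_def using D(2) by (intro continuous_on_vec_lambda) auto
    \<comment> \<open>\<open>grad_within\<close> has been identified with \<open>G\<close> only in
      the interior, so the boundary is discarded as a null set.\<close>
    have "(Omega :: (real^'n) set) - box 0 1 \<in> null_sets lborel"
      by (auto simp: null_sets_def emeasure_Diff emeasure_lborel_cbox_eq emeasure_lborel_box_eq box_subset_cbox)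
    then have "AE x in lborel. x \<notin> Omega - box 0 (1::real^'n)" by (rule AE_not_in)
    then have "AE x in lborel. x \<in> Omega \<longrightarrow> x \<in> box 0 (1::real^'n)"
      by eventually_elim auto
    then have bd: "AE x in leb_Omega. x \<in> box 0 (1::real^'n)"
      by (subst AE_restrict_space_iff) auto
    have "AE x in leb_Omega. norm (G x) \<le> b"
      using ae bd
    proof eventually_elim
      case (elim x)
      then have "grad_within Omega u x = G x"
        unfolding G_def using D(1)[of x] box_subset_cbox[of 0 "1::real^'n"] by (intro grad_within_eq) auto
      then show ?case using elim by simp
    qed
    then have Gb: "norm (G x) \<le> b" if "x \<in> box 0 1" for x
      using that Gc by (intro AE_leb_Omega_le_imp_interior[of "\<lambda>x. norm (G x)"] continuous_intros)
    have cl: "closure (box 0 (1::real^'n)) = Omega"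
      by (rule closure_box) (auto simp: box_ne_empty Basis_vec_def inner_axis)
    have Gb': "norm (G x) \<le> b" if "x \<in> Omega" for x
      using continuous_on_closure_norm_le[of "box 0 1" G b x] Gb Gc that unfolding cl by blast
    have "norm (u y - u x) \<le> b * norm (y - x)"
    proof (rule differentiable_bound[where S = Omega, OF _ D(1)])
      fix x :: "real^'n" assume "x \<in> Omega"
      show "onorm (\<lambda>h. \<Sum>i\<in>UNIV. D i x * h $ i) \<le> b"
      proof (rule onorm_le)
        fix h :: "real^'n"
        have "(\<Sum>i\<in>UNIV. D i x * h $ i) = G x \<bullet> h" by (simp add: G_def inner_vec_def)
        then have "norm (\<Sum>i\<in>UNIV. D i x * h $ i) \<le> norm (G x) * norm h"
          using Cauchy_Schwarz_ineq2[of "G x" h] by simp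
        also have "\<dots> \<le> b * norm h" using Gb'[OF \<open>x \<in> Omega\<close>] by (intro mult_right_mono) auto
        finally show "norm (\<Sum>i\<in>UNIV. D i x * h $ i) \<le> b * norm h" .
      qed
    qed (use x y in auto)
    then show "\<bar>u x - u y\<bar> \<le> C * 2 ^ j * M * norm (x - y)"
      by (simp add: b_def abs_minus_commute norm_minus_commute)
  qed
qed

text \<open>By the Lipschitz bound, \<open>|u|\<close> exceeds half of its maximum on a cube of side of order \<open>2\<^sup>-\<^sup>j\<close>.\<close>

lemma nikolskii:
  assumes r: "1 < r"
  shows "\<exists>K\<ge>1. \<forall>j. \<forall>u\<in>span_on Omega (coarse j). \<forall>x\<in>Omega.
    (u x)\<^sup>2 \<le> K * 2 ^ (j * CARD('n)) * (\<integral>y. (u y)\<^sup>2 \<partial>leb_Omega)"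
proof -
  obtain C where C: "C \<ge> 1" "\<And>j u M x y. u \<in> span_on Omega (coarse j) \<Longrightarrow> (\<And>x. x \<in> Omega \<Longrightarrow> \<bar>u x\<bar> \<le> M) \<Longrightarrow>
     x \<in> Omega \<Longrightarrow> y \<in> Omega \<Longrightarrow> \<bar>u x - u y\<bar> \<le> C * 2 ^ j * M * norm (x - y)"
  proof -
    obtain C where "C \<ge> 1" and C: "\<forall>j. \<forall>u\<in>span_on Omega (coarse j). \<forall>M. (\<forall>x\<in>Omega. \<bar>u x\<bar> \<le> M) \<longrightarrow>
      (\<forall>x\<in>Omega. \<forall>y\<in>Omega. \<bar>u x - u y\<bar> \<le> C * 2 ^ j * M * norm (x - y))"
      using span_on_coarse_Lipschitz[OF r] by (elim exE conjE)
    show ?thesis using \<open>C \<ge> 1\<close> C by (intro that[of C]) simp_all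
  qed
  define d where "d = CARD('n)"
  have d: "1 \<le> d" by (simp add: d_def Suc_leI)
  \<comment> \<open>The 4 comes from squaring \<open>M / 2\<close>; the power is the inverse volume
    of a cube of side \<open>\<rho> / d\<close>, apart from the factor
    \<open>2^(jd)\<close>.\<close>
  define K where "K = 4 * (2 * C * d) ^ d"
  show ?thesis
  proof (intro exI[of _ K] conjI allI ballI)
    have "1 * 1 \<le> 2 * C * real d" using C d by (intro mult_mono) auto
    then have "1 \<le> (2 * C * real d) ^ d" by (intro one_le_power) simp
    then show "1 \<le> K" by (simp add: K_def)
    fix j u and x :: "real^'n" assume u: "u \<in> span_on Omega (coarse j)" and x: "x \<in> Omega"
    have cont: "continuous_on Omega u" using span_on_coarse_continuous[OF r u] .
    then have "\<exists>x0\<in>Omega. \<forall>y\<in>Omega. \<bar>u y\<bar> \<le> \<bar>u x0\<bar>"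
      using x by (intro continuous_attains_sup continuous_intros) auto
    then obtain x0 where x0: "x0 \<in> Omega" "\<And>y. y \<in> Omega \<Longrightarrow> \<bar>u y\<bar> \<le> \<bar>u x0\<bar>" by auto
    define M where "M = \<bar>u x0\<bar>"
    \<comment> \<open>Over this distance the Lipschitz bound permits a loss of exactly
      \<open>M / 2\<close>.\<close>
    define \<rho> where "\<rho> = 1 / (2 * C * 2 ^ j)"
    have \<rho>: "0 < \<rho>" "\<rho> \<le> 1 / 2"
    proof -
      have "1 * 1 \<le> C * 2 ^ j" using C by (intro mult_mono) auto
      then show "\<rho> \<le> 1 / 2" using C by (simp add: \<rho>_def divide_simps)
    qed (use C in \<open>simp add: \<rho>_def\<close>)
    obtain a b where ab: "cbox a b \<subseteq> Omega" "\<And>y. y \<in> cbox a b \<Longrightarrow> norm (y - x0) \<le> \<rho>"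
      "measure lborel (cbox a b) = (\<rho> / CARD('n)) ^ CARD('n)" using quarter_cube[OF x0(1) \<rho>] by blast
    have big: "M / 2 \<le> \<bar>u y\<bar>" if "y \<in> cbox a b" for y
    proof -
      have "\<bar>u x0 - u y\<bar> \<le> C * 2 ^ j * M * norm (x0 - y)"
        using that ab(1) x0 u by (intro C(2)) (auto simp: M_def)
      also have "\<dots> \<le> C * 2 ^ j * M * \<rho>"
        using ab(2)[OF that] C by (intro mult_left_mono) (auto simp: M_def norm_minus_commute)
      also have "\<dots> = M / 2" using C by (simp add: \<rho>_def)
      finally show ?thesis using abs_triangle_ineq2[of "u x0" "u y"] unfolding M_def by linarith
    qed
    have int: "integrable leb_Omega (\<lambda>y. (u y)\<^sup>2)"
      using cont by (intro integrable_leb_Omega_continuous continuous_intros)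
    have ms: "cbox a b \<in> sets leb_Omega"
      using ab(1) by (subst sets_restrict_space_iff) auto
    interpret L: prob_space "leb_Omega :: (real^'n) measure" by (rule prob_space_leb_Omega)
    have "(\<integral>y. (M / 2)\<^sup>2 * indicator (cbox a b) y \<partial>leb_Omega) \<le> (\<integral>y. (u y)\<^sup>2 \<partial>leb_Omega)"
    proof (intro integral_mono int)
      show "integrable leb_Omega (\<lambda>y. (M / 2)\<^sup>2 * indicator (cbox a b) y)"
        using ms by (intro integrable_mult_right L.integrable_const_bound[of _ 1]) (auto simp: indicator_def)
      show "(M / 2)\<^sup>2 * indicator (cbox a b) y \<le> (u y)\<^sup>2" for y
        using big[of y] power_mono[of "M / 2" "\<bar>u y\<bar>" 2] by (auto simp: indicator_def M_def)
    qed
    moreover have "measure leb_Omega (cbox a b) = measure lborel (cbox a b)"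
      using ab(1) by (intro measure_restrict_space) auto
    ultimately have "(M / 2)\<^sup>2 * (\<rho> / d) ^ d \<le> (\<integral>y. (u y)\<^sup>2 \<partial>leb_Omega)"
      using ms ab(3) ab(1) by (simp add: d_def Int_absorb2)
    then have le: "K * 2 ^ (j * d) * ((M / 2)\<^sup>2 * (\<rho> / d) ^ d) \<le> K * 2 ^ (j * d) * (\<integral>y. (u y)\<^sup>2 \<partial>leb_Omega)"
      using \<open>1 \<le> K\<close> by (intro mult_left_mono) auto
    have "(2 * C * d) ^ d * 2 ^ (j * d) * (\<rho> / d) ^ d = (2 * C * d * 2 ^ j * (\<rho> / d)) ^ d"
      using d by (simp add: power_mult power_mult_distrib power_divide)
    also have "2 * C * d * 2 ^ j * (\<rho> / d) = 1" using C d by (simp add: \<rho>_def)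
    finally have one: "(2 * C * d) ^ d * 2 ^ (j * d) * (\<rho> / d) ^ d = 1" by simp
    have "K * 2 ^ (j * d) * ((M / 2)\<^sup>2 * (\<rho> / d) ^ d) = M\<^sup>2 * ((2 * C * d) ^ d * 2 ^ (j * d) * (\<rho> / d) ^ d)"
      unfolding K_def power_divide[of M] by simp
    then have "K * 2 ^ (j * d) * ((M / 2)\<^sup>2 * (\<rho> / d) ^ d) = M\<^sup>2" using one by simp
    moreover have "(u x)\<^sup>2 \<le> M\<^sup>2" using x0(2)[OF x] by (simp add: M_def abs_le_square_iff)
    ultimately show "(u x)\<^sup>2 \<le> K * 2 ^ (j * CARD('n)) * (\<integral>y. (u y)\<^sup>2 \<partial>leb_Omega)"
      using le by (simp add: d_def)
  qed
qed

end


section \<open>Polynomials and bumps\<close>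

lemma ennpowr_1 [simp]: "ennpowr x 1 = x"
  by (cases x) (simp_all add: ennpowr_def)

lemma finite_multiindices: "finite {\<alpha> :: 'n::finite \<Rightarrow> nat. real (\<Sum>i\<in>UNIV. \<alpha> i) \<le> r}"
proof (rule finite_subset)
  show "{\<alpha> :: 'n \<Rightarrow> nat. real (\<Sum>i\<in>UNIV. \<alpha> i) \<le> r} \<subseteq> PiE UNIV (\<lambda>_. {..nat \<lfloor>r\<rfloor>})"
  proof
    fix \<alpha> :: "'n \<Rightarrow> nat" assume "\<alpha> \<in> {\<alpha>. real (\<Sum>i\<in>UNIV. \<alpha> i) \<le> r}"
    then have s: "(\<Sum>i\<in>UNIV. \<alpha> i) \<le> nat \<lfloor>r\<rfloor>" by (simp add: le_nat_floor)
    have "\<alpha> i \<le> nat \<lfloor>r\<rfloor>" for i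
      using member_le_sum[of i UNIV \<alpha>] s by simp
    then show "\<alpha> \<in> PiE UNIV (\<lambda>_. {..nat \<lfloor>r\<rfloor>})" by auto
  qed
  show "finite (PiE (UNIV :: 'n set) (\<lambda>_. {..nat \<lfloor>r\<rfloor>}))" by (rule finite_PiE) auto
qed

lemma polys_monomial:
  fixes \<alpha> :: "'n::finite \<Rightarrow> nat"
  assumes "real (\<Sum>i\<in>UNIV. \<alpha> i) \<le> r"
  shows "(\<lambda>x :: real^'n. \<Prod>i\<in>UNIV. (x $ i) ^ \<alpha> i) \<in> polys_deg_le r"
proof -
  define S where "S = {\<alpha> :: 'n \<Rightarrow> nat. real (\<Sum>i\<in>UNIV. \<alpha> i) \<le> r}"
  have "finite S" "\<alpha> \<in> S" using finite_multiindices assms by (auto simp: S_def)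
  have "(\<Sum>\<beta>\<in>S. (if \<beta> = \<alpha> then 1 else 0) * (\<Prod>i\<in>UNIV. (x $ i) ^ \<beta> i)) = (\<Prod>i\<in>UNIV. (x $ i) ^ \<alpha> i)"
    for x :: "real^'n"
  proof -
    have "(\<Sum>\<beta>\<in>S. (if \<beta> = \<alpha> then 1 else 0) * (\<Prod>i\<in>UNIV. (x $ i) ^ \<beta> i))
       = (\<Sum>\<beta>\<in>S. if \<beta> = \<alpha> then \<Prod>i\<in>UNIV. (x $ i) ^ \<beta> i else 0)"
      by (intro sum.cong) auto
    then show ?thesis using \<open>finite S\<close> \<open>\<alpha> \<in> S\<close> by simp
  qed
  then show ?thesis unfolding polys_deg_le_def S_def
    by (intro CollectI exI[of _ "\<lambda>\<beta>. if \<beta> = \<alpha> then 1 else 0"]) simp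
qed

lemma polys_add:
  assumes "f \<in> polys_deg_le r" "g \<in> polys_deg_le r"
  shows "(\<lambda>x. f x + g x) \<in> polys_deg_le r"
proof -
  obtain c c' where "\<And>x. f x = (\<Sum>\<alpha> | real (\<Sum>i\<in>UNIV. \<alpha> i) \<le> r. c \<alpha> * (\<Prod>i\<in>UNIV. (x $ i) ^ \<alpha> i))"
    "\<And>x. g x = (\<Sum>\<alpha> | real (\<Sum>i\<in>UNIV. \<alpha> i) \<le> r. c' \<alpha> * (\<Prod>i\<in>UNIV. (x $ i) ^ \<alpha> i))"
    using assms unfolding polys_deg_le_def by blast
  then show ?thesis unfolding polys_deg_le_def
    by (intro CollectI exI[of _ "\<lambda>\<alpha>. c \<alpha> + c' \<alpha>"]) (simp add: sum.distrib distrib_right)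
qed

lemma polys_scale:
  assumes "f \<in> polys_deg_le r"
  shows "(\<lambda>x. a * f x) \<in> polys_deg_le r"
proof -
  obtain c where "\<And>x. f x = (\<Sum>\<alpha> | real (\<Sum>i\<in>UNIV. \<alpha> i) \<le> r. c \<alpha> * (\<Prod>i\<in>UNIV. (x $ i) ^ \<alpha> i))"
    using assms unfolding polys_deg_le_def by blast
  then show ?thesis unfolding polys_deg_le_def
    by (intro CollectI exI[of _ "\<lambda>\<alpha>. a * c \<alpha>"]) (simp add: sum_distrib_left mult.assoc)
qed

lemma polys_zero: "(\<lambda>x. 0) \<in> polys_deg_le r"
  unfolding polys_deg_le_def by (intro CollectI exI[of _ "\<lambda>\<alpha>. 0"]) simp

lemma polys_sum:
  assumes "\<And>a. a \<in> A \<Longrightarrow> f a \<in> polys_deg_le r"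
  shows "(\<lambda>x. \<Sum>a\<in>A. f a x) \<in> polys_deg_le r"
  using assms by (induction A rule: infinite_finite_induct) (auto simp: polys_zero polys_add)

lemma polys_const: "0 \<le> r \<Longrightarrow> (\<lambda>x. a) \<in> polys_deg_le r"
  using polys_scale[OF polys_monomial[of "\<lambda>_. 0" r], of a] by simp

lemma polys_mono:
  fixes f :: "real^'n \<Rightarrow> real"
  assumes "f \<in> polys_deg_le r" "r \<le> r'"
  shows "f \<in> polys_deg_le r'"
proof -
  obtain c where c: "\<And>x. f x = (\<Sum>\<alpha> | real (\<Sum>i\<in>UNIV. \<alpha> i) \<le> r. c \<alpha> * (\<Prod>i\<in>UNIV. (x $ i) ^ \<alpha> i))"
    using assms unfolding polys_deg_le_def by blast
  then have "f = (\<lambda>x. \<Sum>\<alpha> | real (\<Sum>i\<in>UNIV. \<alpha> i) \<le> r. c \<alpha> * (\<Prod>i\<in>UNIV. (x $ i) ^ \<alpha> i))" by auto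
  moreover have "\<dots> \<in> polys_deg_le r'"
    using assms(2) by (intro polys_sum polys_scale polys_monomial) auto
  ultimately show ?thesis by simp
qed

lemma polys_coord_mult:
  fixes f :: "real^'n \<Rightarrow> real"
  assumes "f \<in> polys_deg_le r"
  shows "(\<lambda>x. x $ i * f x) \<in> polys_deg_le (r + 1)"
proof -
  obtain c where c: "\<And>x. f x = (\<Sum>\<alpha> | real (\<Sum>i\<in>UNIV. \<alpha> i) \<le> r. c \<alpha> * (\<Prod>i\<in>UNIV. (x $ i) ^ \<alpha> i))"
    using assms unfolding polys_deg_le_def by blast
  define up where "up \<alpha> = \<alpha>(i := Suc (\<alpha> i))" for \<alpha> :: "'n \<Rightarrow> nat"
  have s: "(\<Sum>j\<in>UNIV. up \<alpha> j) = Suc (\<Sum>j\<in>UNIV. \<alpha> j)" for \<alpha>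
    by (subst (1 2) sum.remove[of UNIV i]) (auto simp: up_def intro!: sum.cong)
  have p: "(\<Prod>j\<in>UNIV. (x $ j) ^ up \<alpha> j) = x $ i * (\<Prod>j\<in>UNIV. (x $ j) ^ \<alpha> j)" for \<alpha> and x :: "real^'n"
    by (subst (1 2) prod.remove[of UNIV i]) (auto simp: up_def mult.assoc intro!: prod.cong)
  have "(\<lambda>x. x $ i * f x) = (\<lambda>x. \<Sum>\<alpha> | real (\<Sum>i\<in>UNIV. \<alpha> i) \<le> r. c \<alpha> * (\<Prod>j\<in>UNIV. (x $ j) ^ up \<alpha> j))"
    by (simp add: c p sum_distrib_left mult.left_commute)
  also have "\<dots> \<in> polys_deg_le (r + 1)"
    by (intro polys_sum polys_scale polys_monomial) (auto simp: s)
  finally show ?thesis .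
qed

lemma polys_inner_mult:
  fixes f :: "real^'n \<Rightarrow> real"
  assumes "f \<in> polys_deg_le r"
  shows "(\<lambda>x. (v \<bullet> (x - x0)) * f x) \<in> polys_deg_le (r + 1)"
proof -
  have "(\<lambda>x. (v \<bullet> (x - x0)) * f x) = (\<lambda>x. (\<Sum>i\<in>UNIV. v $ i * (x $ i * f x)) + (- (v \<bullet> x0)) * f x)"
  proof
    fix x
    have "v \<bullet> x = (\<Sum>i\<in>UNIV. v $ i * x $ i)" by (simp only: inner_vec_def inner_real_def)
    then have "(v \<bullet> x) * f x = (\<Sum>i\<in>UNIV. v $ i * (x $ i * f x))" by (simp only: sum_distrib_right mult.assoc)
    then show "(v \<bullet> (x - x0)) * f x = (\<Sum>i\<in>UNIV. v $ i * (x $ i * f x)) + (- (v \<bullet> x0)) * f x"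
      by (simp add: inner_diff_right left_diff_distrib)
  qed
  also have "\<dots> \<in> polys_deg_le (r + 1)"
  proof (rule polys_add)
    show "(\<lambda>x. \<Sum>i\<in>UNIV. v $ i * (x $ i * f x)) \<in> polys_deg_le (r + 1)"
      by (rule polys_sum, rule polys_scale, rule polys_coord_mult, rule assms)
    show "(\<lambda>x. - (v \<bullet> x0) * f x) \<in> polys_deg_le (r + 1)"
      by (rule polys_scale, rule polys_mono[OF assms]) simp
  qed
  finally show ?thesis .
qed

lemma polys_norm_mult:
  fixes f :: "real^'n \<Rightarrow> real"
  assumes "f \<in> polys_deg_le r"
  shows "(\<lambda>x. (norm (x - x0))\<^sup>2 * f x) \<in> polys_deg_le (r + 2)"
proof -
  have "(norm (x - x0))\<^sup>2 * f x = (\<Sum>i\<in>UNIV. (axis i 1 \<bullet> (x - x0)) * ((axis i 1 \<bullet> (x - x0)) * f x))" for x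
  proof -
    have "(norm (x - x0))\<^sup>2 = (\<Sum>i\<in>UNIV. (x - x0) $ i * (x - x0) $ i)"
      by (simp only: power2_norm_eq_inner inner_vec_def inner_real_def)
    also have "\<dots> = (\<Sum>i\<in>UNIV. (axis i 1 \<bullet> (x - x0)) * (axis i 1 \<bullet> (x - x0)))"
      by (simp only: inner_axis' inner_real_def mult_1)
    finally show ?thesis by (simp only: sum_distrib_right mult.assoc)
  qed
  then have "(\<lambda>x. (norm (x - x0))\<^sup>2 * f x) = (\<lambda>x. \<Sum>i\<in>UNIV. (axis i 1 \<bullet> (x - x0)) * ((axis i 1 \<bullet> (x - x0)) * f x))"
    by (rule ext)
  also have "\<dots> \<in> polys_deg_le (r + 1 + 1)"
    using assms by (intro polys_sum polys_inner_mult)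
  finally show ?thesis by (simp add: add.assoc)
qed

text \<open>Up to constants, these are the terms in the expansion of a power of
  \<open>1 - \<rho>^2 |x - c|^2\<close> around \<open>x0\<close>, where a linear and a quadratic
  part appear. The point is their degree.\<close>

lemma polys_inner_norm_power:
  fixes v x0 :: "real^'n"
  shows "(\<lambda>x. (v \<bullet> (x - x0)) ^ i * ((norm (x - x0))\<^sup>2) ^ j) \<in> polys_deg_le (real (i + 2 * j))"
proof (induction i)
  case 0
  show ?case
  proof (induction j)
    case 0
    show ?case using polys_const[of 0 1] by simp
  next
    case (Suc j)
    from polys_norm_mult[OF this, of x0] show ?case by (simp add: mult.assoc add.commute)
  qed
next
  case (Suc i)
  from polys_inner_mult[OF this, of v x0] show ?case by (simp add: mult.assoc add.commute add.left_commute)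
qed

text \<open>A truncated power in place of a smooth cutoff, supported in the ball of radius
  \<open>1/\<rho>\<close>. Inside the ball it is a polynomial, so its Taylor polynomials are
  explicit, and it vanishes to order \<open>N\<close> at the sphere, which is all the smoothness
  that the coefficient bounds use.\<close>

definition bump :: "real^'n \<Rightarrow> real \<Rightarrow> nat \<Rightarrow> real^'n \<Rightarrow> real" where
  "bump c \<rho> N x = (max 0 (1 - \<rho>\<^sup>2 * (norm (x - c))\<^sup>2)) ^ N"

lemma bump_nonneg: "0 \<le> bump c \<rho> N x"
  by (simp add: bump_def)

lemma bump_le_1: "bump c \<rho> N x \<le> 1"
  unfolding bump_def by (intro power_le_one) auto

lemma bump_eq_0:
  assumes "0 < \<rho>" "1 / \<rho> \<le> norm (x - c)" "N \<ge> 1"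
  shows "bump c \<rho> N x = 0"
proof -
  have "1 \<le> \<rho> * norm (x - c)" using assms by (simp add: field_simps)
  then have "1\<^sup>2 \<le> (\<rho> * norm (x - c))\<^sup>2" by (intro power_mono) auto
  then have "max 0 (1 - \<rho>\<^sup>2 * (norm (x - c))\<^sup>2) = 0" by (simp add: power_mult_distrib)
  then show ?thesis using assms by (simp add: bump_def)
qed

lemma bump_eq:
  assumes "0 < \<rho>" "norm (x - c) \<le> 1 / \<rho>"
  shows "bump c \<rho> N x = (1 - \<rho>\<^sup>2 * (norm (x - c))\<^sup>2) ^ N"
proof -
  have "\<rho> * norm (x - c) \<le> 1" using assms by (simp add: field_simps)
  then have "(\<rho> * norm (x - c))\<^sup>2 \<le> 1\<^sup>2" using assms by (intro power_mono) auto
  then show ?thesis by (simp add: bump_def power_mult_distrib)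
qed

lemma continuous_on_bump [continuous_intros]: "continuous_on S (bump c \<rho> N)"
  unfolding bump_def by (intro continuous_intros)

text \<open>Around \<open>x0\<close> the base is
  \<open>a + v \<bullet> (x - x0) - \<rho>^2 |x - x0|^2\<close>. Because \<open>x0\<close> lies in
  the ball, \<open>0 <= a <= 1\<close> and \<open>|v| <= 2 \<rho>\<close>, so all coefficients are
  bounded in the rescaled variable \<open>\<rho> (x - x0)\<close>. This is why one constant serves
  all centres and scales.\<close>

lemma bump_Taylor:
  shows "\<exists>K\<ge>0. \<forall>(c::real^'n) \<rho> x0 r. \<rho> > 0 \<longrightarrow> norm (x0 - c) \<le> 1 / \<rho> \<longrightarrow> real N \<le> r + 1 \<longrightarrow>
    (\<exists>P\<in>polys_deg_le r. \<forall>\<delta> x. \<rho> * norm (x - x0) \<le> \<delta> \<longrightarrow> \<delta> \<le> 1 \<longrightarrow>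
      \<bar>(1 - \<rho>\<^sup>2 * (norm (x - c))\<^sup>2) ^ N - P x\<bar> \<le> K * \<delta> ^ N)"
proof -
  define w where "w i j = real (N choose i) * real ((N - i) choose j)" for i j
  define K where "K = (\<Sum>i\<le>N. \<Sum>j\<le>N - i. w i j * 2 ^ N)"
  have w0: "0 \<le> w i j" for i j by (simp add: w_def)
  show ?thesis
  proof (intro exI[of _ K] conjI allI impI)
    show "0 \<le> K" unfolding K_def by (intro sum_nonneg) (simp add: w0)
    fix c x0 :: "real^'n" and \<rho> r :: real
    assume \<rho>: "\<rho> > 0" and x0: "norm (x0 - c) \<le> 1 / \<rho>" and Nr: "real N \<le> r + 1"
    define a where "a = 1 - \<rho>\<^sup>2 * (norm (x0 - c))\<^sup>2"
    have x0': "\<rho> * norm (x0 - c) \<le> 1" using x0 \<rho> by (simp add: field_simps)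
    then have "(\<rho> * norm (x0 - c))\<^sup>2 \<le> 1\<^sup>2" using \<rho> by (intro power_mono) auto
    then have a: "0 \<le> a" "a \<le> 1" by (auto simp: a_def power_mult_distrib)
    define v where "v = (- 2 * \<rho>\<^sup>2) *\<^sub>R (x0 - c)"
    define M where "M i j x = w i j * a ^ (N - i - j) * (- (\<rho>\<^sup>2)) ^ j * ((v \<bullet> (x - x0)) ^ i * ((norm (x - x0))\<^sup>2) ^ j)" for i j x
    \<comment> \<open>The term \<open>M i j\<close> has degree \<open>i + 2 * j\<close>. Keeping the
      degrees below \<open>N\<close> leaves at most \<open>N - 1 <= r\<close>.\<close>
    define P where "P x = (\<Sum>i\<le>N. \<Sum>j\<le>N - i. if i + 2 * j < N then M i j x else 0)" for x
    have P: "P \<in> polys_deg_le r"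
    proof -
      have "(\<lambda>x. if i + 2 * j < N then M i j x else 0) \<in> polys_deg_le r" for i j
      proof (cases "i + 2 * j < N")
        case True
        then have "real (i + 2 * j) \<le> r" using Nr by linarith
        then have "M i j \<in> polys_deg_le r" unfolding M_def
          by (intro polys_scale polys_mono[OF polys_inner_norm_power])
        then show ?thesis using True by simp
      qed (simp add: polys_zero)
      then show ?thesis unfolding P_def by (intro polys_sum)
    qed
    have expand: "(1 - \<rho>\<^sup>2 * (norm (x - c))\<^sup>2) ^ N = (\<Sum>i\<le>N. \<Sum>j\<le>N - i. M i j x)" for x
    proof -
      have sq: "(norm (y + z))\<^sup>2 = (norm y)\<^sup>2 + 2 * (z \<bullet> y) + (norm z)\<^sup>2" for y z :: "real^'n"
        by (simp add: power2_norm_eq_inner inner_add inner_commute[of y z])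
      have "(norm (x - c))\<^sup>2 = (norm (x - x0))\<^sup>2 + 2 * ((x0 - c) \<bullet> (x - x0)) + (norm (x0 - c))\<^sup>2"
        using sq[of "x - x0" "x0 - c"] by simp
      then have quad: "1 - \<rho>\<^sup>2 * (norm (x - c))\<^sup>2 = v \<bullet> (x - x0) + ((- (\<rho>\<^sup>2)) * (norm (x - x0))\<^sup>2 + a)"
      proof -
        assume n: "(norm (x - c))\<^sup>2 = (norm (x - x0))\<^sup>2 + 2 * ((x0 - c) \<bullet> (x - x0)) + (norm (x0 - c))\<^sup>2"
        have "v \<bullet> (x - x0) = - 2 * \<rho>\<^sup>2 * ((x0 - c) \<bullet> (x - x0))" by (simp add: v_def)
        then show ?thesis unfolding n a_def by algebra
      qed
      then have "(1 - \<rho>\<^sup>2 * (norm (x - c))\<^sup>2) ^ N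
         = (\<Sum>i\<le>N. real (N choose i) * (v \<bullet> (x - x0)) ^ i * (\<Sum>j\<le>N - i. real ((N - i) choose j) * ((- (\<rho>\<^sup>2)) * (norm (x - x0))\<^sup>2) ^ j * a ^ (N - i - j)))"
        by (simp only: binomial_ring)
      also have "\<dots> = (\<Sum>i\<le>N. \<Sum>j\<le>N - i. M i j x)"
        unfolding M_def w_def sum_distrib_left power_mult_distrib[of "- (\<rho>\<^sup>2)"]
        by (intro sum.cong refl) (simp only: mult_ac)
      finally show ?thesis .
    qed
    show "\<exists>P\<in>polys_deg_le r. \<forall>\<delta> x. \<rho> * norm (x - x0) \<le> \<delta> \<longrightarrow> \<delta> \<le> 1 \<longrightarrow>
      \<bar>(1 - \<rho>\<^sup>2 * (norm (x - c))\<^sup>2) ^ N - P x\<bar> \<le> K * \<delta> ^ N"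
    proof (intro bexI[OF _ P] allI impI)
      fix \<delta> and x assume h: "\<rho> * norm (x - x0) \<le> \<delta>" and \<delta>1: "\<delta> \<le> 1"
      have \<delta>0: "0 \<le> \<delta>" using h \<rho> by (meson mult_nonneg_nonneg norm_ge_zero less_imp_le order_trans)
      have v: "\<bar>v \<bullet> (x - x0)\<bar> \<le> 2 * \<delta>"
      proof -
        have "\<bar>v \<bullet> (x - x0)\<bar> \<le> norm v * norm (x - x0)" by (rule Cauchy_Schwarz_ineq2)
        also have "\<dots> = 2 * ((\<rho> * norm (x0 - c)) * (\<rho> * norm (x - x0)))"
          by (simp add: v_def power2_eq_square)
        also have "\<dots> \<le> 2 * (1 * \<delta>)" using x0' h \<rho> by (intro mult_left_mono mult_mono) auto
        finally show ?thesis by simp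
      qed
      have rem: "\<bar>M i j x\<bar> \<le> w i j * 2 ^ N * \<delta> ^ N" if "i \<le> N" "\<not> i + 2 * j < N" for i j
      proof -
        have "\<bar>M i j x\<bar> = w i j * (a ^ (N - i - j) * (\<bar>v \<bullet> (x - x0)\<bar> ^ i * ((\<rho> * norm (x - x0))\<^sup>2) ^ j))"
          using a w0 by (simp add: M_def abs_mult power_abs power_mult_distrib)
        also have "\<dots> \<le> w i j * (1 * ((2 * \<delta>) ^ i * (\<delta>\<^sup>2) ^ j))"
          using a v h \<rho> w0 \<delta>0 by (intro mult_left_mono mult_mono power_mono power_le_one) auto
        also have "(2 * \<delta>) ^ i * (\<delta>\<^sup>2) ^ j = 2 ^ i * \<delta> ^ (i + 2 * j)"
          by (simp add: power_mult_distrib power_add power_mult)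
        \<comment> \<open>The omitted terms have \<open>i + 2 * j >= N\<close>, and \<delta> is at
          most 1, so the surplus powers only help.\<close>
        also have "w i j * (1 * (2 ^ i * \<delta> ^ (i + 2 * j))) \<le> w i j * (1 * (2 ^ N * \<delta> ^ N))"
          using that \<delta>0 \<delta>1 w0 by (intro mult_left_mono mult_mono power_increasing power_decreasing) auto
        finally show ?thesis by simp
      qed
      have "(1 - \<rho>\<^sup>2 * (norm (x - c))\<^sup>2) ^ N - P x = (\<Sum>i\<le>N. \<Sum>j\<le>N - i. if i + 2 * j < N then 0 else M i j x)"
        unfolding expand P_def sum_subtractf[symmetric] by (intro sum.cong) auto
      also have "\<bar>\<dots>\<bar> \<le> (\<Sum>i\<le>N. \<Sum>j\<le>N - i. w i j * 2 ^ N * \<delta> ^ N)"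
      proof (intro order_trans[OF sum_abs] sum_mono order_trans[OF sum_abs])
        fix i j assume "i \<in> {..N}" "j \<in> {..N - i}"
        then show "\<bar>if i + 2 * j < N then 0 else M i j x\<bar> \<le> w i j * 2 ^ N * \<delta> ^ N"
          using rem w0[of i j] \<delta>0 by auto
      qed
      also have "\<dots> = K * \<delta> ^ N" by (simp add: K_def sum_distrib_right)
      finally show "\<bar>(1 - \<rho>\<^sup>2 * (norm (x - c))\<^sup>2) ^ N - P x\<bar> \<le> K * \<delta> ^ N" .
    qed
  qed
qed

section \<open>Besov norms through wavelet coefficients\<close>

lemma Lnorm_count_space_finite_le:
  assumes fin: "finite A" and g: "\<And>x. x \<in> A \<Longrightarrow> g x \<le> ennreal b" and b: "0 \<le> b"
    and t: "1 \<le> t" and K: "1 \<le> K" "real (card A) \<le> K"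
  shows "Lnorm t (count_space A) g \<le> ennreal (K powr enn2real (1 / t) * b)"
proof (cases "t = \<top>")
  case True
  then show ?thesis using g K by (auto simp: Lnorm_def intro!: esssup_I)
next
  case False
  then obtain t' where t': "t = ennreal t'" "1 \<le> t'" using t by (cases t) auto
  have "(\<integral>\<^sup>+x. ennpowr (g x) t' \<partial>count_space A) \<le> (\<integral>\<^sup>+x. ennreal (b powr t') \<partial>count_space A)"
    using g t' b by (intro nn_integral_mono) (auto simp flip: ennpowr_ennreal intro!: ennpowr_mono)
  also have "\<dots> = ennreal (real (card A) * b powr t')"
    using fin by (simp add: nn_integral_count_space_finite ennreal_mult' ennreal_of_nat_eq_real_of_nat mult.commute)
  also have "\<dots> \<le> ennreal (K * b powr t')" using K by (intro ennreal_leI mult_right_mono) auto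
  finally have "Lnorm t (count_space A) g \<le> ennpowr (ennreal (K * b powr t')) (1 / t')"
    using t' by (auto simp: Lnorm_def intro!: ennpowr_mono)
  also have "\<dots> = ennreal (K powr (1 / t') * b)"
  proof -
    have "(K * b powr t') powr (1 / t') = K powr (1 / t') * b"
      using t' b by (simp add: powr_mult powr_powr)
    then show ?thesis using K by (simp add: ennpowr_ennreal)
  qed
  also have "1 / t' = enn2real (1 / t)" using t' by (simp add: divide_ennreal[of 1 t', simplified])
  finally show ?thesis .
qed

text \<open>The \<open>l_1\<close> norm dominates every \<open>l_q\<close> norm: each
  \<open>x k\<close> is at most \<open>S\<close>, hence \<open>(x k)^q <= x k * S^(q-1)\<close>. The
  Besov estimates can therefore be made for \<open>q = 1\<close> and hold uniformly in
  \<open>q\<close>.\<close>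

lemma Lnorm_sequence_le:
  assumes g: "\<And>k. g k \<le> ennreal (x k)" and x: "\<And>k. 0 \<le> x k" and S: "\<And>n. (\<Sum>k<n. x k) \<le> S" and q: "1 \<le> q"
  shows "Lnorm q (count_space (UNIV :: nat set)) g \<le> ennreal S"
proof -
  have S0: "0 \<le> S" using S[of 0] by simp
  have xS: "x k \<le> S" for k using S[of "Suc k"] sum_nonneg[of "{..<k}" x] x by simp
  show ?thesis
  proof (cases "q = \<top>")
    case True
    have "g k \<le> ennreal S" for k using g xS by (meson ennreal_leI order_trans)
    then show ?thesis using True by (auto simp: Lnorm_def intro!: esssup_I)
  next
    case False
    then obtain q' where q': "q = ennreal q'" "1 \<le> q'" using q by (cases q) auto
    have "(\<integral>\<^sup>+k. ennpowr (g k) q' \<partial>count_space UNIV) \<le> (\<integral>\<^sup>+k. ennreal (x k powr q') \<partial>count_space UNIV)"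
      using g q' x by (intro nn_integral_mono) (auto simp flip: ennpowr_ennreal intro!: ennpowr_mono)
    also have "\<dots> = (SUP n. \<Sum>k<n. ennreal (x k powr q'))"
      by (simp add: nn_integral_count_space_nat suminf_eq_SUP)
    also have "\<dots> \<le> ennreal (S powr q')"
    proof (rule SUP_least)
      fix n
      have "(\<Sum>k<n. x k powr q') \<le> (\<Sum>k<n. x k * S powr (q' - 1))"
      proof (rule sum_mono)
        fix k
        show "x k powr q' \<le> x k * S powr (q' - 1)"
        proof (cases "x k = 0")
          case False
          then have "x k powr q' = x k * x k powr (q' - 1)" using x[of k] by (simp add: powr_diff)
          also have "\<dots> \<le> x k * S powr (q' - 1)"
            using x[of k] xS[of k] q' by (intro mult_left_mono powr_mono2) auto
          finally show ?thesis .
        qed simp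
      qed
      also have "\<dots> = (\<Sum>k<n. x k) * S powr (q' - 1)" by (simp add: sum_distrib_right)
      also have "\<dots> \<le> S * S powr (q' - 1)" using S by (intro mult_right_mono) auto
      also have "\<dots> = S powr q'" using S0 by (cases "S = 0") (auto simp: powr_diff)
      finally show "(\<Sum>k<n. ennreal (x k powr q')) \<le> ennreal (S powr q')" by simp
    qed
    finally have "Lnorm q (count_space UNIV) g \<le> ennpowr (ennreal (S powr q')) (1 / q')"
      using q' by (auto simp: Lnorm_def intro!: ennpowr_mono)
    then show ?thesis using q' S0 by (simp add: ennpowr_ennreal powr_powr)
  qed
qed


text \<open>The order of the sup-norm of the wavelets at level \<open>k\<close>, and of the inverse of their \<open>L\<^sub>1\<close>-norm.\<close>

definition wav_scale :: "'n itself \<Rightarrow> nat \<Rightarrow> real" where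
  "wav_scale _ k = 2 powr (real CARD('n) * real k / 2)"

lemma wav_scale_pos: "0 < wav_scale TYPE('n) k"
  by (simp add: wav_scale_def)

lemma wav_scale_sq: "(wav_scale TYPE('n::finite) k)\<^sup>2 = (2 ^ k) ^ CARD('n)"
proof -
  have "(wav_scale TYPE('n) k)\<^sup>2 = 2 powr (real CARD('n) * real k / 2 + real CARD('n) * real k / 2)"
    by (simp only: wav_scale_def power2_eq_square powr_add)
  also have "\<dots> = 2 powr (real (k * CARD('n)))" by (simp add: mult.commute)
  also have "\<dots> = (2 ^ k) ^ CARD('n)" by (subst powr_realpow) (auto simp: power_mult)
  finally show ?thesis .
qed

context wavelet_system
begin

lemma inner_basis:
  assumes "u \<in> coarse j" "v \<in> coarse j"
  shows "inner_Omega u v = (if u = v then 1 else 0)"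
  using assms basis coarse_subset[of j] unfolding orthonormal_basis_Omega_def by blast

lemma coarse_continuous: "1 < r \<Longrightarrow> v \<in> coarse j \<Longrightarrow> continuous_on Omega v"
  using coarse_subset_span by (intro span_on_coarse_continuous) auto

text \<open>Applied to \<open>\<Sum>v. v x * v\<close>, the inequality above bounds the diagonal \<open>\<Sum>v. (v x)\<^sup>2\<close> of the reproducing
  kernel; integrating the diagonal over \<open>x\<close> counts the basis functions.\<close>

lemma coarse_bounds:
  assumes r: "1 < r"
  shows "\<exists>K\<ge>1. \<forall>j. finite (coarse j) \<and> real (card (coarse j)) \<le> K * 2 ^ (j * CARD('n)) \<and>
    (\<forall>v\<in>coarse j. \<forall>x\<in>Omega. (v x)\<^sup>2 \<le> K * 2 ^ (j * CARD('n)))"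
proof -
  obtain K where K: "K \<ge> 1" and nik: "\<And>j u x. u \<in> span_on Omega (coarse j) \<Longrightarrow> x \<in> Omega \<Longrightarrow>
    (u x)\<^sup>2 \<le> K * 2 ^ (j * CARD('n)) * (\<integral>y. (u y)\<^sup>2 \<partial>leb_Omega)"
    using nikolskii[OF r] by blast
  interpret L: prob_space "leb_Omega :: (real^'n) measure" by (rule prob_space_leb_Omega)
  show ?thesis
  proof (intro exI[of _ K] conjI allI ballI K)
    fix j
    define B where "B = K * 2 ^ (j * CARD('n))"
    have B0: "0 \<le> B" using K by (simp add: B_def)
    \<comment> \<open>The level is not yet known to be finite. A common bound for all its finite
      subsets gives finiteness and the count at once.\<close>
    have card: "card F \<le> nat \<lfloor>B\<rfloor>" if F: "F \<subseteq> coarse j" "finite F" for F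
    proof -
      have cont: "continuous_on Omega v" if "v \<in> F" for v 
        by (rule coarse_continuous[OF r subsetD[OF F(1) that]])
      have pt: "(\<Sum>v\<in>F. (v x)\<^sup>2) \<le> B" if x: "x \<in> Omega" for x
      proof -
        define u where "u y = (\<Sum>v\<in>F. v x * v y)" for y
        have us: "u \<in> span_on Omega (coarse j)" unfolding span_on_def u_def
          using F(2) by (intro CollectI exI[of _ F] exI[of _ "\<lambda>v. v x"] conjI F(1)) simp_all
        have "(\<integral>y. (u y)\<^sup>2 \<partial>leb_Omega) = (\<integral>y. (\<Sum>v\<in>F. \<Sum>w\<in>F. v x * w x * (v y * w y)) \<partial>leb_Omega)"
          unfolding u_def power2_eq_square sum_product by (simp only: mult_ac)
        also have "\<dots> = (\<Sum>v\<in>F. \<Sum>w\<in>F. v x * w x * inner_Omega v w)"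
          using cont by (simp add: integrable_leb_Omega_continuous continuous_intros)
        also have "\<dots> = (\<Sum>v\<in>F. \<Sum>w\<in>F. if v = w then v x * w x else 0)"
          using F by (intro sum.cong refl) (auto simp: inner_basis[of _ j] subset_iff)
        also have "\<dots> = (\<Sum>v\<in>F. (v x)\<^sup>2)" using F by (simp add: power2_eq_square)
        finally have I: "(\<integral>y. (u y)\<^sup>2 \<partial>leb_Omega) = (\<Sum>v\<in>F. (v x)\<^sup>2)" .
        have ux: "u x = (\<Sum>v\<in>F. (v x)\<^sup>2)" by (simp add: u_def power2_eq_square)
        have "(\<Sum>v\<in>F. (v x)\<^sup>2)\<^sup>2 \<le> B * (\<Sum>v\<in>F. (v x)\<^sup>2)"
          using nik[OF us x] unfolding I ux B_def .
        moreover have "0 \<le> (\<Sum>v\<in>F. (v x)\<^sup>2)" by (intro sum_nonneg) simp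
        ultimately show ?thesis using B0
          by (cases "(\<Sum>v\<in>F. (v x)\<^sup>2) = 0") (auto simp: power2_eq_square)
      qed
      have "real (card F) = (\<Sum>v\<in>F. inner_Omega v v)"
        using F by (simp add: inner_basis[of _ j] subset_iff)
      also have "\<dots> = (\<integral>x. (\<Sum>v\<in>F. (v x)\<^sup>2) \<partial>leb_Omega)"
        using cont by (simp add: integrable_leb_Omega_continuous continuous_intros power2_eq_square)
      also have "\<dots> \<le> (\<integral>x. B \<partial>(leb_Omega :: (real^'n) measure))"
        using pt cont by (intro integral_mono integrable_leb_Omega_continuous continuous_intros) auto
      also have "\<dots> = B" by (simp add: L.prob_space[simplified space_leb_Omega])
      finally show ?thesis by (simp add: le_nat_floor)
    qed
    show "finite (coarse j)" using finite_if_finite_subsets_card_bdd[OF card] by (rule conjunct1)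
    have "card (coarse j) \<le> nat \<lfloor>B\<rfloor>" using finite_if_finite_subsets_card_bdd[OF card] by (rule conjunct2)
    then show "real (card (coarse j)) \<le> K * 2 ^ (j * CARD('n))"
      using B0 unfolding B_def by linarith
    fix v and x :: "real^'n" assume v: "v \<in> coarse j" and x: "x \<in> Omega"
    have "(\<integral>y. (v y)\<^sup>2 \<partial>leb_Omega) = 1"
      using inner_basis[OF v v] by (simp add: power2_eq_square)
    then show "(v x)\<^sup>2 \<le> K * 2 ^ (j * CARD('n))"
      using nik[OF subsetD[OF coarse_subset_span v] x] by simp
  qed
qed

text \<open>Vanishing moments: polynomials of degree at most \<open>r\<close> are combinations of
  scaling functions, and these are orthogonal to all wavelets.\<close>

lemma inner_polys:
  assumes r: "1 < r" and P: "P \<in> polys_deg_le r" and \<psi>: "\<psi> \<in> \<Psi> k"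
  shows "inner_Omega P \<psi> = 0"
proof -
  obtain F c where F: "finite F" "F \<subseteq> \<Phi>" "\<And>x. x \<in> Omega \<Longrightarrow> P x = (\<Sum>v\<in>F. c v * v x)"
    using subsetD[OF polynomials P] by (auto simp: span_on_def)
  have \<psi>c: "\<psi> \<in> coarse (Suc k)" using \<psi> by auto
  have cont: "continuous_on Omega v" if "v \<in> F" for v
    using that F(2) by (intro coarse_continuous[OF r, of v 0]) auto
  have "inner_Omega P \<psi> = (\<integral>x. (\<Sum>v\<in>F. c v * (v x * \<psi> x)) \<partial>leb_Omega)"
    using F(3) by (intro Bochner_Integration.integral_cong) (auto simp: sum_distrib_right mult.assoc)
  also have "\<dots> = (\<Sum>v\<in>F. c v * inner_Omega v \<psi>)"
    using cont coarse_continuous[OF r \<psi>c] by (simp add: integrable_leb_Omega_continuous continuous_intros)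
  also have "\<dots> = 0"
  proof (intro sum.neutral ballI)
    fix v assume v: "v \<in> F"
    then have "v \<noteq> \<psi>" using F(2) \<psi> disjoint_scaling[of k] by blast
    then show "c v * inner_Omega v \<psi> = 0"
      using inner_basis[of v "Suc k" \<psi>] v F(2) \<psi>c by auto
  qed
  finally show ?thesis .
qed

text \<open>The normalization for \<open>t = 1\<close>. It converts a uniform approximation error
  into a bound for wavelet coefficients.\<close>

lemma wavelet_L1:
  assumes r: "1 < r"
  shows "\<exists>K\<ge>1. \<forall>k. \<forall>\<psi>\<in>\<Psi> k. (\<integral>x. \<bar>\<psi> x\<bar> \<partial>leb_Omega) \<le> K / wav_scale TYPE('n) k"
proof -
  obtain C :: real where C: "\<And>k \<psi> t. \<psi> \<in> \<Psi> k \<Longrightarrow> t \<ge> 1 \<Longrightarrow>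
     Lnorm_Omega t \<psi> \<le> ennreal (C * 2 powr (real CARD('n) * real k * (1 / 2 - enn2real (1 / t))))"
  proof -
    from normalization obtain c C where "c > (0::real)" and C: "\<forall>j. \<forall>\<psi>\<in>\<Psi> j. \<forall>t\<ge>1.
      (let w = 2 powr (real CARD('n) * real j * (1 / 2 - enn2real (1 / t)))
       in ennreal (c * w) \<le> Lnorm_Omega t \<psi> \<and> Lnorm_Omega t \<psi> \<le> ennreal (C * w))"
      by (elim exE conjE)
    have "Lnorm_Omega t \<psi> \<le> ennreal (C * 2 powr (real CARD('n) * real k * (1 / 2 - enn2real (1 / t))))"
      if "\<psi> \<in> \<Psi> k" "t \<ge> 1" for k \<psi> t
      using C[rule_format, OF that] unfolding Let_def by (rule conjunct2)
    then show ?thesis by (rule that)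
  qed
  show ?thesis
  proof (intro exI[of _ "max 1 C"] conjI allI ballI)
    fix k \<psi> assume \<psi>: "\<psi> \<in> \<Psi> k"
    have "continuous_on Omega \<psi>" using \<psi> by (intro coarse_continuous[OF r, of _ "Suc k"]) auto
    then have m: "(\<lambda>x. \<bar>\<psi> x\<bar>) \<in> borel_measurable leb_Omega"
      by (intro measurable_leb_Omega_continuous continuous_intros)
    have "2 powr (real CARD('n) * real k * (1 / 2 - enn2real (1 / 1))) = 1 / wav_scale TYPE('n) k"
    proof -
      have "real CARD('n) * real k * (1 / 2 - enn2real (1 / 1)) = - (real CARD('n) * real k / 2)"
        by (simp add: divide_ennreal[of 1 1, simplified])
      then show ?thesis unfolding wav_scale_def by (simp only: powr_minus_divide)
    qed
    then have "(\<integral>\<^sup>+x. ennreal \<bar>\<psi> x\<bar> \<partial>leb_Omega) \<le> ennreal (C * (1 / wav_scale TYPE('n) k))"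
      using C[OF \<psi>, of 1] by (simp add: Lnorm_def)
    also have "\<dots> \<le> ennreal (max 1 C / wav_scale TYPE('n) k)"
      using wav_scale_pos[where 'n='n, of k] by (intro ennreal_leI) (simp add: divide_right_mono)
    finally show "(\<integral>x. \<bar>\<psi> x\<bar> \<partial>leb_Omega) \<le> max 1 C / wav_scale TYPE('n) k"
      using m wav_scale_pos[where 'n='n, of k]
      by (subst integral_eq_nn_integral) (auto intro!: enn2real_leI divide_nonneg_nonneg)
  qed simp
qed

lemma wavelet_support:
  "\<exists>K\<ge>1. \<forall>k. \<forall>\<psi>\<in>\<Psi> k. \<exists>a b. cbox a b \<subseteq> Omega \<and> {x \<in> Omega. \<psi> x \<noteq> 0} \<subseteq> cbox a b
      \<and> diameter (cbox a b) \<le> K / 2 ^ k"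
proof -
  obtain C :: real and I where CI: "\<And>k \<psi>. \<psi> \<in> \<Psi> k \<Longrightarrow> (\<exists>a b. I k \<psi> = cbox a b) \<and> I k \<psi> \<subseteq> Omega \<and>
      {x \<in> Omega. \<psi> x \<noteq> 0} \<subseteq> I k \<psi> \<and> diameter (I k \<psi>) \<le> C * 2 powr (- real k)"
  proof -
    from locality obtain C :: real and I where CI: "\<forall>j. (\<forall>\<psi>\<in>\<Psi> j. (\<exists>a b. I j \<psi> = cbox a b) \<and> I j \<psi> \<subseteq> Omega \<and>
         {x \<in> Omega. \<psi> x \<noteq> 0} \<subseteq> I j \<psi> \<and> diameter (I j \<psi>) \<le> C * 2 powr (- real j)) \<and>
      Lnorm \<infinity> leb_Omega (\<lambda>x. \<integral>\<^sup>+\<psi>. indicator (I j \<psi>) x \<partial>count_space (\<Psi> j)) \<le> ennreal C"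
      by (elim exE)
    have "(\<exists>a b. I k \<psi> = cbox a b) \<and> I k \<psi> \<subseteq> Omega \<and>
      {x \<in> Omega. \<psi> x \<noteq> 0} \<subseteq> I k \<psi> \<and> diameter (I k \<psi>) \<le> C * 2 powr (- real k)" if "\<psi> \<in> \<Psi> k" for k \<psi>
      using bspec[OF conjunct1[OF spec[OF CI]] that] .
    then show ?thesis by (rule that)
  qed
  have "C * 2 powr (- real k) \<le> max 1 C / 2 ^ k" for k
    by (simp add: powr_minus powr_realpow divide_inverse mult_right_mono)
  note le = this
  show ?thesis
  proof (intro exI[of _ "max 1 C"] conjI allI ballI)
    fix k \<psi> assume "\<psi> \<in> \<Psi> k"
    from CI[OF this] obtain a b where "I k \<psi> = cbox a b" "I k \<psi> \<subseteq> Omega"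
      "{x \<in> Omega. \<psi> x \<noteq> 0} \<subseteq> I k \<psi>" "diameter (I k \<psi>) \<le> C * 2 powr (- real k)" by (elim exE conjE)
    then show "\<exists>a b. cbox a b \<subseteq> Omega \<and> {x \<in> Omega. \<psi> x \<noteq> 0} \<subseteq> cbox a b \<and> diameter (cbox a b) \<le> max 1 C / 2 ^ k"
      using le[of k] by (intro exI[of _ a] exI[of _ b]) auto
  qed simp
qed

text \<open>A wavelet of level \<open>k\<close> lies in \<open>coarse (Suc k)\<close>. There
  \<open>coarse_bounds\<close> gives its sup-norm, of order \<open>wav_scale k\<close>, and the
  Bernstein inequality contributes the factor \<open>2^k\<close>.\<close>

lemma wavelet_Lipschitz:
  assumes r: "1 < r"
  shows "\<exists>K\<ge>1. \<forall>k. \<forall>\<psi>\<in>\<Psi> k. \<forall>x\<in>Omega. \<forall>y\<in>Omega.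
    \<bar>\<psi> x - \<psi> y\<bar> \<le> K * 2 ^ k * wav_scale TYPE('n) k * norm (x - y)"
proof -
  obtain C where C: "C \<ge> 1" "\<forall>j. \<forall>u\<in>span_on Omega (coarse j). \<forall>M. (\<forall>x\<in>Omega. \<bar>u x\<bar> \<le> M) \<longrightarrow>
      (\<forall>x\<in>Omega. \<forall>y\<in>Omega. \<bar>u x - u y\<bar> \<le> C * 2 ^ j * M * norm (x - y))"
    using span_on_coarse_Lipschitz[OF r] by (elim exE conjE)
  obtain K where K: "K \<ge> 1" "\<And>j v x. v \<in> coarse j \<Longrightarrow> x \<in> Omega \<Longrightarrow> (v x)\<^sup>2 \<le> K * 2 ^ (j * CARD('n))"
    using coarse_bounds[OF r] by blast
  \<comment> \<open>The factors 2 and \<open>2 ^ CARD('n)\<close> pay for the passage from level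
    \<open>k\<close> to \<open>Suc k\<close>.\<close>
  define K' where "K' = C * 2 * sqrt (K * 2 ^ CARD('n))"
  show ?thesis
  proof (intro exI[of _ "max 1 K'"] conjI allI ballI)
    fix k \<psi> and x y :: "real^'n"
    assume \<psi>: "\<psi> \<in> \<Psi> k" and x: "x \<in> Omega" and y: "y \<in> Omega"
    have \<psi>c: "\<psi> \<in> coarse (Suc k)" using \<psi> by auto
    define M where "M = sqrt (K * 2 ^ (Suc k * CARD('n)))"
    have M: "\<bar>\<psi> x\<bar> \<le> M" if "x \<in> Omega" for x
      using real_sqrt_le_mono[OF K(2)[OF \<psi>c that]] by (simp add: M_def)
    have w: "2 ^ (k * CARD('n)) = (wav_scale TYPE('n) k)\<^sup>2"
      by (simp add: wav_scale_sq power_mult)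
    have "M = sqrt (K * 2 ^ CARD('n)) * wav_scale TYPE('n) k"
      using wav_scale_pos[where 'n='n, of k] by (simp add: M_def power_add w real_sqrt_mult)
    then have M': "C * 2 ^ Suc k * M = K' * 2 ^ k * wav_scale TYPE('n) k" by (simp add: K'_def)
    have "\<bar>\<psi> x - \<psi> y\<bar> \<le> C * 2 ^ Suc k * M * norm (x - y)"
      using C(2)[rule_format, OF subsetD[OF coarse_subset_span \<psi>c] M x y] .
    also have "\<dots> \<le> max 1 K' * 2 ^ k * wav_scale TYPE('n) k * norm (x - y)"
      unfolding M' using wav_scale_pos[where 'n='n, of k] by (intro mult_right_mono) auto
    finally show "\<bar>\<psi> x - \<psi> y\<bar> \<le> max 1 K' * 2 ^ k * wav_scale TYPE('n) k * norm (x - y)" .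
  qed simp
qed

text \<open>In this scaling the exponent \<open>p\<close> disappears. A level has of the order of
  \<open>2^(dk)\<close> wavelets, so its \<open>l_p\<close> norm gains \<open>2^(dk/p)\<close>,
  which cancels against the weight, and the remaining \<open>2^(dk/2)\<close> cancels against
  \<open>wav_scale k\<close>. What is left of level \<open>k\<close> is \<open>2^(ks) * a k\<close>.
  The sup-norm bound \<open>B\<close> takes care of the scaling coefficients.\<close>

lemma besov_norm_le:
  assumes r: "1 < r" and s: "0 \<le> s"
  shows "\<exists>K\<ge>1. \<forall>p q f B a S. 1 \<le> p \<longrightarrow> 1 \<le> q \<longrightarrow> (\<forall>x\<in>Omega. \<bar>f x\<bar> \<le> B) \<longrightarrow> f \<in> borel_measurable leb_Omega \<longrightarrow>
     (\<forall>k. 0 \<le> a k \<and> (\<forall>\<psi>\<in>\<Psi> k. \<bar>inner_Omega f \<psi>\<bar> \<le> a k / wav_scale TYPE('n) k)) \<longrightarrow>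
     (\<forall>n. (\<Sum>k<n. 2 powr (real k * s) * a k) \<le> S) \<longrightarrow>
     besov_norm \<Phi> \<Psi> s p q f \<le> ennreal (K * (B + S))"
proof -
  obtain K where K: "K \<ge> 1" "\<And>j. finite (coarse j)" "\<And>j. real (card (coarse j)) \<le> K * 2 ^ (j * CARD('n))"
     "\<And>j v x. v \<in> coarse j \<Longrightarrow> x \<in> Omega \<Longrightarrow> (v x)\<^sup>2 \<le> K * 2 ^ (j * CARD('n))"
    using coarse_bounds[OF r] by blast
  define K2 where "K2 = K * 2 ^ CARD('n)"
  have K2: "K \<le> K2" "1 \<le> K2"
  proof -
    have "K * 1 \<le> K2" unfolding K2_def using K(1) by (intro mult_left_mono) auto
    then show "K \<le> K2" "1 \<le> K2" using K(1) by auto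
  qed
  have \<Phi>c: "\<Phi> \<subseteq> coarse 0" by auto
  have fin\<Phi>: "finite \<Phi>" using K(2)[of 0] by simp
  have card\<Phi>: "real (card \<Phi>) \<le> K" using K(3)[of 0] by simp
  have fin\<Psi>: "finite (\<Psi> k)" for k by (rule finite_subset[OF _ K(2)[of "Suc k"]]) auto
  have card\<Psi>: "real (card (\<Psi> k)) \<le> K2 * 2 ^ (k * CARD('n))" for k
  proof -
    have "card (\<Psi> k) \<le> card (coarse (Suc k))" by (intro card_mono K(2)) auto
    then show ?thesis using K(3)[of "Suc k"] by (simp add: K2_def power_add)
  qed
  interpret L: prob_space "leb_Omega :: (real^'n) measure" by (rule prob_space_leb_Omega)
  show ?thesis
  proof (intro exI[of _ "K2 * K2"] conjI allI impI)
    show "1 \<le> K2 * K2" using K2 by (simp add: mult_ge1_I)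
    fix p q :: ennreal and f :: "real^'n \<Rightarrow> real" and B S :: real and a
    assume p: "1 \<le> p" and q: "1 \<le> q" and fB: "\<forall>x\<in>Omega. \<bar>f x\<bar> \<le> B" and fm: "f \<in> borel_measurable leb_Omega"
      and a: "\<forall>k. 0 \<le> a k \<and> (\<forall>\<psi>\<in>\<Psi> k. \<bar>inner_Omega f \<psi>\<bar> \<le> a k / wav_scale TYPE('n) k)"
      and S: "\<forall>n. (\<Sum>k<n. 2 powr (real k * s) * a k) \<le> S"
    have "(0 :: real^'n) \<in> Omega" by (simp add: mem_box_cart)
    then have B0: "0 \<le> B" using fB by force
    define e where "e = enn2real (1 / p)"
    have e: "0 \<le> e" "e \<le> 1"
    proof -
      have "1 / p \<le> 1" using p by (simp add: divide_le_posI_ennreal less_le_trans[OF _ p])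
      then show "e \<le> 1" unfolding e_def by (intro enn2real_leI) auto
    qed (simp add: e_def)
    have \<Phi>b: "ennreal \<bar>inner_Omega f \<phi>\<bar> \<le> ennreal (B * K)" if \<phi>: "\<phi> \<in> \<Phi>" for \<phi>
    proof -
      have \<phi>K: "\<bar>\<phi> x\<bar> \<le> K" if "x \<in> Omega" for x
      proof -
        have "(\<phi> x)\<^sup>2 \<le> K" using K(4)[of \<phi> 0 x] \<phi> that by simp
        also have "K \<le> K\<^sup>2" using K(1) by (simp add: power2_eq_square)
        finally show ?thesis using K(1) by (simp add: abs_le_square_iff[symmetric])
      qed
      have "continuous_on Omega \<phi>" using \<phi> by (intro coarse_continuous[OF r, of _ 0]) auto
      then have "(\<lambda>x. f x * \<phi> x) \<in> borel_measurable leb_Omega"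
        by (intro borel_measurable_times fm measurable_leb_Omega_continuous)
      moreover have b: "\<bar>f x * \<phi> x\<bar> \<le> B * K" if "x \<in> Omega" for x
        using fB \<phi>K that B0 by (auto simp: abs_mult intro!: mult_mono)
      ultimately have i: "integrable leb_Omega (\<lambda>x. f x * \<phi> x)"
        by (rule integrable_leb_Omega_bounded)
      have "\<bar>inner_Omega f \<phi>\<bar> \<le> (\<integral>x. \<bar>f x * \<phi> x\<bar> \<partial>leb_Omega)" by (rule integral_abs_bound)
      also have "\<dots> \<le> (\<integral>x. B * K \<partial>(leb_Omega :: (real^'n) measure))"
        using i b by (intro integral_mono) auto
      finally show ?thesis by (intro ennreal_leI) (simp add: L.prob_space[simplified space_leb_Omega])
    qed
    have "Lnorm p (count_space \<Phi>) (\<lambda>\<phi>. ennreal \<bar>inner_Omega f \<phi>\<bar>) \<le> ennreal (K powr e * (B * K))"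
      unfolding e_def using fin\<Phi> \<Phi>b p K(1) card\<Phi> B0 by (intro Lnorm_count_space_finite_le) auto
    also have "\<dots> \<le> ennreal (K2 * K2 * B)"
    proof (intro ennreal_leI)
      have "K powr e \<le> K powr 1" using e K(1) by (intro powr_mono) auto
      then have "K powr e * (B * K) \<le> K2 * (B * K2)" using K(1) K2 B0 by (intro mult_mono) auto
      then show "K powr e * (B * K) \<le> K2 * K2 * B" by (simp add: mult_ac)
    qed
    finally have 1: "Lnorm p (count_space \<Phi>) (\<lambda>\<phi>. ennreal \<bar>inner_Omega f \<phi>\<bar>) \<le> ennreal (K2 * K2 * B)" .
    have level: "ennreal (2 powr (real k * s) * 2 powr (real CARD('n) * real k * (1 / 2 - enn2real (1 / p)))) *
       Lnorm p (count_space (\<Psi> k)) (\<lambda>\<psi>. ennreal \<bar>inner_Omega f \<psi>\<bar>) \<le> ennreal (K2 * (2 powr (real k * s) * a k))" for k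
    proof -
      define D where "D = real CARD('n) * real k"
      define w where "w = wav_scale TYPE('n) k"
      have w: "0 < w" "w = 2 powr (D / 2)" by (simp_all add: w_def D_def wav_scale_def)
      have pw: "2 ^ (k * CARD('n)) = 2 powr D" by (subst powr_realpow[symmetric]) (auto simp: D_def mult.commute)
      have "Lnorm p (count_space (\<Psi> k)) (\<lambda>\<psi>. ennreal \<bar>inner_Omega f \<psi>\<bar>) \<le> ennreal ((K2 * 2 powr D) powr e * (a k / w))"
        unfolding e_def
      proof (rule Lnorm_count_space_finite_le[OF fin\<Psi>])
        show "ennreal \<bar>inner_Omega f \<psi>\<bar> \<le> ennreal (a k / w)" if "\<psi> \<in> \<Psi> k" for \<psi>
          using a that by (intro ennreal_leI) (auto simp: w_def)
        show "0 \<le> a k / w" using a w by auto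
        have "1 * 1 \<le> K2 * 2 powr D" using K2 by (intro mult_mono) (auto simp: D_def ge_one_powr_ge_zero)
        then show "1 \<le> K2 * 2 powr D" by simp
        show "real (card (\<Psi> k)) \<le> K2 * 2 powr D" using card\<Psi>[of k] by (simp add: pw)
      qed (rule p)
      then have "ennreal (2 powr (real k * s) * 2 powr (D * (1 / 2 - e))) *
        Lnorm p (count_space (\<Psi> k)) (\<lambda>\<psi>. ennreal \<bar>inner_Omega f \<psi>\<bar>)
        \<le> ennreal (2 powr (real k * s) * 2 powr (D * (1 / 2 - e))) * ennreal ((K2 * 2 powr D) powr e * (a k / w))"
        by (intro mult_left_mono) auto
      also have "\<dots> = ennreal (2 powr (real k * s) * 2 powr (D * (1 / 2 - e)) * ((K2 * 2 powr D) powr e * (a k / w)))"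
        using a w by (intro ennreal_mult[symmetric]) auto
      also have "\<dots> \<le> ennreal (K2 * (2 powr (real k * s) * a k))"
      proof (intro ennreal_leI)
        \<comment> \<open>The cancellation of \<open>p\<close>: here \<open>e\<close> is
          \<open>1/p\<close>, and it is 0 for \<open>p = \<top>\<close>.\<close>
        have "2 powr (D * (1 / 2 - e)) * (2 powr D) powr e = w"
          by (simp add: w powr_powr powr_add[symmetric] algebra_simps)
        then have "2 powr (real k * s) * 2 powr (D * (1 / 2 - e)) * ((K2 * 2 powr D) powr e * (a k / w))
           = K2 powr e * (2 powr (real k * s) * a k) * (w / w)"
          by (simp add: powr_mult mult_ac)
        also have "\<dots> = K2 powr e * (2 powr (real k * s) * a k)" using w by simp
        also have "\<dots> \<le> K2 powr 1 * (2 powr (real k * s) * a k)"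
          using K2 e a by (intro mult_right_mono powr_mono) auto
        finally show "2 powr (real k * s) * 2 powr (D * (1 / 2 - e)) * ((K2 * 2 powr D) powr e * (a k / w))
           \<le> K2 * (2 powr (real k * s) * a k)" using K2 by simp
      qed
      finally show ?thesis by (simp only: D_def e_def mult.assoc)
    qed
    have 2: "Lnorm q (count_space UNIV) (\<lambda>k. ennreal (2 powr (real k * s) * 2 powr (real CARD('n) * real k * (1 / 2 - enn2real (1 / p)))) *
       Lnorm p (count_space (\<Psi> k)) (\<lambda>\<psi>. ennreal \<bar>inner_Omega f \<psi>\<bar>)) \<le> ennreal (K2 * S)"
    proof (rule Lnorm_sequence_le[OF level _ _ q])
      show "0 \<le> K2 * (2 powr (real k * s) * a k)" for k using K2 a by (intro mult_nonneg_nonneg) auto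
      show "(\<Sum>k<n. K2 * (2 powr (real k * s) * a k)) \<le> K2 * S" for n
        unfolding sum_distrib_left[symmetric] using S K2 by (intro mult_left_mono) auto
    qed
    have S0: "0 \<le> S" using S[rule_format, of 0] by simp
    have "besov_norm \<Phi> \<Psi> s p q f \<le> ennreal (K2 * K2 * B) + ennreal (K2 * S)"
      unfolding besov_norm_def by (intro add_mono 1 2)
    also have "\<dots> = ennreal (K2 * K2 * B + K2 * S)" using K2 B0 S0 by (intro ennreal_plus[symmetric]) auto
    also have "\<dots> \<le> ennreal (K2 * K2 * (B + S))"
    proof (intro ennreal_leI)
      have "1 * (K2 * S) \<le> K2 * (K2 * S)" using K2 S0 by (intro mult_right_mono) auto
      then show "K2 * K2 * B + K2 * S \<le> K2 * K2 * (B + S)" by (simp add: algebra_simps)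
    qed
    finally show "besov_norm \<Phi> \<Psi> s p q f \<le> ennreal (K2 * K2 * (B + S))" .
  qed
qed

end


section \<open>Sums of bumps with disjoint supports\<close>

lemma polys_continuous: "f \<in> polys_deg_le r \<Longrightarrow> continuous_on S f"
proof -
  assume "f \<in> polys_deg_le r"
  then obtain c where c: "f = (\<lambda>x. \<Sum>\<alpha> | real (\<Sum>i\<in>UNIV. \<alpha> i) \<le> r. c \<alpha> * (\<Prod>i\<in>UNIV. (x $ i) ^ \<alpha> i))"
    unfolding polys_deg_le_def by blast
  show ?thesis unfolding c by (intro continuous_intros)
qed

text \<open>Balls of radius \<open>1/\<rho>\<close> around centres at distance at least
  \<open>2/\<rho>\<close> meet at most on their boundaries, where the bumps vanish.\<close>

lemma sum_bumps_at:
  fixes T :: "(real^'n) set"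
  assumes T: "finite T" and \<rho>: "0 < \<rho>" and N: "N \<ge> 1"
    and sep: "\<And>c c'. c \<in> T \<Longrightarrow> c' \<in> T \<Longrightarrow> c \<noteq> c' \<Longrightarrow> 2 / \<rho> \<le> norm (c - c')"
    and Q: "Q \<in> T" "norm (x - Q) \<le> 1 / \<rho>"
  shows "(\<Sum>c\<in>T. \<theta> c * bump c \<rho> N x) = \<theta> Q * bump Q \<rho> N x"
proof -
  have "bump c \<rho> N x = 0" if "c \<in> T" "c \<noteq> Q" for c
  proof (rule bump_eq_0[OF \<rho> _ N])
    have "2 / \<rho> \<le> norm (c - Q)" using sep that Q by auto
    also have "\<dots> \<le> norm (x - c) + norm (x - Q)" using norm_triangle_ineq4[of "x - Q" "x - c"] by simp
    finally show "1 / \<rho> \<le> norm (x - c)" using Q by (simp add: add_divide_distrib[symmetric] field_simps)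
  qed
  then have "(\<Sum>c\<in>T. \<theta> c * bump c \<rho> N x) = (\<Sum>c\<in>T. if c = Q then \<theta> Q * bump Q \<rho> N x else 0)"
    by (intro sum.cong) auto
  then show ?thesis using T Q by simp
qed

lemma sum_bumps_outside:
  assumes \<rho>: "0 < \<rho>" and N: "N \<ge> 1" and "\<And>Q. Q \<in> T \<Longrightarrow> 1 / \<rho> \<le> norm (x - Q)"
  shows "(\<Sum>c\<in>T. \<theta> c * bump c \<rho> N x) = 0"
  using assms by (intro sum.neutral) (auto intro: bump_eq_0)

lemma sum_bumps_bound:
  fixes T :: "(real^'n) set"
  assumes T: "finite T" and \<rho>: "0 < \<rho>" and N: "N \<ge> 1"
    and sep: "\<And>c c'. c \<in> T \<Longrightarrow> c' \<in> T \<Longrightarrow> c \<noteq> c' \<Longrightarrow> 2 / \<rho> \<le> norm (c - c')"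
    and \<theta>: "\<And>c. c \<in> T \<Longrightarrow> \<bar>\<theta> c\<bar> \<le> 1"
  shows "\<bar>\<Sum>c\<in>T. \<theta> c * bump c \<rho> N x\<bar> \<le> 1"
proof (cases "\<exists>Q\<in>T. norm (x - Q) \<le> 1 / \<rho>")
  case True
  then obtain Q where Q: "Q \<in> T" "norm (x - Q) \<le> 1 / \<rho>" by auto
  have "\<bar>\<theta> Q\<bar> * bump Q \<rho> N x \<le> 1 * 1"
    using \<theta> Q bump_le_1 bump_nonneg by (intro mult_mono) auto
  then show ?thesis using sum_bumps_at[OF T \<rho> N sep Q, of \<theta>] bump_nonneg[of Q \<rho> N x] by (simp add: abs_mult)
next
  case False
  then show ?thesis using sum_bumps_outside[OF \<rho> N, of T x \<theta>] by force
qed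

text \<open>On a set that fits into one ball the bump is approximated by its Taylor polynomial;
  otherwise every point of the set is close to the boundary of the ball, where the bump vanishes
  to order \<open>N\<close>.\<close>

lemma sum_bumps_approx:
  assumes N: "N \<ge> 1"
  shows "\<exists>K\<ge>1. \<forall>(T :: (real^'n) set) \<theta> \<rho> I \<delta> r. finite T \<longrightarrow> 0 < \<rho> \<longrightarrow>
    (\<forall>c\<in>T. \<forall>c'\<in>T. c \<noteq> c' \<longrightarrow> 2 / \<rho> \<le> norm (c - c')) \<longrightarrow> (\<forall>c\<in>T. \<bar>\<theta> c\<bar> \<le> 1) \<longrightarrow>
    real N \<le> r + 1 \<longrightarrow> (\<forall>x\<in>I. \<forall>y\<in>I. \<rho> * norm (x - y) \<le> \<delta>) \<longrightarrow>
    (\<exists>P\<in>polys_deg_le r. \<forall>x\<in>I. \<bar>(\<Sum>c\<in>T. \<theta> c * bump c \<rho> N x) - P x\<bar> \<le> K * \<delta> ^ N)"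
proof -
  obtain K0 where K0: "K0 \<ge> 0" and "\<forall>(c::real^'n) \<rho> x0 r. \<rho> > 0 \<longrightarrow> norm (x0 - c) \<le> 1 / \<rho> \<longrightarrow> real N \<le> r + 1 \<longrightarrow>
    (\<exists>P\<in>polys_deg_le r. \<forall>\<delta> x. \<rho> * norm (x - x0) \<le> \<delta> \<longrightarrow> \<delta> \<le> 1 \<longrightarrow>
      \<bar>(1 - \<rho>\<^sup>2 * (norm (x - c))\<^sup>2) ^ N - P x\<bar> \<le> K0 * \<delta> ^ N)"
    using bump_Taylor[of N] by (elim exE conjE)
  note K0T = this(2)[rule_format]
  define K where "K = max K0 (2 ^ N)"
  have K: "1 \<le> K" "K0 \<le> K" "2 ^ N \<le> K" unfolding K_def using one_le_power[of "2::real" N] by linarith+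
  show ?thesis
  proof (intro exI[of _ K] conjI allI impI K(1))
    fix T I :: "(real^'n) set" and \<theta> :: "real^'n \<Rightarrow> real" and \<rho> \<delta> r :: real
    assume T: "finite T" and \<rho>: "0 < \<rho>" and sep: "\<forall>c\<in>T. \<forall>c'\<in>T. c \<noteq> c' \<longrightarrow> 2 / \<rho> \<le> norm (c - c')"
      and \<theta>: "\<forall>c\<in>T. \<bar>\<theta> c\<bar> \<le> 1" and Nr: "real N \<le> r + 1" and diam: "\<forall>x\<in>I. \<forall>y\<in>I. \<rho> * norm (x - y) \<le> \<delta>"
    define H where "H x = (\<Sum>c\<in>T. \<theta> c * bump c \<rho> N x)" for x
    have H1: "\<bar>H x\<bar> \<le> 1" for x
      unfolding H_def using T \<rho> N sep \<theta> by (intro sum_bumps_bound) auto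
    have H_at: "H x = \<theta> Q * bump Q \<rho> N x" if "Q \<in> T" "norm (x - Q) \<le> 1 / \<rho>" for x Q
      unfolding H_def using T \<rho> N sep that by (intro sum_bumps_at) auto
    show "\<exists>P\<in>polys_deg_le r. \<forall>x\<in>I. \<bar>(\<Sum>c\<in>T. \<theta> c * bump c \<rho> N x) - P x\<bar> \<le> K * \<delta> ^ N"
    proof (cases "I = {}")
      case True
      then show ?thesis using polys_zero[of r] by blast
    next
      case False
      then obtain x0 where x0: "x0 \<in> I" by auto
      have \<delta>0: "0 \<le> \<delta>" using diam[rule_format, OF x0 x0] by simp
      \<comment> \<open>For large \<delta> the zero polynomial suffices, since the sum is bounded by
        1. Otherwise \<open>I\<close> either fits into one ball or has a point outside each of
        them.\<close>
      consider "\<delta> > 1" | Q where "\<delta> \<le> 1" "Q \<in> T" "\<forall>x\<in>I. norm (x - Q) \<le> 1 / \<rho>"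
        | "\<delta> \<le> 1" "\<forall>Q\<in>T. \<exists>y\<in>I. 1 / \<rho> < norm (y - Q)" by force
      then show ?thesis
      proof cases
        case 1
        have "\<bar>H x - 0\<bar> \<le> K * \<delta> ^ N" for x
        proof -
          have "1 * 1 \<le> K * \<delta> ^ N" using K 1 by (intro mult_mono one_le_power) auto
          then show ?thesis using H1[of x] by simp
        qed
        then show ?thesis using polys_zero[of r] unfolding H_def by (intro bexI[of _ "\<lambda>_. 0"]) simp_all
      next
        case 2
        obtain P where P: "P \<in> polys_deg_le r" "\<And>\<delta> x. \<rho> * norm (x - x0) \<le> \<delta> \<Longrightarrow> \<delta> \<le> 1 \<Longrightarrow>
           \<bar>(1 - \<rho>\<^sup>2 * (norm (x - Q))\<^sup>2) ^ N - P x\<bar> \<le> K0 * \<delta> ^ N"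
          using K0T[OF \<rho> 2(3)[rule_format, OF x0] Nr] by blast
        show ?thesis
        proof (intro bexI[of _ "\<lambda>x. \<theta> Q * P x"] ballI polys_scale P(1))
          fix x assume x: "x \<in> I"
          have "H x - \<theta> Q * P x = \<theta> Q * ((1 - \<rho>\<^sup>2 * (norm (x - Q))\<^sup>2) ^ N - P x)"
            using H_at[OF 2(2)] 2(3) x bump_eq[OF \<rho>, of x Q N] by (simp add: right_diff_distrib)
          then have "\<bar>H x - \<theta> Q * P x\<bar> = \<bar>\<theta> Q\<bar> * \<bar>(1 - \<rho>\<^sup>2 * (norm (x - Q))\<^sup>2) ^ N - P x\<bar>"
            by (simp add: abs_mult)
          also have "\<dots> \<le> 1 * (K * \<delta> ^ N)"
          proof (intro mult_mono)
            show "\<bar>\<theta> Q\<bar> \<le> 1" using \<theta> 2(2) by auto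
            have "\<bar>(1 - \<rho>\<^sup>2 * (norm (x - Q))\<^sup>2) ^ N - P x\<bar> \<le> K0 * \<delta> ^ N"
              using diam x x0 2(1) by (intro P(2)) auto
            also have "\<dots> \<le> K * \<delta> ^ N" using K(2) \<delta>0 by (intro mult_right_mono) auto
            finally show "\<bar>(1 - \<rho>\<^sup>2 * (norm (x - Q))\<^sup>2) ^ N - P x\<bar> \<le> K * \<delta> ^ N" .
          qed auto
          finally show "\<bar>(\<Sum>c\<in>T. \<theta> c * bump c \<rho> N x) - \<theta> Q * P x\<bar> \<le> K * \<delta> ^ N" by (simp add: H_def)
        qed
      next
        case 3
        have "\<bar>H x - 0\<bar> \<le> K * \<delta> ^ N" if x: "x \<in> I" for x
        proof (cases "\<exists>Q\<in>T. norm (x - Q) < 1 / \<rho>")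
          case True
          then obtain Q where Q: "Q \<in> T" "norm (x - Q) < 1 / \<rho>" by auto
          obtain y where y: "y \<in> I" "1 / \<rho> < norm (y - Q)" using 3(2) Q(1) by auto
          define u where "u = \<rho> * norm (x - Q)"
          have u: "0 \<le> u" "u < 1" using Q \<rho> by (auto simp: u_def field_simps)
          have "1 < \<rho> * norm (y - Q)" using y \<rho> by (simp add: field_simps)
          also have "\<dots> \<le> \<rho> * (norm (x - Q) + norm (x - y))"
            using norm_triangle_ineq4[of "x - Q" "x - y"] \<rho> by (intro mult_left_mono) auto
          also have "\<dots> \<le> u + \<delta>" using diam x y by (simp add: u_def distrib_left)
          finally have "1 - \<delta> \<le> u" by simp
          \<comment> \<open>Indeed \<open>1 - u^2 <= 1 - (1 - \<delta>)^2 <= 2 \<delta>\<close>: the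
            base of the bump is small near the sphere. This is the source of \<open>2 ^ N\<close> in
            \<open>K\<close>.\<close>
          then have "1 - u\<^sup>2 \<le> 2 * \<delta>"
          proof -
            have "(1 - \<delta>)\<^sup>2 \<le> u\<^sup>2" using \<open>1 - \<delta> \<le> u\<close> 3(1) by (intro power_mono) auto
            then show ?thesis by (simp add: power2_diff) (smt (verit) zero_le_power2)
          qed
          moreover have "0 \<le> 1 - u\<^sup>2" using u by (simp add: power_le_one)
          ultimately have "(1 - u\<^sup>2) ^ N \<le> (2 * \<delta>) ^ N" by (intro power_mono) auto
          moreover have "bump Q \<rho> N x = (1 - u\<^sup>2) ^ N"
            using bump_eq[OF \<rho>, of x Q N] Q by (simp add: u_def power_mult_distrib)
          ultimately have b: "bump Q \<rho> N x \<le> 2 ^ N * \<delta> ^ N" by (simp add: power_mult_distrib)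
          have "\<bar>H x\<bar> = \<bar>\<theta> Q\<bar> * bump Q \<rho> N x"
            using H_at[of Q x] Q bump_nonneg[of Q \<rho> N x] by (simp add: abs_mult)
          also have "\<dots> \<le> 1 * (2 ^ N * \<delta> ^ N)"
            using \<theta> Q(1) b bump_nonneg[of Q \<rho> N x] by (intro mult_mono) auto
          also have "\<dots> \<le> K * \<delta> ^ N" using K(3) \<delta>0 by (simp add: mult_right_mono)
          finally show ?thesis by simp
        next
          case False
          then have "H x = 0" unfolding H_def by (intro sum_bumps_outside[OF \<rho> N]) force
          then show ?thesis using K \<delta>0 by simp
        qed
        then show ?thesis using polys_zero[of r] unfolding H_def by (intro bexI[of _ "\<lambda>_. 0"]) simp_all
      qed
    qed
  qed
qed

lemma content_cbox_le:
  fixes a b :: "real^'n"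
  assumes "0 \<le> D" and "cbox a b \<noteq> {} \<Longrightarrow> norm (b - a) \<le> D"
  shows "measure lborel (cbox a b) \<le> D ^ CARD('n)"
proof (cases "cbox a b = {}")
  case False
  then have le: "a $ i \<le> b $ i" for i by (simp add: interval_ne_empty_cart)
  have "b $ i - a $ i \<le> D" for i
    using component_le_norm_cart[of "b - a" i] assms(2)[OF False] by simp
  then have "(\<Prod>i\<in>UNIV. b $ i - a $ i) \<le> (\<Prod>i\<in>(UNIV :: 'n set). D)"
    using le by (intro prod_mono) auto
  then show ?thesis using content_cbox_cart[OF False] by simp
qed (use assms in simp)

lemma emeasure_cbox_less_top: "emeasure lborel (cbox a b :: (real^'n) set) < \<top>"
  using emeasure_lborel_cbox_finite[of a b] by (metis infinity_ennreal_def)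

lemma lborel_translate:
  fixes f :: "real^'n \<Rightarrow> real"
  assumes [measurable]: "f \<in> borel_measurable borel"
  shows "(\<integral>x. f x \<partial>lborel) = (\<integral>x. f (x + v) \<partial>lborel)"
    and "integrable lborel f \<longleftrightarrow> integrable lborel (\<lambda>x. f (x + v))"
proof -
  have d: "lborel = distr lborel borel (\<lambda>x. x + v)"
    by (subst lborel_distr_plus[of v, symmetric]) (intro arg_cong[where f = "distr lborel borel"], auto simp: add.commute)
  show "(\<integral>x. f x \<partial>lborel) = (\<integral>x. f (x + v) \<partial>lborel)"
    by (subst d, subst integral_distr) auto
  show "integrable lborel f \<longleftrightarrow> integrable lborel (\<lambda>x. f (x + v))"
    by (subst d, subst integrable_distr_eq) auto
qed

lemma integral_leb_Omega_eq:
  fixes f :: "real^'n \<Rightarrow> real"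
  shows "(\<integral>x. f x \<partial>leb_Omega) = (\<integral>x. indicator Omega x * f x \<partial>lborel)"
  by (subst integral_restrict_space) auto

context wavelet_system
begin

text \<open>Subtracting the polynomial from \<open>sum_bumps_approx\<close> does not change the
  coefficient. On the support of \<psi>, whose diameter is of order \<open>2^(-k)\<close>, the error
  is of order \<open>(\<rho> / 2^k)^N\<close>, and the \<open>L_1\<close> norm of \<psi> contributes
  \<open>1 / wav_scale k\<close>. The signs play no part in the estimate, so it applies to dipoles
  and to single bumps alike.\<close>

lemma fine_coefficients:
  assumes r: "1 < r" and N: "N \<ge> 1" "real N \<le> r + 1"
  shows "\<exists>K\<ge>1. \<forall>k \<psi> (T :: (real^'n) set) \<theta> \<rho>. \<psi> \<in> \<Psi> k \<longrightarrow> finite T \<longrightarrow> 0 < \<rho> \<longrightarrow>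
    (\<forall>c\<in>T. \<forall>c'\<in>T. c \<noteq> c' \<longrightarrow> 2 / \<rho> \<le> norm (c - c')) \<longrightarrow> (\<forall>c\<in>T. \<bar>\<theta> c\<bar> \<le> 1) \<longrightarrow>
    \<bar>inner_Omega (\<lambda>x. \<Sum>c\<in>T. \<theta> c * bump c \<rho> N x) \<psi>\<bar> \<le> K * (\<rho> / 2 ^ k) ^ N / wav_scale TYPE('n) k"
proof -
  obtain K1 where K1: "K1 \<ge> 1" and "\<forall>(T :: (real^'n) set) \<theta> \<rho> I \<delta> r. finite T \<longrightarrow> 0 < \<rho> \<longrightarrow>
    (\<forall>c\<in>T. \<forall>c'\<in>T. c \<noteq> c' \<longrightarrow> 2 / \<rho> \<le> norm (c - c')) \<longrightarrow> (\<forall>c\<in>T. \<bar>\<theta> c\<bar> \<le> 1) \<longrightarrow>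
    real N \<le> r + 1 \<longrightarrow> (\<forall>x\<in>I. \<forall>y\<in>I. \<rho> * norm (x - y) \<le> \<delta>) \<longrightarrow>
    (\<exists>P\<in>polys_deg_le r. \<forall>x\<in>I. \<bar>(\<Sum>c\<in>T. \<theta> c * bump c \<rho> N x) - P x\<bar> \<le> K1 * \<delta> ^ N)"
    using sum_bumps_approx[OF N(1)] by (elim exE conjE)
  note approx = this(2)[THEN spec, THEN spec, THEN spec, THEN spec, THEN spec, THEN spec, THEN mp, THEN mp, THEN mp, THEN mp, THEN mp, THEN mp]
  obtain K2 where K2: "K2 \<ge> 1" and L1: "\<forall>k. \<forall>\<psi>\<in>\<Psi> k. (\<integral>x. \<bar>\<psi> x\<bar> \<partial>leb_Omega) \<le> K2 / wav_scale TYPE('n) k"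
    using wavelet_L1[OF r] by (elim exE conjE)
  obtain K3 where K3: "K3 \<ge> 1" and supp: "\<forall>k. \<forall>\<psi>\<in>\<Psi> k. \<exists>a b. cbox a b \<subseteq> Omega \<and> {x \<in> Omega. \<psi> x \<noteq> 0} \<subseteq> cbox a b
      \<and> diameter (cbox a b) \<le> K3 / 2 ^ k"
    using wavelet_support by (elim exE conjE)
  define K where "K = K1 * K3 ^ N * K2"
  show ?thesis
  proof (intro exI[of _ K] conjI allI impI)
    have "1 * 1 * 1 \<le> K" unfolding K_def using K1 K2 K3 by (intro mult_mono one_le_power) auto
    then show "1 \<le> K" by simp
    fix k \<psi> and T :: "(real^'n) set" and \<theta> :: "real^'n \<Rightarrow> real" and \<rho> :: real
    assume \<psi>: "\<psi> \<in> \<Psi> k" and T: "finite T" and \<rho>: "0 < \<rho>"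
      and sep: "\<forall>c\<in>T. \<forall>c'\<in>T. c \<noteq> c' \<longrightarrow> 2 / \<rho> \<le> norm (c - c')" and \<theta>: "\<forall>c\<in>T. \<bar>\<theta> c\<bar> \<le> 1"
    define H where "H x = (\<Sum>c\<in>T. \<theta> c * bump c \<rho> N x)" for x
    obtain a b where ab: "{x \<in> Omega. \<psi> x \<noteq> 0} \<subseteq> cbox a b" "diameter (cbox a b) \<le> K3 / 2 ^ k"
      using supp[rule_format, OF \<psi>] by (elim exE conjE)
    define \<delta> where "\<delta> = \<rho> * (K3 / 2 ^ k)"
    have \<delta>0: "0 \<le> \<delta>" using \<rho> K3 by (simp add: \<delta>_def)
    have diam: "\<forall>x\<in>cbox a b. \<forall>y\<in>cbox a b. \<rho> * norm (x - y) \<le> \<delta>"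
    proof (intro ballI)
      fix x y assume "x \<in> cbox a b" "y \<in> cbox a b"
      then have "dist x y \<le> diameter (cbox a b)" by (intro diameter_bounded_bound bounded_cbox)
      then show "\<rho> * norm (x - y) \<le> \<delta>" unfolding \<delta>_def using ab(2) \<rho>
        by (intro mult_left_mono) (auto simp: dist_norm)
    qed
    obtain P where P: "P \<in> polys_deg_le r" "\<forall>x\<in>cbox a b. \<bar>H x - P x\<bar> \<le> K1 * \<delta> ^ N"
      using approx[OF T \<rho> sep \<theta> N(2) diam] unfolding H_def by (elim bexE)
    have \<psi>c: "continuous_on Omega \<psi>" using \<psi> by (intro coarse_continuous[OF r, of _ "Suc k"]) auto
    have Hc: "continuous_on Omega H" unfolding H_def by (intro continuous_intros)
    have Pc: "continuous_on Omega P" using P(1) by (rule polys_continuous)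
    have "inner_Omega H \<psi> = inner_Omega H \<psi> - inner_Omega P \<psi>" using inner_polys[OF r P(1) \<psi>] by simp
    also have "\<dots> = (\<integral>x. (H x - P x) * \<psi> x \<partial>leb_Omega)"
      using \<psi>c Hc Pc by (subst Bochner_Integration.integral_diff[symmetric])
        (auto intro!: integrable_leb_Omega_continuous continuous_intros simp: left_diff_distrib)
    finally have "\<bar>inner_Omega H \<psi>\<bar> \<le> (\<integral>x. \<bar>(H x - P x) * \<psi> x\<bar> \<partial>leb_Omega)"
      by (simp only: integral_abs_bound)
    also have "\<dots> \<le> (\<integral>x. K1 * \<delta> ^ N * \<bar>\<psi> x\<bar> \<partial>leb_Omega)"
    proof (intro integral_mono)
      fix x assume "x \<in> space (leb_Omega :: (real^'n) measure)"
      then have "\<psi> x \<noteq> 0 \<Longrightarrow> x \<in> cbox a b" using ab(1) by auto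
      then show "\<bar>(H x - P x) * \<psi> x\<bar> \<le> K1 * \<delta> ^ N * \<bar>\<psi> x\<bar>"
        using P(2) by (cases "\<psi> x = 0") (auto simp: abs_mult intro!: mult_right_mono)
    qed (use \<psi>c Hc Pc in \<open>auto intro!: integrable_leb_Omega_continuous continuous_intros\<close>)
    also have "\<dots> = K1 * \<delta> ^ N * (\<integral>x. \<bar>\<psi> x\<bar> \<partial>leb_Omega)" by simp
    also have "\<dots> \<le> K1 * \<delta> ^ N * (K2 / wav_scale TYPE('n) k)"
      using K1 \<delta>0 L1 \<psi> by (intro mult_left_mono) auto
    also have "\<dots> = K * (\<rho> / 2 ^ k) ^ N / wav_scale TYPE('n) k"
      by (simp add: K_def \<delta>_def power_mult_distrib power_divide)
    finally show "\<bar>inner_Omega (\<lambda>x. \<Sum>c\<in>T. \<theta> c * bump c \<rho> N x) \<psi>\<bar> \<le> K * (\<rho> / 2 ^ k) ^ N / wav_scale TYPE('n) k"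
      unfolding H_def .
  qed
qed

text \<open>Shifting the difference operator from \<open>G\<close> to the wavelet gains the factor \<open>2\<^sup>k |v|\<close>. This is
  what makes the low frequencies of a sum of dipoles negligible, also for \<open>s = 0\<close>.\<close>

lemma coarse_coefficients:
  assumes r: "1 < r"
  shows "\<exists>K\<ge>1. \<forall>k \<psi> v G. \<psi> \<in> \<Psi> k \<longrightarrow> continuous_on UNIV G \<longrightarrow> (\<forall>x. \<bar>G x\<bar> \<le> 1) \<longrightarrow>
    (\<forall>x. G x \<noteq> 0 \<longrightarrow> x \<in> Omega \<and> x + v \<in> Omega) \<longrightarrow>
    \<bar>inner_Omega (\<lambda>x. G x - G (x - v)) \<psi>\<bar> \<le> K * (norm v * 2 ^ k) / wav_scale TYPE('n) k"
proof -
  obtain K2 where K2: "K2 \<ge> 1" and lip: "\<forall>k. \<forall>\<psi>\<in>\<Psi> k. \<forall>x\<in>Omega. \<forall>y\<in>Omega.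
    \<bar>\<psi> x - \<psi> y\<bar> \<le> K2 * 2 ^ k * wav_scale TYPE('n) k * norm (x - y)"
    using wavelet_Lipschitz[OF r] by (elim exE conjE)
  obtain K3 where K3: "K3 \<ge> 1" and supp: "\<forall>k. \<forall>\<psi>\<in>\<Psi> k. \<exists>a b. cbox a b \<subseteq> Omega \<and> {x \<in> Omega. \<psi> x \<noteq> 0} \<subseteq> cbox a b
      \<and> diameter (cbox a b) \<le> K3 / 2 ^ k"
    using wavelet_support by (elim exE conjE)
  define K where "K = 2 * K2 * K3 ^ CARD('n)"
  show ?thesis
  proof (intro exI[of _ K] conjI allI impI)
    have "1 * 1 * 1 \<le> K" unfolding K_def using K2 K3 by (intro mult_mono one_le_power) auto
    then show "1 \<le> K" by simp
    fix k \<psi> and v :: "real^'n" and G :: "real^'n \<Rightarrow> real"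
    assume \<psi>: "\<psi> \<in> \<Psi> k" and Gc: "continuous_on UNIV G" and G1: "\<forall>x. \<bar>G x\<bar> \<le> 1"
      and Gs: "\<forall>x. G x \<noteq> 0 \<longrightarrow> x \<in> Omega \<and> x + v \<in> Omega"
    obtain a b where ab: "cbox a b \<subseteq> Omega" "{x \<in> Omega. \<psi> x \<noteq> 0} \<subseteq> cbox a b" "diameter (cbox a b) \<le> K3 / 2 ^ k"
      using supp[rule_format, OF \<psi>] by (elim exE conjE)
    have \<psi>c: "continuous_on Omega \<psi>" using \<psi> by (intro coarse_continuous[OF r, of _ "Suc k"]) auto
    have Gm [measurable]: "G \<in> borel_measurable borel" using Gc by (rule borel_measurable_continuous_onI)
    define w where "w = wav_scale TYPE('n) k"
    have w0: "0 < w" by (simp add: w_def wav_scale_pos)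
    \<comment> \<open>Extension by zero, so that the translation can be carried out on the whole
      space.\<close>
    define \<psi>0 where "\<psi>0 x = indicator Omega x * \<psi> x" for x
    have [measurable]: "\<psi>0 \<in> borel_measurable borel"
      using measurable_leb_Omega_continuous[OF \<psi>c] unfolding \<psi>0_def
      by (subst (asm) borel_measurable_restrict_space_iff) auto
    have "compact (\<psi> ` Omega)" using \<psi>c by (intro compact_continuous_image) auto
    then obtain M where M: "\<And>x. x \<in> Omega \<Longrightarrow> \<bar>\<psi> x\<bar> \<le> M"
      using compact_imp_bounded bounded_iff by (metis image_eqI real_norm_def)
    have M0: "0 \<le> M" using M[of 0] by (auto simp: mem_box_cart)
    have int_i: "integrable lborel (\<lambda>x :: real^'n. M * indicator Omega x)"
      by (intro integrable_mult_right integrable_real_indicator) (auto simp: emeasure_cbox_less_top intro!: integrable_real_indicator)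
    have int: "integrable lborel (\<lambda>x. F x * \<psi>0 x)" if [measurable]: "F \<in> borel_measurable borel" and F: "\<And>x. \<bar>F x\<bar> \<le> 1" for F
    proof (rule Bochner_Integration.integrable_bound[OF int_i])
      show "AE x in lborel. norm (F x * \<psi>0 x) \<le> norm (M * indicator Omega x)"
      proof (intro AE_I2)
        fix x
        have "\<bar>F x\<bar> * \<bar>\<psi>0 x\<bar> \<le> 1 * (M * indicator Omega x)"
          using F[of x] M[of x] M0 by (intro mult_mono) (auto simp: \<psi>0_def indicator_def)
        then show "norm (F x * \<psi>0 x) \<le> norm (M * indicator Omega x)" using M0 by (simp add: abs_mult)
      qed
    qed simp
    have i1: "integrable lborel (\<lambda>x. G x * \<psi>0 x)" using G1 by (intro int) auto
    have i2: "integrable lborel (\<lambda>x. G (x - v) * \<psi>0 x)" using G1 by (intro int) auto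
    have i3: "integrable lborel (\<lambda>x. G x * \<psi>0 (x + v))"
      using i2 lborel_translate(2)[of "\<lambda>x. G (x - v) * \<psi>0 x" v] by simp
    have "inner_Omega (\<lambda>x. G x - G (x - v)) \<psi> = (\<integral>x. G x * \<psi>0 x - G (x - v) * \<psi>0 x \<partial>lborel)"
      unfolding integral_leb_Omega_eq \<psi>0_def
      by (intro Bochner_Integration.integral_cong) (auto simp: algebra_simps)
    also have "\<dots> = (\<integral>x. G x * \<psi>0 x \<partial>lborel) - (\<integral>x. G (x - v) * \<psi>0 x \<partial>lborel)"
      using i1 i2 by simp
    also have "(\<integral>x. G (x - v) * \<psi>0 x \<partial>lborel) = (\<integral>x. G x * \<psi>0 (x + v) \<partial>lborel)"
      using lborel_translate(1)[of "\<lambda>x. G (x - v) * \<psi>0 x" v] by simp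
    also have "(\<integral>x. G x * \<psi>0 x \<partial>lborel) - (\<integral>x. G x * \<psi>0 (x + v) \<partial>lborel) = (\<integral>x. G x * \<psi>0 x - G x * \<psi>0 (x + v) \<partial>lborel)"
      using i1 i3 by simp
    finally have eq: "inner_Omega (\<lambda>x. G x - G (x - v)) \<psi> = (\<integral>x. G x * \<psi>0 x - G x * \<psi>0 (x + v) \<partial>lborel)" .
    define L where "L = K2 * 2 ^ k * w * norm v"
    have L0: "0 \<le> L" using K2 w0 by (simp add: L_def)
    \<comment> \<open>Where \<open>G\<close> is nonzero, both \<open>x\<close> and
      \<open>x + v\<close> lie in the cube, so the jump of \<psi>0 at the boundary is never met and
      the Lipschitz bound of \<psi> applies.\<close>
    have pt: "\<bar>G x * \<psi>0 x - G x * \<psi>0 (x + v)\<bar> \<le> L * (indicator (cbox a b) x + indicator (cbox (a - v) (b - v)) x)" for x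
    proof (cases "G x = 0")
      case True
      then show ?thesis using L0 by simp
    next
      case False
      then have x: "x \<in> Omega" "x + v \<in> Omega" using Gs by auto
      have sh: "x \<in> cbox (a - v) (b - v) \<longleftrightarrow> x + v \<in> cbox a b"
        by (auto simp: mem_box_cart algebra_simps)
      show ?thesis
      proof (cases "x \<in> cbox a b \<or> x + v \<in> cbox a b")
        case True
        have "\<bar>\<psi> x - \<psi> (x + v)\<bar> \<le> K2 * 2 ^ k * w * norm (x - (x + v))"
          using lip[rule_format, OF \<psi> x] by (simp add: w_def)
        then have "\<bar>\<psi> x - \<psi> (x + v)\<bar> \<le> L" by (simp add: L_def)
        then have "\<bar>G x\<bar> * \<bar>\<psi> x - \<psi> (x + v)\<bar> \<le> 1 * L" using G1 by (intro mult_mono) auto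
        also have "1 * L \<le> L * (indicator (cbox a b) x + indicator (cbox (a - v) (b - v)) x)"
          using True L0 by (auto simp: sh indicator_def)
        finally show ?thesis using x by (simp add: \<psi>0_def right_diff_distrib[symmetric] abs_mult)
      next
        case False
        then have "\<psi> x = 0" "\<psi> (x + v) = 0" using ab(2) x by auto
        then show ?thesis using L0 by (simp add: \<psi>0_def)
      qed
    qed
    define D where "D = K3 / 2 ^ k"
    have D0: "0 \<le> D" using K3 by (simp add: D_def)
    have vol: "measure lborel (cbox (a - u) (b - u)) \<le> D ^ CARD('n)" for u
    proof (rule content_cbox_le[OF D0])
      assume "cbox (a - u) (b - u) \<noteq> {}"
      then have "cbox a b \<noteq> {}" by (simp add: interval_ne_empty_cart)
      then have "a \<in> cbox a b" "b \<in> cbox a b" by (simp_all add: interval_ne_empty_cart mem_box_cart)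
      then have "dist b a \<le> diameter (cbox a b)" by (intro diameter_bounded_bound bounded_cbox)
      then show "norm ((b - u) - (a - u)) \<le> D" using ab(3) by (simp add: dist_norm D_def)
    qed
    have int_b: "integrable lborel (\<lambda>x. L * (indicator (cbox a b) x + indicator (cbox (a - v) (b - v)) x))"
      by (intro integrable_mult_right Bochner_Integration.integrable_add integrable_real_indicator)
        (auto simp: emeasure_cbox_less_top intro!: integrable_real_indicator)
    have "\<bar>inner_Omega (\<lambda>x. G x - G (x - v)) \<psi>\<bar> \<le> (\<integral>x. \<bar>G x * \<psi>0 x - G x * \<psi>0 (x + v)\<bar> \<partial>lborel)"
      unfolding eq by (rule integral_abs_bound)
    also have "\<dots> \<le> (\<integral>x. L * (indicator (cbox a b) x + indicator (cbox (a - v) (b - v)) x) \<partial>lborel)"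
      using i1 i3 int_b pt by (intro integral_mono) auto
    also have "\<dots> = L * (measure lborel (cbox a b) + measure lborel (cbox (a - v) (b - v)))"
      by (subst integral_mult_right_zero, subst Bochner_Integration.integral_add)
        (auto simp: emeasure_cbox_less_top intro!: integrable_real_indicator)
    also have "\<dots> \<le> L * (D ^ CARD('n) + D ^ CARD('n))"
      using vol[of v] vol[of 0] L0 by (intro mult_left_mono add_mono) auto
    \<comment> \<open>The volume of the support is of order \<open>w^(-2)\<close>, which turns the
      Lipschitz constant of order \<open>2^k * w\<close> into the required
      \<open>2^k / w\<close>.\<close>
    also have "D ^ CARD('n) = K3 ^ CARD('n) / w\<^sup>2"
      by (simp add: D_def power_divide w_def wav_scale_sq)
    also have "L * (K3 ^ CARD('n) / w\<^sup>2 + K3 ^ CARD('n) / w\<^sup>2) = K * (norm v * 2 ^ k) / w"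
      using w0 by (simp add: L_def K_def power2_eq_square field_simps)
    finally show "\<bar>inner_Omega (\<lambda>x. G x - G (x - v)) \<psi>\<bar> \<le> K * (norm v * 2 ^ k) / wav_scale TYPE('n) k"
      by (simp only: w_def)
  qed
qed

end

text \<open>Two geometric sums that meet at level \<open>j\<close>. Below \<open>j\<close> the
  weight is replaced by its largest value \<open>2^(js)\<close> and the factors
  \<open>2^(k-j)\<close> are summed, which works for \<open>s = 0\<close> too; from \<open>j\<close>
  on the ratio is \<open>2^(s-N) < 1\<close>.\<close>

lemma level_sum:
  assumes s: "0 \<le> s" and N: "s < real N"
  shows "\<exists>S\<ge>0. \<forall>j n. (\<Sum>k<n. 2 powr (real k * s) * (if k < j then 2 ^ k / 2 ^ j else (2 ^ j / 2 ^ k) ^ N))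
    \<le> S * 2 powr (real j * s)"
proof -
  define \<gamma> :: real where "\<gamma> = 2 powr (s - real N)"
  have \<gamma>: "0 < \<gamma>" "\<gamma> < 1" using N by (auto simp: \<gamma>_def powr_less_one)
  define S where "S = 1 + 1 / (1 - \<gamma>)"
  show ?thesis
  proof (intro exI[of _ S] conjI allI)
    show "0 \<le> S" using \<gamma> by (simp add: S_def)
    fix j n :: nat
    define W where "W = 2 powr (real j * s)"
    define t where "t k = 2 powr (real k * s) * (if k < j then 2 ^ k / 2 ^ j else (2 ^ j / 2 ^ k) ^ N)" for k
    have t0: "0 \<le> t k" for k by (simp add: t_def)
    have "(\<Sum>k<j. t k) \<le> (\<Sum>k<j. W * (2 ^ k / 2 ^ j))"
      using s by (intro sum_mono) (auto simp: t_def W_def intro!: divide_right_mono mult_right_mono powr_mono)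
    also have "\<dots> = W * ((2 ^ j - 1) / 2 ^ j)"
    proof -
      have "(\<Sum>k<j. (2::real) ^ k) = 2 ^ j - 1" by (subst geometric_sum) auto
      then show ?thesis by (simp only: sum_distrib_left[symmetric] sum_divide_distrib[symmetric])
    qed
    also have "\<dots> \<le> W * 1" by (intro mult_left_mono) (auto simp: W_def divide_le_eq)
    finally have low: "(\<Sum>k<j. t k) \<le> W" by simp
    have "t (j + i) = W * \<gamma> ^ i" for i
    proof -
      have "t (j + i) = 2 powr (real j * s) * (2 powr (real i * s) * (1 / 2 ^ i) ^ N)"
        by (simp add: t_def powr_add distrib_right power_add)
      also have "2 powr (real i * s) * (1 / 2 ^ i) ^ N = \<gamma> ^ i"
      proof -
        have "(1 / 2 ^ i) ^ N = (2::real) powr (- (real i * real N))"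
        proof -
          have "(1 / 2 ^ i) ^ N = 1 / (2::real) ^ (i * N)" by (simp add: power_mult power_one_over)
          also have "\<dots> = 2 powr (- real (i * N))" by (simp only: powr_minus_divide powr_realpow[OF zero_less_numeral])
          finally show ?thesis by simp
        qed
        then have "2 powr (real i * s) * (1 / 2 ^ i) ^ N = 2 powr ((s - real N) * real i)"
          by (simp add: powr_add[symmetric] algebra_simps)
        also have "\<dots> = \<gamma> ^ i" unfolding \<gamma>_def by (simp add: powr_powr[symmetric] powr_realpow)
        finally show ?thesis .
      qed
      finally show ?thesis by (simp add: W_def)
    qed
    then have "(\<Sum>i<n. t (j + i)) = W * (\<Sum>i<n. \<gamma> ^ i)" by (simp add: sum_distrib_left)
    also have "\<dots> \<le> W * (1 / (1 - \<gamma>))"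
    proof (intro mult_left_mono)
      have "(\<Sum>i<n. \<gamma> ^ i) = (1 - \<gamma> ^ n) / (1 - \<gamma>)" using \<gamma> by (simp add: sum_gp_strict)
      also have "\<dots> \<le> 1 / (1 - \<gamma>)" using \<gamma> by (intro divide_right_mono) auto
      finally show "(\<Sum>i<n. \<gamma> ^ i) \<le> 1 / (1 - \<gamma>)" .
    qed (simp add: W_def)
    finally have high: "(\<Sum>i<n. t (j + i)) \<le> W * (1 / (1 - \<gamma>))" .
    have "(\<Sum>k<n. t k) \<le> (\<Sum>k\<in>{..<j} \<union> (+) j ` {..<n}. t k)"
    proof (rule sum_mono2)
      show "{..<n} \<subseteq> {..<j} \<union> (+) j ` {..<n}"
      proof
        fix k assume "k \<in> {..<n}"
        then show "k \<in> {..<j} \<union> (+) j ` {..<n}"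
          by (cases "k < j") (auto intro!: image_eqI[of _ _ "k - j"])
      qed
    qed (auto simp: t0)
    also have "\<dots> = (\<Sum>k<j. t k) + (\<Sum>i<n. t (j + i))"
      by (subst sum.union_disjoint) (auto simp: sum.reindex)
    also have "\<dots> \<le> W + W * (1 / (1 - \<gamma>))" using low high by simp
    also have "\<dots> = S * W" by (simp add: S_def algebra_simps)
    finally show "(\<Sum>k<n. 2 powr (real k * s) * (if k < j then 2 ^ k / 2 ^ j else (2 ^ j / 2 ^ k) ^ N))
      \<le> S * 2 powr (real j * s)" by (simp add: t_def W_def)
  qed
qed

lemma Lspace_bounded:
  fixes f :: "real^'n \<Rightarrow> real"
  assumes f: "f \<in> borel_measurable leb_Omega" and B: "\<And>x. x \<in> Omega \<Longrightarrow> \<bar>f x\<bar> \<le> B" and t: "1 \<le> t"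
  shows "f \<in> Lspace t leb_Omega"
proof -
  interpret L: prob_space "leb_Omega :: (real^'n) measure" by (rule prob_space_leb_Omega)
  have B0: "0 \<le> B" using B[of 0] by (auto simp: mem_box_cart)
  have "Lnorm t leb_Omega (\<lambda>x. ennreal \<bar>f x\<bar>) \<le> ennreal B"
  proof (cases "t = \<top>")
    case True
    then show ?thesis using f B by (auto simp: Lnorm_def intro!: esssup_I AE_I2 ennreal_leI)
  next
    case False
    then obtain t' where t': "t = ennreal t'" "1 \<le> t'" using t by (cases t) auto
    have "(\<integral>\<^sup>+x. ennpowr (ennreal \<bar>f x\<bar>) t' \<partial>leb_Omega) \<le> (\<integral>\<^sup>+x. ennpowr (ennreal B) t' \<partial>(leb_Omega :: (real^'n) measure))"
      using B t' by (intro nn_integral_mono ennpowr_mono ennreal_leI) auto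
    also have "\<dots> = ennpowr (ennreal B) t'"
      using L.emeasure_space_1 by simp
    finally have "Lnorm t leb_Omega (\<lambda>x. ennreal \<bar>f x\<bar>) \<le> ennpowr (ennpowr (ennreal B) t') (1 / t')"
      using t' by (auto simp: Lnorm_def intro!: ennpowr_mono)
    also have "\<dots> = ennreal B" using B0 t' by (simp add: ennpowr_ennreal powr_powr)
    finally show ?thesis .
  qed
  then have "Lnorm t leb_Omega (\<lambda>x. ennreal \<bar>f x\<bar>) < \<top>"
    by (rule order.strict_trans1) simp
  then show ?thesis using f by (simp add: Lspace_def)
qed


section \<open>The rate for \<open>d - s < 2p\<close>\<close>

definition bump_mass :: "'n::finite itself \<Rightarrow> real \<Rightarrow> nat \<Rightarrow> real" where
  "bump_mass _ \<rho> N = (\<integral>x. bump (0 :: real^'n) \<rho> N x \<partial>lborel)"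

lemma bump_measurable [measurable]: "bump c \<rho> N \<in> borel_measurable borel"
  by (intro borel_measurable_continuous_onI continuous_on_bump)

lemma bump_shift: "bump c \<rho> N (x - v) = bump (c + v) \<rho> N x"
  by (simp add: bump_def algebra_simps)

lemma bump_le_indicator_cbox:
  fixes c :: "real^'n"
  assumes "0 < \<rho>" "N \<ge> 1"
  shows "bump c \<rho> N x \<le> indicator (cbox (c - (\<chi> i. 1 / \<rho>)) (c + (\<chi> i. 1 / \<rho>))) x"
proof (cases "norm (x - c) \<le> 1 / \<rho>")
  case True
  have "x \<in> cbox (c - (\<chi> i. 1 / \<rho>)) (c + (\<chi> i. 1 / \<rho>))"
    unfolding mem_box_cart
  proof
    fix i
    have "\<bar>(x - c) $ i\<bar> \<le> 1 / \<rho>" using component_le_norm_cart[of "x - c" i] True by linarith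
    then show "(c - (\<chi> i. 1 / \<rho>)) $ i \<le> x $ i \<and> x $ i \<le> (c + (\<chi> i. 1 / \<rho>)) $ i" by auto
  qed
  then show ?thesis using bump_le_1[of c \<rho> N x] by simp
next
  case False
  then show ?thesis using bump_eq_0[OF assms(1) _ assms(2), of x c] by simp
qed

lemma integrable_bump:
  fixes c :: "real^'n"
  assumes "0 < \<rho>" "N \<ge> 1"
  shows "integrable lborel (bump c \<rho> N)"
proof (rule Bochner_Integration.integrable_bound)
  show "integrable lborel (indicator (cbox (c - (\<chi> i. 1 / \<rho>)) (c + (\<chi> i. 1 / \<rho>))) :: real^'n \<Rightarrow> real)"
    by (intro integrable_real_indicator) (simp_all add: emeasure_cbox_less_top)
  show "AE x in lborel. norm (bump c \<rho> N x) \<le> norm (indicator (cbox (c - (\<chi> i. 1 / \<rho>)) (c + (\<chi> i. 1 / \<rho>))) x :: real)"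
    using bump_le_indicator_cbox[OF assms, of c] bump_nonneg[of c \<rho> N] by (intro AE_I2) auto
qed simp

lemma integral_bump:
  fixes c :: "real^'n"
  shows "(\<integral>x. bump c \<rho> N x \<partial>lborel) = bump_mass TYPE('n) \<rho> N"
proof -
  have "(\<integral>x. bump c \<rho> N x \<partial>lborel) = (\<integral>x. bump c \<rho> N (x + c) \<partial>lborel)"
    by (rule lborel_translate) simp
  also have "(\<lambda>x. bump c \<rho> N (x + c)) = bump 0 \<rho> N" by (auto simp: bump_def)
  finally show ?thesis by (simp add: bump_mass_def)
qed

lemma bump_mass_le:
  assumes \<rho>: "0 < \<rho>" and N: "N \<ge> 1"
  shows "bump_mass TYPE('n::finite) \<rho> N \<le> (2 / \<rho>) ^ CARD('n)"
proof -
  define a :: "real^'n" where "a = 0 - (\<chi> i. 1 / \<rho>)"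
  define b :: "real^'n" where "b = 0 + (\<chi> i. 1 / \<rho>)"
  have ne: "cbox a b \<noteq> {}" using \<rho> by (simp add: interval_ne_empty_cart a_def b_def)
  have "bump_mass TYPE('n) \<rho> N \<le> (\<integral>x. indicator (cbox a b) x \<partial>lborel)"
    unfolding bump_mass_def
  proof (intro integral_mono integrable_bump[OF \<rho> N])
    show "integrable lborel (indicator (cbox a b) :: real^'n \<Rightarrow> real)"
      by (intro integrable_real_indicator) (simp_all add: emeasure_cbox_less_top)
    show "bump 0 \<rho> N x \<le> indicator (cbox a b) x" for x
      unfolding a_def b_def by (rule bump_le_indicator_cbox[OF \<rho> N])
  qed
  also have "\<dots> = measure lborel (cbox a b)" by simp
  also have "\<dots> = (2 / \<rho>) ^ CARD('n)" using content_cbox_cart[OF ne] by (simp add: a_def b_def)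
  finally show ?thesis .
qed

lemma bump_ge:
  assumes \<rho>: "0 < \<rho>" and x: "norm (x - c) \<le> 1 / (2 * \<rho>)"
  shows "(3 / 4) ^ N \<le> bump c \<rho> N x"
proof -
  have "\<rho> * norm (x - c) \<le> 1 / 2" using \<rho> x by (simp add: field_simps)
  then have "(\<rho> * norm (x - c))\<^sup>2 \<le> (1 / 2)\<^sup>2" using \<rho> by (intro power_mono) auto
  then have "\<rho>\<^sup>2 * (norm (x - c))\<^sup>2 \<le> 1 / 4" by (simp add: power_mult_distrib power_divide)
  then have "3 / 4 \<le> max 0 (1 - \<rho>\<^sup>2 * (norm (x - c))\<^sup>2)" by linarith
  then show ?thesis unfolding bump_def by (rule power_mono) simp
qed

lemma emeasure_ball_less_top: "emeasure lborel (ball c \<rho> :: (real^'n) set) < \<top>"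
  using emeasure_lborel_ball_finite[of c \<rho>] by (metis infinity_ennreal_def)

lemma bump_mass_pos:
  assumes \<rho>: "0 < \<rho>" and N: "N \<ge> 1"
  shows "0 < bump_mass TYPE('n::finite) \<rho> N"
proof -
  have "0 < (3 / 4) ^ N * measure lborel (ball (0 :: real^'n) (1 / (2 * \<rho>)))" using \<rho> by simp
  also have "\<dots> = (\<integral>x. (3 / 4) ^ N * indicator (ball (0 :: real^'n) (1 / (2 * \<rho>))) x \<partial>lborel)"
    by (simp add: emeasure_ball_less_top)
  also have "\<dots> \<le> bump_mass TYPE('n) \<rho> N"
    unfolding bump_mass_def
  proof (intro integral_mono integrable_bump[OF \<rho> N] integrable_mult_right integrable_real_indicator)
    show "(3 / 4) ^ N * indicator (ball (0 :: real^'n) (1 / (2 * \<rho>))) x \<le> bump 0 \<rho> N x" for x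
      using bump_ge[OF \<rho>, of x 0 N] bump_nonneg[of 0 \<rho> N x] by (auto simp: indicator_def)
  qed (auto simp: emeasure_ball_less_top)
  finally show ?thesis .
qed

lemma bump_support_Omega:
  fixes c :: "real^'n"
  assumes \<rho>: "0 < \<rho>" and N: "N \<ge> 1" and c: "\<And>i. 1 / \<rho> \<le> c $ i \<and> c $ i \<le> 1 - 1 / \<rho>"
  shows "norm (x - c) \<le> 1 / \<rho> \<Longrightarrow> x \<in> Omega" and "bump c \<rho> N x \<noteq> 0 \<Longrightarrow> x \<in> Omega"
proof -
  show *: "x \<in> Omega" if "norm (x - c) \<le> 1 / \<rho>"
    unfolding mem_box_cart
  proof
    fix i
    have "\<bar>(x - c) $ i\<bar> \<le> 1 / \<rho>" using component_le_norm_cart[of "x - c" i] that by linarith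
    then show "0 $ i \<le> x $ i \<and> x $ i \<le> 1 $ i" using c[of i] by auto
  qed
  show "x \<in> Omega" if "bump c \<rho> N x \<noteq> 0"
    using bump_eq_0[OF \<rho> _ N, of x c] that * by force
qed

lemma integral_bump_Omega:
  fixes c :: "real^'n"
  assumes \<rho>: "0 < \<rho>" and N: "N \<ge> 1" and c: "\<And>i. 1 / \<rho> \<le> c $ i \<and> c $ i \<le> 1 - 1 / \<rho>"
  shows "(\<integral>x. bump c \<rho> N x \<partial>leb_Omega) = bump_mass TYPE('n) \<rho> N"
proof -
  have eq: "indicator Omega x * bump c \<rho> N x = bump c \<rho> N x" for x
    using bump_support_Omega(2)[OF \<rho> N, of c x] c by (auto simp: indicator_def)
  show ?thesis unfolding integral_leb_Omega_eq eq by (rule integral_bump)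
qed

lemma integrable_bump_Omega: "integrable leb_Omega (bump c \<rho> N)"
  by (intro integrable_leb_Omega_continuous continuous_on_bump)

lemma prob_space_law:
  assumes f: "integrable leb_Omega f" "\<And>x. 0 \<le> f x" "(\<integral>x. f x \<partial>leb_Omega) = 1"
  shows "prob_space (law f)"
proof
  have [measurable]: "f \<in> borel_measurable leb_Omega" using f(1) by simp
  have "(\<integral>\<^sup>+x. ennreal (f x) \<partial>leb_Omega) = ennreal (\<integral>x. f x \<partial>leb_Omega)"
    using f by (intro nn_integral_eq_integral) auto
  then show "emeasure (law f) (space (law f)) = 1"
  proof -
    assume "(\<integral>\<^sup>+x. ennreal (f x) \<partial>leb_Omega) = ennreal (\<integral>x. f x \<partial>leb_Omega)"
    moreover have "emeasure (law f) (space (law f)) = (\<integral>\<^sup>+x. ennreal (f x) * indicator (space leb_Omega) x \<partial>leb_Omega)"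
      unfolding law_def space_density by (intro emeasure_density sets.top) measurable
    moreover have "\<dots> = (\<integral>\<^sup>+x. ennreal (f x) \<partial>leb_Omega)" by (intro nn_integral_cong) simp
    ultimately show ?thesis using f(3) by simp
  qed
qed

lemma measure_law:
  assumes f: "integrable leb_Omega f" "\<And>x. 0 \<le> f x" and S: "S \<in> sets borel"
  shows "measure (law f) (S \<inter> Omega) = (\<integral>x. f x * indicator S x \<partial>leb_Omega)"
proof -
  have [measurable]: "f \<in> borel_measurable leb_Omega" using f(1) by simp
  have SO: "S \<inter> Omega \<in> sets leb_Omega" unfolding sets_leb_Omega using S by (auto simp: sets_restrict_space)
  have "emeasure (law f) (S \<inter> Omega) = (\<integral>\<^sup>+x. ennreal (f x) * indicator (S \<inter> Omega) x \<partial>leb_Omega)"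
    unfolding law_def using SO by (subst emeasure_density) auto
  also have "\<dots> = (\<integral>\<^sup>+x. ennreal (f x * indicator (S \<inter> Omega) x) \<partial>leb_Omega)"
    by (intro nn_integral_cong) (auto simp: indicator_def)
  also have "\<dots> = ennreal (\<integral>x. f x * indicator (S \<inter> Omega) x \<partial>leb_Omega)"
    using f SO by (intro nn_integral_eq_integral integrable_real_mult_indicator) auto
  also have "(\<integral>x. f x * indicator (S \<inter> Omega) x \<partial>leb_Omega) = (\<integral>x. f x * indicator S x \<partial>leb_Omega)"
    by (intro Bochner_Integration.integral_cong) (auto simp: indicator_def)
  finally show ?thesis using f(2) by (simp add: measure_def integral_nonneg_AE)
qed

lemma integrable_indicator_Omega:
  assumes "integrable leb_Omega f" and "S \<in> sets borel"
  shows "integrable leb_Omega (\<lambda>x. f x * indicator S x :: real)"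
proof -
  have "S \<inter> Omega \<in> sets leb_Omega" unfolding sets_leb_Omega using assms(2) by (auto simp: sets_restrict_space)
  then have "integrable leb_Omega (\<lambda>x. f x * indicator (S \<inter> Omega) x)"
    using assms(1) by (intro integrable_real_mult_indicator)
  then show ?thesis
    by (rule Bochner_Integration.integrable_cong[THEN iffD1, rotated 2]) (auto simp: indicator_def)
qed

text \<open>Makes the error bound \<open>1 - exp 1 / 4\<close> of \<open>two_point_testing\<close>
  positive.\<close>

lemma exp_1_less_4: "exp (1::real) < 4"
  using e_less_272 by simp

context wavelet_system
begin

text \<open>All densities are mixtures of the same two bumps and differ only in the weight
  \<open>w\<close>, so one Besov ball contains them for every \<open>n\<close>. The distance between
  the bumps is fixed, and the cost is a constant times the \<open>1/p\<close>-th power of the mass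
  moved.\<close>

lemma two_point_lower_bound:
  assumes r: "1 < r" and s: "0 \<le> s" "s < r" and p: "1 \<le> p" and p': "1 \<le> p'" and q: "1 \<le> q"
  shows "\<exists>L0>0. \<exists>c>0. \<forall>L\<ge>L0. \<forall>n\<ge>1. \<forall>\<mu>'\<in>estimators n. \<exists>f\<in>besov_class \<Phi> \<Psi> s p' q L.
    ennreal (c * real n powr (- (1 / (2 * p))))
      \<le> (\<integral>\<^sup>+X. wasserstein p (law f) (\<mu>' X) \<partial>PiM {..<n} (\<lambda>_. law f))"
proof -
  \<comment> \<open>The largest integer allowed by \<open>N <= r + 1\<close>, the condition for
    Taylor polynomials of degree \<open>N - 1\<close> to be orthogonal to the wavelets. It exceeds
    \<open>s\<close> because \<open>r\<close> does.\<close>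
  define N where "N = nat \<lfloor>r\<rfloor> + 1"
  have N: "N \<ge> 1" "real N \<le> r + 1" "s < real N" using r s by (auto simp: N_def) linarith+
  obtain K where K: "K \<ge> 1" and "\<forall>k \<psi> (T :: (real^'n) set) \<theta> \<rho>. \<psi> \<in> \<Psi> k \<longrightarrow> finite T \<longrightarrow> 0 < \<rho> \<longrightarrow>
    (\<forall>c\<in>T. \<forall>c'\<in>T. c \<noteq> c' \<longrightarrow> 2 / \<rho> \<le> norm (c - c')) \<longrightarrow> (\<forall>c\<in>T. \<bar>\<theta> c\<bar> \<le> 1) \<longrightarrow>
    \<bar>inner_Omega (\<lambda>x. \<Sum>c\<in>T. \<theta> c * bump c \<rho> N x) \<psi>\<bar> \<le> K * (\<rho> / 2 ^ k) ^ N / wav_scale TYPE('n) k"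
    using fine_coefficients[OF r N(1,2)] by (elim exE conjE)
  note fine = this(2)[THEN spec, THEN spec, THEN spec, THEN spec, THEN spec, THEN mp, THEN mp, THEN mp, THEN mp, THEN mp]
  obtain S where S: "S \<ge> 0" and lev: "\<forall>j n. (\<Sum>k<n. 2 powr (real k * s) * (if k < j then 2 ^ k / 2 ^ j else (2 ^ j / 2 ^ k) ^ N))
    \<le> S * 2 powr (real j * s)" using level_sum[OF s(1) N(3)] by (elim exE conjE)
  obtain KB where KB: "KB \<ge> 1" and "\<forall>p q f B a S. 1 \<le> p \<longrightarrow> 1 \<le> q \<longrightarrow> (\<forall>x\<in>Omega. \<bar>f x\<bar> \<le> B) \<longrightarrow> f \<in> borel_measurable leb_Omega \<longrightarrow>
     (\<forall>k. 0 \<le> a k \<and> (\<forall>\<psi>\<in>\<Psi> k. \<bar>inner_Omega f \<psi>\<bar> \<le> a k / wav_scale TYPE('n) k)) \<longrightarrow>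
     (\<forall>n. (\<Sum>k<n. 2 powr (real k * s) * a k) \<le> S) \<longrightarrow>
     besov_norm \<Phi> \<Psi> s p q f \<le> ennreal (KB * (B + S))"
    using besov_norm_le[OF r s(1)] by (elim exE conjE)
  note besov = this(2)[THEN spec, THEN spec, THEN spec, THEN spec, THEN spec, THEN spec, THEN mp, THEN mp, THEN mp, THEN mp, THEN mp, THEN mp]
  define M where "M = bump_mass TYPE('n) 8 N"
  have M0: "0 < M" unfolding M_def by (rule bump_mass_pos) (use N in auto)
  define u :: "real^'n" where "u = (\<chi> i. 3 / 4)"
  define l :: "real^'n" where "l = (\<chi> i. 1 / 4)"
  have ul: "1 / 2 \<le> norm (u - l)"
    using component_le_norm_cart[of "u - l" undefined] by (simp add: u_def l_def)
  then have "u \<noteq> l" by auto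
  have u_in: "1 / 8 \<le> u $ i \<and> u $ i \<le> 1 - 1 / 8" and l_in: "1 / 8 \<le> l $ i \<and> l $ i \<le> 1 - 1 / 8" for i
    by (auto simp: u_def l_def)
  define f where "f w x = w / M * bump u 8 N x + (1 - w) / M * bump l 8 N x" for w x
  have f_sum: "f w x = 1 / M * (\<Sum>c\<in>{u, l}. (if c = u then w else 1 - w) * bump c 8 N x)" for w x
    using \<open>u \<noteq> l\<close> by (simp add: f_def add_divide_distrib)
  have sep: "\<forall>c\<in>{u, l}. \<forall>c'\<in>{u, l}. c \<noteq> c' \<longrightarrow> 2 / 8 \<le> norm (c - c')"
    using ul by (auto simp: norm_minus_commute)
  define B where "B = 1 / M"
  have f0: "0 \<le> f w x" if "0 \<le> w" "w \<le> 1" for w x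
    using that M0 bump_nonneg[of u 8 N x] bump_nonneg[of l 8 N x] by (simp add: f_def)
  have fB: "\<bar>f w x\<bar> \<le> B" if "0 \<le> w" "w \<le> 1" for w x
  proof -
    have "\<bar>\<Sum>c\<in>{u, l}. (if c = u then w else 1 - w) * bump c 8 N x\<bar> \<le> 1"
      using sep that N by (intro sum_bumps_bound) auto
    then show ?thesis unfolding f_sum abs_mult B_def using M0 by (simp add: divide_right_mono)
  qed
  have fc: "continuous_on A (f w)" for A w unfolding f_def by (intro continuous_intros)
  have fm: "f w \<in> borel_measurable leb_Omega" for w by (intro measurable_leb_Omega_continuous fc)
  have fi: "integrable leb_Omega (f w)" for w by (intro integrable_leb_Omega_continuous fc)
  have Iu: "(\<integral>x. bump u 8 N x \<partial>leb_Omega) = M" and Il: "(\<integral>x. bump l 8 N x \<partial>leb_Omega) = M"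
    unfolding M_def using u_in l_in N by (intro integral_bump_Omega; simp)+
  have f1: "(\<integral>x. f w x \<partial>leb_Omega) = 1" for w
  proof -
    have "(\<integral>x. f w x \<partial>leb_Omega) = w / M * M + (1 - w) / M * M"
      unfolding f_def using integrable_bump_Omega[of u 8 N] integrable_bump_Omega[of l 8 N]
      by (subst Bochner_Integration.integral_add) (auto simp: Iu Il)
    then show ?thesis using M0 by simp
  qed
  define C where "C = K * 8 ^ N / M"
  have C0: "0 \<le> C" using K M0 by (simp add: C_def)
  have fcoef: "\<bar>inner_Omega (f w) \<psi>\<bar> \<le> C * (1 / 2 ^ k) ^ N / wav_scale TYPE('n) k" if w: "0 \<le> w" "w \<le> 1" and \<psi>: "\<psi> \<in> \<Psi> k" for w k \<psi>
  proof -
    have "\<bar>inner_Omega (\<lambda>x. \<Sum>c\<in>{u, l}. (if c = u then w else 1 - w) * bump c 8 N x) \<psi>\<bar> \<le> K * (8 / 2 ^ k) ^ N / wav_scale TYPE('n) k"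
      using w by (intro fine[OF \<psi> _ _ sep]) auto
    moreover have "inner_Omega (f w) \<psi> = 1 / M * inner_Omega (\<lambda>x. \<Sum>c\<in>{u, l}. (if c = u then w else 1 - w) * bump c 8 N x) \<psi>"
      unfolding f_sum mult.assoc by (rule integral_mult_right_zero)
    ultimately have "\<bar>inner_Omega (f w) \<psi>\<bar> \<le> 1 / M * (K * (8 / 2 ^ k) ^ N / wav_scale TYPE('n) k)"
      using M0 by (simp only: abs_mult) (intro mult_mono, auto)
    also have "\<dots> = C * (1 / 2 ^ k) ^ N / wav_scale TYPE('n) k" by (simp add: C_def power_divide)
    finally show ?thesis .
  qed
  define L0 where "L0 = KB * (B + C * S)"
  have L0: "0 < L0" using KB M0 C0 S by (simp add: L0_def B_def add_pos_nonneg)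
  have member: "f w \<in> besov_class \<Phi> \<Psi> s p' q L" if w: "0 \<le> w" "w \<le> 1" and L: "L0 \<le> L" for w L
  proof -
    have "besov_norm \<Phi> \<Psi> s p' q (f w) \<le> ennreal L0"
      unfolding L0_def
    proof (rule besov[of p' q "f w" B "\<lambda>k. C * (1 / 2 ^ k) ^ N" "C * S", OF p' q _ fm])
      show "\<forall>x\<in>Omega. \<bar>f w x\<bar> \<le> B" using fB w by auto
      show "\<forall>k. 0 \<le> C * (1 / 2 ^ k) ^ N \<and> (\<forall>\<psi>\<in>\<Psi> k. \<bar>inner_Omega (f w) \<psi>\<bar> \<le> C * (1 / 2 ^ k) ^ N / wav_scale TYPE('n) k)"
        using fcoef w C0 by auto
      show "\<forall>n. (\<Sum>k<n. 2 powr (real k * s) * (C * (1 / 2 ^ k) ^ N)) \<le> C * S"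
      proof
        fix n
        \<comment> \<open>The bumps have a fixed size, so only the decaying part of
          \<open>level_sum\<close> occurs, with \<open>j = 0\<close>.\<close>
        have "(\<Sum>k<n. 2 powr (real k * s) * (1 / 2 ^ k) ^ N) \<le> S" using lev[rule_format, of 0 n] by simp
        then have "C * (\<Sum>k<n. 2 powr (real k * s) * (1 / 2 ^ k) ^ N) \<le> C * S" using C0 by (rule mult_left_mono)
        then show "(\<Sum>k<n. 2 powr (real k * s) * (C * (1 / 2 ^ k) ^ N)) \<le> C * S"
          by (simp add: sum_distrib_left mult.left_commute)
      qed
    qed
    also have "\<dots> \<le> ennreal L" using L by (rule ennreal_leI)
    finally have "besov_norm \<Phi> \<Psi> s p' q (f w) \<le> ennreal L" .
    moreover have "f w \<in> Lspace p' leb_Omega" using fm fB w p' by (intro Lspace_bounded) auto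
    ultimately show ?thesis using f1 f0 w by (simp add: besov_class_def)
  qed
  \<comment> \<open>The factors are the gap between the balls, the 1/8 in
    \<open>\<Delta> / 2 = \<sigma> / 8\<close>, and the averaged testing error.\<close>
  define c where "c = 1 / 16 * (1 / 8) powr (1 / p) * ((1 - exp 1 / 4) / 2)"
  have c0: "0 < c" using exp_1_less_4 by (simp add: c_def)
  show ?thesis
  proof (rule exI[of _ L0], intro conjI L0, rule exI[of _ c], intro conjI c0 allI impI ballI)
    fix L and n :: nat and \<mu>' :: "(nat \<Rightarrow> real^'n) \<Rightarrow> (real^'n) measure"
    assume L: "L0 \<le> L" and n: "1 \<le> n" and \<mu>': "\<mu>' \<in> estimators n"
    \<comment> \<open>The second moment of the likelihood ratio below is
      \<open>1 + \<sigma>^2\<close>, so this is the largest shift that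
      \<open>two_point_testing\<close> admits.\<close>
    define \<sigma> where "\<sigma> = 1 / sqrt (real n)"
    have \<sigma>: "0 < \<sigma>" "\<sigma> \<le> 1" "\<sigma>\<^sup>2 = 1 / n" using n by (auto simp: \<sigma>_def power_divide)
    define w where "w \<theta> = (if \<theta> = {} then 1 / 2 else 1 / 2 + \<sigma> / 2)" for \<theta> :: "(real^'n) set"
    have w01: "0 \<le> w \<theta>" "w \<theta> \<le> 1" for \<theta> using \<sigma> by (auto simp: w_def)
    have far: "bump l 8 N x = 0" if "norm (x - u) < 1 / 4" for x
    proof (rule bump_eq_0)
      have "norm (u - l) \<le> norm (x - l) + norm (x - u)" using norm_triangle_ineq4[of "x - l" "x - u"] by simp
      then show "1 / 8 \<le> norm (x - l)" using ul that by simp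
    qed (use N in auto)
    have mass_ge: "w \<theta> \<le> measure (law (f (w \<theta>))) (ball u (1 / 8) \<inter> Omega)" for \<theta>
    proof -
      have "w \<theta> = (\<integral>x. w \<theta> / M * bump u 8 N x \<partial>leb_Omega)" using M0 by (simp add: Iu)
      also have "\<dots> \<le> (\<integral>x. f (w \<theta>) x * indicator (ball u (1 / 8)) x \<partial>leb_Omega)"
      proof (intro integral_mono integrable_mult_right integrable_bump_Omega integrable_indicator_Omega fi)
        fix x
        show "w \<theta> / M * bump u 8 N x \<le> f (w \<theta>) x * indicator (ball u (1 / 8)) x"
        proof (cases "x \<in> ball u (1 / 8)")
          case True
          then show ?thesis using M0 w01 bump_nonneg[of l 8 N x] by (simp add: f_def)
        next
          case False
          then have "bump u 8 N x = 0" using N by (intro bump_eq_0) (auto simp: dist_norm norm_minus_commute)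
          then show ?thesis using False by simp
        qed
      qed simp
      also have "\<dots> = measure (law (f (w \<theta>))) (ball u (1 / 8) \<inter> Omega)"
        using f0[OF w01] by (intro measure_law[symmetric] fi) auto
      finally show ?thesis .
    qed
    have mass_le: "measure (law (f (w \<theta>))) (ball u (1 / 4) \<inter> Omega) \<le> w \<theta>" for \<theta>
    proof -
      have "measure (law (f (w \<theta>))) (ball u (1 / 4) \<inter> Omega) = (\<integral>x. f (w \<theta>) x * indicator (ball u (1 / 4)) x \<partial>leb_Omega)"
        using f0[OF w01] by (intro measure_law fi) auto
      also have "\<dots> \<le> (\<integral>x. w \<theta> / M * bump u 8 N x \<partial>leb_Omega)"
      proof (intro integral_mono integrable_mult_right integrable_bump_Omega integrable_indicator_Omega fi)
        fix x
        show "f (w \<theta>) x * indicator (ball u (1 / 4)) x \<le> w \<theta> / M * bump u 8 N x"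
          using far[of x] M0 w01[of \<theta>] bump_nonneg[of u 8 N x]
          by (auto simp: f_def indicator_def dist_norm norm_minus_commute)
      qed simp
      also have "\<dots> = w \<theta>" using M0 by (simp add: Iu)
      finally show ?thesis .
    qed
    \<comment> \<open>A single cell around \<open>u\<close>. The radii 1/8, 3/16 and 1/4 leave gaps
      of 1/16; the smallest ball carries the whole bump at \<open>u\<close>, and the largest is
      still clear of the bump at \<open>l\<close>. The threshold is midway between the two possible
      masses.\<close>
    have "\<exists>\<theta>\<subseteq>{u}. ennreal (1 / 16 * (\<sigma> / 4 / 2 * card {u}) powr (1 / p) * ((1 - exp 1 / 4) / 2))
      \<le> (\<integral>\<^sup>+X. wasserstein p (law (f (w \<theta>))) (\<mu>' X) \<partial>PiM {..<n} (\<lambda>_. law (f (w \<theta>))))"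
    proof (rule assouad_wasserstein[where A = "\<lambda>_. ball u (1 / 8)" and N = "\<lambda>_. ball u (3 / 16)"
          and N' = "\<lambda>_. ball u (1 / 4)" and \<tau> = "1 / 2 + \<sigma> / 4", OF _ _ p n])
      show "prob_space (law (f (w \<theta>)))" for \<theta> using f0[OF w01] f1 fi by (intro prob_space_law) auto
      show "1 / 16 \<le> norm (x - y)" if "x \<in> ball u (1 / 8)" "y \<notin> ball u (3 / 16)" for x y
        using that dist_triangle[of u y x] by (simp add: dist_norm)
      show "1 / 16 \<le> norm (x - y)" if "x \<notin> ball u (1 / 4)" "y \<in> ball u (3 / 16)" for x y
        using that dist_triangle[of u x y] by (simp add: dist_norm norm_minus_commute)
      show "1 / 2 + \<sigma> / 4 + \<sigma> / 4 \<le> measure (law (f (w \<theta>))) (ball u (1 / 8) \<inter> Omega)" if "Q \<in> \<theta>" for \<theta> and Q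
        using mass_ge[of \<theta>] that by (auto simp: w_def split: if_splits)
      show "measure (law (f (w \<theta>))) (ball u (1 / 4) \<inter> Omega) \<le> 1 / 2 + \<sigma> / 4 - \<sigma> / 4"
        if "\<theta> \<subseteq> {u}" "Q \<in> {u} - \<theta>" for \<theta> Q
        using mass_le[of \<theta>] that by (auto simp: w_def subset_singleton_iff split: if_splits)
      show "\<exists>h. h \<in> borel_measurable leb_Omega \<and> (\<forall>x. 0 \<le> h x) \<and> (\<forall>x\<in>Omega. f (w (insert Q \<theta>)) x = f (w \<theta>) x * h x)
        \<and> (\<integral>\<^sup>+x. ennreal (f (w \<theta>) x * (h x)\<^sup>2) \<partial>leb_Omega) \<le> ennreal (1 + 1 / real n)"
        if Q: "Q \<in> {u}" and \<theta>: "\<theta> \<subseteq> {u} - {Q}" for Q \<theta>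
      proof -
        have \<theta>e: "\<theta> = {}" using Q \<theta> by auto
        \<comment> \<open>The likelihood ratio, given as a two-valued function; the quotient of the
          densities would be of the form 0/0 outside both supports.\<close>
        define h where "h x = (if x \<in> ball u (1 / 8) then 1 + \<sigma> else 1 - \<sigma>)" for x
        have near: "bump u 8 N x = 0" if "x \<notin> ball u (1 / 8)" for x
          using that N by (intro bump_eq_0) (auto simp: dist_norm norm_minus_commute)
        \<comment> \<open>A general \<open>g\<close> covers both needs: the identity recovers the
          second density, and the square gives the second moment.\<close>
        have prod_h: "f (1 / 2) x * g (h x) = g (1 + \<sigma>) / (2 * M) * bump u 8 N x + g (1 - \<sigma>) / (2 * M) * bump l 8 N x" for x and g :: "real \<Rightarrow> real"
        proof (cases "x \<in> ball u (1 / 8)")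
          case True
          then have "bump l 8 N x = 0" by (intro far) (auto simp: dist_norm norm_minus_commute)
          then show ?thesis using True by (simp add: f_def h_def)
        next
          case False
          then show ?thesis using near[OF False] by (simp add: f_def h_def)
        qed
        have hm: "h \<in> borel_measurable leb_Omega"
        proof -
          have "h \<in> borel_measurable borel" unfolding h_def by (intro measurable_If_set) auto
          then show ?thesis by (intro measurable_restrict_space1) simp
        qed
        have eq: "f (w (insert Q \<theta>)) x = f (w \<theta>) x * h x" for x
          using prod_h[of x "\<lambda>y. y"] M0 by (simp add: \<theta>e w_def f_def field_simps)
        have "(\<integral>\<^sup>+x. ennreal (f (w \<theta>) x * (h x)\<^sup>2) \<partial>leb_Omega)
          = (\<integral>\<^sup>+x. ennreal ((1 + \<sigma>)\<^sup>2 / (2 * M) * bump u 8 N x + (1 - \<sigma>)\<^sup>2 / (2 * M) * bump l 8 N x) \<partial>leb_Omega)"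
          using prod_h[of _ "\<lambda>y. y\<^sup>2"] by (simp add: \<theta>e w_def)
        also have "\<dots> = ennreal (\<integral>x. (1 + \<sigma>)\<^sup>2 / (2 * M) * bump u 8 N x + (1 - \<sigma>)\<^sup>2 / (2 * M) * bump l 8 N x \<partial>leb_Omega)"
          using M0 bump_nonneg by (intro nn_integral_eq_integral Bochner_Integration.integrable_add integrable_mult_right integrable_bump_Omega AE_I2 add_nonneg_nonneg mult_nonneg_nonneg divide_nonneg_nonneg) auto
        also have "(\<integral>x. (1 + \<sigma>)\<^sup>2 / (2 * M) * bump u 8 N x + (1 - \<sigma>)\<^sup>2 / (2 * M) * bump l 8 N x \<partial>leb_Omega)
           = (1 + \<sigma>)\<^sup>2 / (2 * M) * M + (1 - \<sigma>)\<^sup>2 / (2 * M) * M"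
          using integrable_bump_Omega[of u 8 N] integrable_bump_Omega[of l 8 N]
          by (subst Bochner_Integration.integral_add) (auto simp: Iu Il)
        also have "\<dots> = 1 + 1 / real n"
          using M0 \<sigma>(3) by (simp add: power2_eq_square field_simps)
        finally have "(\<integral>\<^sup>+x. ennreal (f (w \<theta>) x * (h x)\<^sup>2) \<partial>leb_Omega) \<le> ennreal (1 + 1 / real n)" by simp
        then show ?thesis using hm eq \<sigma> by (intro exI[of _ h]) (auto simp: h_def)
      qed
      show "\<mu>' \<in> estimators n" by (rule \<mu>')
    qed (use \<sigma> fm f0 w01 in \<open>auto simp: disjoint_family_on_def\<close>)
    then obtain \<theta> where \<theta>: "ennreal (1 / 16 * (\<sigma> / 4 / 2 * card {u}) powr (1 / p) * ((1 - exp 1 / 4) / 2))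
      \<le> (\<integral>\<^sup>+X. wasserstein p (law (f (w \<theta>))) (\<mu>' X) \<partial>PiM {..<n} (\<lambda>_. law (f (w \<theta>))))" by (elim exE conjE)
    have "1 / 16 * (\<sigma> / 4 / 2 * card {u}) powr (1 / p) * ((1 - exp 1 / 4) / 2) = c * real n powr (- (1 / (2 * p)))"
    proof -
      have "\<sigma> powr (1 / p) = real n powr (- (1 / (2 * p)))"
        using n by (simp add: \<sigma>_def powr_half_sqrt[symmetric] powr_minus_divide[symmetric] powr_powr)
      moreover have "(\<sigma> / 4 / 2 * card {u}) powr (1 / p) = (1 / 8) powr (1 / p) * \<sigma> powr (1 / p)"
        unfolding powr_mult[symmetric] by simp
      ultimately show ?thesis by (simp add: c_def)
    qed
    then show "\<exists>f\<in>besov_class \<Phi> \<Psi> s p' q L. ennreal (c * real n powr (- (1 / (2 * p))))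
      \<le> (\<integral>\<^sup>+X. wasserstein p (law f) (\<mu>' X) \<partial>PiM {..<n} (\<lambda>_. law f))"
      using \<theta> member[OF w01 L, of \<theta>] by auto
  qed
qed

end


section \<open>The rate for \<open>d - s \<ge> 2p\<close>\<close>

text \<open>All coordinates of the points of \<open>lattice2 m\<close> below are of the form \<open>(4u + 2)/(32m)\<close>, with \<open>u\<close> even on
  \<open>lattice m\<close> and \<open>u\<close> odd on the shifted copy. So the balls of radius \<open>1/(32m)\<close> around them are disjoint, and
  they are contained in \<open>[0, 1/4]\<^sup>d\<close>, away from the fixed bump centred at \<open>(3/4, \<dots>, 3/4)\<close>.\<close>

definition lattice_center :: "nat \<Rightarrow> ('n::finite \<Rightarrow> nat) \<Rightarrow> real^'n" where
  "lattice_center m z = (\<chi> i. (8 * real (z i) + 2) / (32 * real m))"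

definition lattice :: "nat \<Rightarrow> (real^'n) set" where
  "lattice m = lattice_center m ` (UNIV \<rightarrow>\<^sub>E {..<m})"

definition lattice_shift :: "nat \<Rightarrow> real^'n" where
  "lattice_shift m = (\<chi> i. 4 / (32 * real m))"

lemma lattice_center_inj:
  assumes "m \<ge> 1" "lattice_center m z = lattice_center m z'"
  shows "z = z'"
proof
  fix i
  have "lattice_center m z $ i = lattice_center m z' $ i" using assms by simp
  then show "z i = z' i" using assms(1) by (simp add: lattice_center_def)
qed

lemma finite_lattice: "finite (lattice m)"
  unfolding lattice_def by (intro finite_imageI finite_PiE) auto

lemma card_lattice:
  assumes "m \<ge> 1"
  shows "card (lattice m :: (real^'n) set) = m ^ CARD('n)"
proof -
  have "inj_on (lattice_center m) (UNIV \<rightarrow>\<^sub>E {..<m} :: ('n \<Rightarrow> nat) set)"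
    using lattice_center_inj[OF assms] by (auto intro!: inj_onI)
  then show ?thesis unfolding lattice_def by (simp add: card_image card_PiE)
qed

lemma lattice_nonempty: "m \<ge> 1 \<Longrightarrow> lattice m \<noteq> {}"
  unfolding lattice_def by (auto simp: PiE_eq_empty_iff lessThan_empty_iff)

lemma lattice_bounds:
  assumes "m \<ge> 1" "c \<in> lattice m"
  shows "2 / (32 * real m) \<le> c $ i" "c $ i \<le> 1 / 4 - 6 / (32 * real m)"
proof -
  obtain z where z: "c = lattice_center m z" "z i < m" using assms(2) by (auto simp: lattice_def)
  have zi: "real (z i) \<le> real m - 1" using z(2) by linarith
  show "2 / (32 * real m) \<le> c $ i"
    unfolding z lattice_center_def vec_lambda_beta by (intro divide_right_mono) auto
  have "c $ i \<le> (8 * (real m - 1) + 2) / (32 * real m)"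
    unfolding z lattice_center_def using zi by (simp add: divide_right_mono)
  also have "\<dots> = 1 / 4 - 6 / (32 * real m)" using assms(1) by (simp add: field_simps)
  finally show "c $ i \<le> 1 / 4 - 6 / (32 * real m)" .
qed

lemma lattice_sep:
  assumes m: "m \<ge> 1" and c: "c \<in> lattice m" "c' \<in> lattice m" "c \<noteq> c'"
  shows "8 / (32 * real m) \<le> norm (c - c')"
proof -
  obtain z z' where z: "c = lattice_center m z" "c' = lattice_center m z'" using c by (auto simp: lattice_def)
  then obtain i where "z i \<noteq> z' i" using c(3) by (metis ext)
  then have "1 \<le> \<bar>real (z i) - real (z' i)\<bar>" by linarith
  then have "8 / (32 * real m) \<le> 8 * \<bar>real (z i) - real (z' i)\<bar> / (32 * real m)"
    by (intro divide_right_mono) auto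
  also have "\<dots> = \<bar>(c - c') $ i\<bar>"
  proof -
    have eq: "(c - c') $ i = 8 * (real (z i) - real (z' i)) / (32 * real m)"
      using m by (simp add: z lattice_center_def field_simps)
    show ?thesis unfolding eq by (simp only: abs_divide abs_mult abs_numeral abs_of_nat)
  qed
  also have "\<dots> \<le> norm (c - c')" by (rule component_le_norm_cart)
  finally show ?thesis .
qed

lemma lattice_sep_shift:
  assumes m: "m \<ge> 1" and c: "c \<in> lattice m" "c' \<in> lattice m"
  shows "4 / (32 * real m) \<le> norm (c + lattice_shift m - c')"
proof -
  obtain z z' where z: "c = lattice_center m z" "c' = lattice_center m z'" using c by (auto simp: lattice_def)
  define i :: 'a where "i = undefined"
  have "4 \<le> \<bar>8 * (real (z i) - real (z' i)) + 4\<bar>"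
  proof (cases "z' i \<le> z i")
    case False
    then have "real (z i) + 1 \<le> real (z' i)" by linarith
    then have "8 * (real (z i) - real (z' i)) + 4 \<le> - 4" by argo
    then show ?thesis by linarith
  qed simp
  then have "4 / (32 * real m) \<le> \<bar>8 * (real (z i) - real (z' i)) + 4\<bar> / (32 * real m)"
    by (intro divide_right_mono) auto
  also have "\<dots> = \<bar>(c + lattice_shift m - c') $ i\<bar>"
  proof -
    have eq: "(c + lattice_shift m - c') $ i = (8 * (real (z i) - real (z' i)) + 4) / (32 * real m)"
      using m by (simp add: z lattice_center_def lattice_shift_def field_simps)
    show ?thesis unfolding eq by (simp only: abs_divide abs_mult abs_numeral abs_of_nat)
  qed
  also have "\<dots> \<le> norm (c + lattice_shift m - c')" by (rule component_le_norm_cart)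
  finally show ?thesis .
qed

lemma norm_lattice_shift: "norm (lattice_shift m :: real^'n) \<le> real CARD('n) / (8 * real m)"
proof -
  have "norm (lattice_shift m :: real^'n) \<le> (\<Sum>i\<in>UNIV. \<bar>(lattice_shift m :: real^'n) $ i\<bar>)" by (rule norm_le_l1_cart)
  then show ?thesis by (simp add: lattice_shift_def)
qed

definition lattice2 :: "nat \<Rightarrow> (real^'n) set" where
  "lattice2 m = lattice m \<union> (\<lambda>c. c + lattice_shift m) ` lattice m"

lemma lattice2_sep:
  assumes m: "m \<ge> 1" and c: "c \<in> lattice2 m" "c' \<in> lattice2 m" "c \<noteq> c'"
  shows "2 / (32 * real m) \<le> norm (c - c')"
proof -
  have le: "2 / (32 * real m) \<le> 4 / (32 * real m)" "2 / (32 * real m) \<le> 8 / (32 * real m)"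
    by (intro divide_right_mono; simp)+
  consider "c \<in> lattice m" "c' \<in> lattice m"
    | a where "c = a + lattice_shift m" "a \<in> lattice m" "c' \<in> lattice m"
    | a where "c' = a + lattice_shift m" "a \<in> lattice m" "c \<in> lattice m"
    | a a' where "c = a + lattice_shift m" "c' = a' + lattice_shift m" "a \<in> lattice m" "a' \<in> lattice m"
    using c(1,2) by (auto simp: lattice2_def)
  then show ?thesis
  proof cases
    case 1
    then show ?thesis using lattice_sep[OF m] c(3) le by force
  next
    case 2
    then show ?thesis using lattice_sep_shift[OF m 2(2,3)] le by simp
  next
    case 3
    then show ?thesis using lattice_sep_shift[OF m 3(2,3)] le by (simp add: norm_minus_commute)
  next
    case 4
    then show ?thesis using lattice_sep[OF m 4(3,4)] c(3) le by force
  qed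
qed

lemma lattice2_bounds:
  assumes m: "m \<ge> 1" and c: "c \<in> lattice2 m"
  shows "1 / (32 * real m) \<le> c $ i" "c $ i \<le> 1 / 4 - 1 / (32 * real m)"
proof -
  define h where "h = 1 / (32 * real m)"
  have h: "1 / (32 * real m) = h" "2 / (32 * real m) = 2 * h" "4 / (32 * real m) = 4 * h" "6 / (32 * real m) = 6 * h" "0 \<le> h"
    by (simp_all add: h_def)
  consider "c \<in> lattice m" | a where "c = a + lattice_shift m" "a \<in> lattice m" using c by (auto simp: lattice2_def)
  then have "h \<le> c $ i \<and> c $ i \<le> 1 / 4 - h"
  proof cases
    case 1
    then show ?thesis using lattice_bounds[OF m 1, of i, unfolded h] h(5) by linarith
  next
    case 2
    have "c $ i = a $ i + 4 * h" by (simp only: 2 lattice_shift_def vector_add_component vec_lambda_beta h)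
    then show ?thesis using lattice_bounds[OF m 2(2), of i, unfolded h] h(5) by linarith
  qed
  note this[folded h(1)]
  then show "1 / (32 * real m) \<le> c $ i" "c $ i \<le> 1 / 4 - 1 / (32 * real m)" by auto
qed

section \<open>Sums of dipoles on the lattice\<close>

definition monopoles :: "nat \<Rightarrow> nat \<Rightarrow> (real^'n) set \<Rightarrow> real^'n \<Rightarrow> real" where
  "monopoles N m \<theta> x = (\<Sum>c\<in>lattice m. (if c \<in> \<theta> then 1 else -1) * bump c (32 * real m) N x)"

definition dipoles :: "nat \<Rightarrow> nat \<Rightarrow> (real^'n) set \<Rightarrow> real^'n \<Rightarrow> real" where
  "dipoles N m \<theta> x = monopoles N m \<theta> x - monopoles N m \<theta> (x - lattice_shift m)"

definition dipole_sign :: "nat \<Rightarrow> (real^'n) set \<Rightarrow> real^'n \<Rightarrow> real" where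
  "dipole_sign m \<theta> c =
     (if c \<in> lattice m then (if c \<in> \<theta> then 1 else -1) else (if c - lattice_shift m \<in> \<theta> then -1 else 1))"

text \<open>Both forms are used. As a difference of translates the function has small low-frequency
  coefficients; as a signed sum of separated bumps it falls under
  \<open>fine_coefficients\<close>.\<close>

lemma dipoles_eq:
  assumes m: "m \<ge> 1"
  shows "dipoles N m \<theta> x = (\<Sum>c\<in>lattice2 m. dipole_sign m \<theta> c * bump c (32 * real m) N x)"
proof -
  let ?v = "lattice_shift m"
  have disj: "c + ?v \<notin> lattice m" if "c \<in> lattice m" for c :: "real^'a"
  proof
    assume "c + ?v \<in> lattice m"
    then have "4 / (32 * real m) \<le> norm (c + ?v - (c + ?v))" by (rule lattice_sep_shift[OF m that])
    then show False using m by simp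
  qed
  have "(\<Sum>c\<in>lattice2 m. dipole_sign m \<theta> c * bump c (32 * real m) N x)
    = (\<Sum>c\<in>lattice m. dipole_sign m \<theta> c * bump c (32 * real m) N x)
      + (\<Sum>c\<in>(\<lambda>c. c + ?v) ` lattice m. dipole_sign m \<theta> c * bump c (32 * real m) N x)"
    unfolding lattice2_def using disj finite_lattice by (intro sum.union_disjoint) auto
  also have "(\<Sum>c\<in>lattice m. dipole_sign m \<theta> c * bump c (32 * real m) N x) = monopoles N m \<theta> x"
    unfolding monopoles_def by (intro sum.cong) (auto simp: dipole_sign_def)
  also have "(\<Sum>c\<in>(\<lambda>c. c + ?v) ` lattice m. dipole_sign m \<theta> c * bump c (32 * real m) N x)
    = (\<Sum>c\<in>lattice m. dipole_sign m \<theta> (c + ?v) * bump (c + ?v) (32 * real m) N x)"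
    by (subst sum.reindex) (auto simp: inj_on_def)
  also have "\<dots> = (\<Sum>c\<in>lattice m. - ((if c \<in> \<theta> then 1 else -1) * bump c (32 * real m) N (x - ?v)))"
    using disj by (intro sum.cong) (auto simp: dipole_sign_def bump_shift)
  also have "\<dots> = - monopoles N m \<theta> (x - ?v)" unfolding monopoles_def by (rule sum_negf)
  finally show ?thesis by (simp add: dipoles_def)
qed

lemma finite_lattice2: "finite (lattice2 m)"
  by (simp add: lattice2_def finite_lattice)

lemma dipole_sign_bound: "\<bar>dipole_sign m \<theta> c\<bar> \<le> 1"
  by (simp add: dipole_sign_def)

lemma dipoles_bound:
  assumes "m \<ge> 1" "N \<ge> 1"
  shows "\<bar>dipoles N m \<theta> x\<bar> \<le> 1"
  unfolding dipoles_eq[OF assms(1)] using assms lattice2_sep[OF assms(1)] finite_lattice2 dipole_sign_bound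
  by (intro sum_bumps_bound) auto

lemma dipoles_at:
  assumes m: "m \<ge> 1" and N: "N \<ge> 1" and c: "c \<in> lattice m" "norm (x - c) \<le> 1 / (32 * real m)"
  shows "dipoles N m \<theta> x = (if c \<in> \<theta> then 1 else -1) * bump c (32 * real m) N x"
proof -
  have "dipoles N m \<theta> x = dipole_sign m \<theta> c * bump c (32 * real m) N x"
    unfolding dipoles_eq[OF m] using m N c lattice2_sep[OF m] finite_lattice2
    by (intro sum_bumps_at) (auto simp: lattice2_def)
  then show ?thesis using c by (simp add: dipole_sign_def)
qed

lemma monopoles_bound:
  assumes "m \<ge> 1" "N \<ge> 1"
  shows "\<bar>monopoles N m \<theta> x\<bar> \<le> 1"
proof -
  have "2 / (32 * real m) \<le> norm (c - c')" if "c \<in> lattice m" "c' \<in> lattice m" "c \<noteq> c'" for c c' :: "real^'a"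
    using lattice2_sep[OF assms(1)] that by (auto simp: lattice2_def)
  then show ?thesis unfolding monopoles_def using assms finite_lattice by (intro sum_bumps_bound) auto
qed

lemma continuous_on_monopoles: "continuous_on A (monopoles N m \<theta>)"
  unfolding monopoles_def by (intro continuous_intros)

lemma continuous_on_dipoles: "m \<ge> 1 \<Longrightarrow> continuous_on A (dipoles N m \<theta>)"
proof -
  assume "m \<ge> 1"
  then have "dipoles N m \<theta> = (\<lambda>x. \<Sum>c\<in>lattice2 m. dipole_sign m \<theta> c * bump c (32 * real m) N x)"
    by (intro ext dipoles_eq)
  then show ?thesis by (simp add: continuous_intros)
qed

lemma lattice2_support:
  fixes c x :: "real^'n"
  assumes m: "m \<ge> 1" and N: "N \<ge> 1" and c: "c \<in> lattice2 m"
  shows "norm (x - c) \<le> 1 / (32 * real m) \<Longrightarrow> x \<in> Omega"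
    and "bump c (32 * real m) N x \<noteq> 0 \<Longrightarrow> x \<in> Omega"
    and "(\<integral>x. bump c (32 * real m) N x \<partial>leb_Omega) = bump_mass TYPE('n) (32 * real m) N"
proof -
  have \<rho>: "0 < 32 * real m" using m by simp
  have b: "1 / (32 * real m) \<le> c $ i \<and> c $ i \<le> 1 - 1 / (32 * real m)" for i
    using lattice2_bounds[OF m c, of i] by linarith
  show "norm (x - c) \<le> 1 / (32 * real m) \<Longrightarrow> x \<in> Omega"
    by (rule bump_support_Omega(1)[OF \<rho> N b])
  show "bump c (32 * real m) N x \<noteq> 0 \<Longrightarrow> x \<in> Omega"
    by (rule bump_support_Omega(2)[OF \<rho> N b])
  show "(\<integral>x. bump c (32 * real m) N x \<partial>leb_Omega) = bump_mass TYPE('n) (32 * real m) N"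
    by (rule integral_bump_Omega[OF \<rho> N b])
qed

text \<open>The support condition of \<open>coarse_coefficients\<close> for the shift by
  \<open>lattice_shift m\<close>.\<close>

lemma monopoles_support:
  assumes m: "m \<ge> 1" and N: "N \<ge> 1" and "monopoles N m \<theta> x \<noteq> 0"
  shows "x \<in> Omega \<and> x + lattice_shift m \<in> Omega"
proof -
  obtain c where c: "c \<in> lattice m" "bump c (32 * real m) N x \<noteq> 0"
    using assms(3) unfolding monopoles_def by (metis (no_types, lifting) mult_zero_right sum.neutral)
  have "bump (c + lattice_shift m) (32 * real m) N (x + lattice_shift m) = bump c (32 * real m) N x"
    by (simp add: bump_shift[symmetric])
  then show ?thesis using c lattice2_support(2)[OF m N, of c x]
      lattice2_support(2)[OF m N, of "c + lattice_shift m" "x + lattice_shift m"]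
    by (auto simp: lattice2_def)
qed

lemma integral_dipoles:
  fixes \<theta> :: "(real^'n) set"
  assumes m: "m \<ge> 1" and N: "N \<ge> 1"
  shows "(\<integral>x. dipoles N m \<theta> x \<partial>leb_Omega) = 0"
proof -
  have eq: "dipoles N m \<theta> = (\<lambda>x. \<Sum>c\<in>lattice m. (if c \<in> \<theta> then 1 else -1) *
      (bump c (32 * real m) N x - bump (c + lattice_shift m) (32 * real m) N x))"
    by (auto simp: dipoles_def monopoles_def bump_shift right_diff_distrib sum_subtractf)
  have I: "(\<integral>x. bump c (32 * real m) N x - bump (c + lattice_shift m) (32 * real m) N x \<partial>leb_Omega) = 0"
    if "c \<in> lattice m" for c :: "real^'n"
  proof -
    have c: "c \<in> lattice2 m" "c + lattice_shift m \<in> lattice2 m" using that by (auto simp: lattice2_def)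
    show ?thesis using lattice2_support(3)[OF m N c(1)] lattice2_support(3)[OF m N c(2)]
      by (subst Bochner_Integration.integral_diff) (auto simp: integrable_bump_Omega)
  qed
  have "(\<integral>x. dipoles N m \<theta> x \<partial>leb_Omega) = (\<Sum>c\<in>lattice m. (if c \<in> \<theta> then 1 else -1) *
      (\<integral>x. bump c (32 * real m) N x - bump (c + lattice_shift m) (32 * real m) N x \<partial>leb_Omega))"
    unfolding eq by (subst Bochner_Integration.integral_sum)
      (auto intro!: integrable_mult_right Bochner_Integration.integrable_diff integrable_bump_Omega)
  also have "\<dots> = 0" using I by (intro sum.neutral) simp
  finally show ?thesis .
qed

text \<open>Switching a cell reverses its dipole; the sign goes from -1 to 1, hence the factor
  2.\<close>

lemma dipoles_insert:
  assumes c: "c \<in> lattice m" "c \<notin> \<theta>"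
  shows "dipoles N m (insert c \<theta>) x - dipoles N m \<theta> x
    = 2 * (bump c (32 * real m) N x - bump c (32 * real m) N (x - lattice_shift m))"
proof -
  have "monopoles N m (insert c \<theta>) y - monopoles N m \<theta> y = 2 * bump c (32 * real m) N y" for y
  proof -
    have "monopoles N m (insert c \<theta>) y - monopoles N m \<theta> y
      = (\<Sum>c'\<in>lattice m. if c' = c then 2 * bump c (32 * real m) N y else 0)"
      unfolding monopoles_def sum_subtractf[symmetric] using c by (intro sum.cong) auto
    then show ?thesis using c by (simp add: finite_lattice)
  qed
  from this[of x] this[of "x - lattice_shift m"] show ?thesis by (simp add: dipoles_def)
qed


context wavelet_system
begin

text \<open>The lattice scale is a power of two so that it coincides with a wavelet level. Below
  level \<open>j\<close> the bound comes from \<open>coarse_coefficients\<close>, from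
  \<open>j\<close> on from \<open>fine_coefficients\<close>, and the result has the form summed in
  \<open>level_sum\<close>.\<close>

lemma dipoles_coefficients:
  assumes r: "1 < r" and N: "N \<ge> 1" "real N \<le> r + 1"
  shows "\<exists>K\<ge>1. \<forall>j k \<psi> (\<theta> :: (real^'n) set). \<psi> \<in> \<Psi> k \<longrightarrow>
    \<bar>inner_Omega (dipoles N (2 ^ j) \<theta>) \<psi>\<bar> \<le> K * (if k < j then 2 ^ k / 2 ^ j else (2 ^ j / 2 ^ k) ^ N) / wav_scale TYPE('n) k"
proof -
  obtain K1 where K1: "K1 \<ge> 1" and "\<forall>k \<psi> (T :: (real^'n) set) \<theta> \<rho>. \<psi> \<in> \<Psi> k \<longrightarrow> finite T \<longrightarrow> 0 < \<rho> \<longrightarrow>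
    (\<forall>c\<in>T. \<forall>c'\<in>T. c \<noteq> c' \<longrightarrow> 2 / \<rho> \<le> norm (c - c')) \<longrightarrow> (\<forall>c\<in>T. \<bar>\<theta> c\<bar> \<le> 1) \<longrightarrow>
    \<bar>inner_Omega (\<lambda>x. \<Sum>c\<in>T. \<theta> c * bump c \<rho> N x) \<psi>\<bar> \<le> K1 * (\<rho> / 2 ^ k) ^ N / wav_scale TYPE('n) k"
    using fine_coefficients[OF r N] by (elim exE conjE)
  note fine = this(2)[THEN spec, THEN spec, THEN spec, THEN spec, THEN spec, THEN mp, THEN mp, THEN mp, THEN mp, THEN mp]
  obtain K2 where K2: "K2 \<ge> 1" and "\<forall>k \<psi> v G. \<psi> \<in> \<Psi> k \<longrightarrow> continuous_on UNIV G \<longrightarrow> (\<forall>x. \<bar>G x\<bar> \<le> 1) \<longrightarrow>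
    (\<forall>x. G x \<noteq> 0 \<longrightarrow> x \<in> Omega \<and> x + v \<in> Omega) \<longrightarrow>
    \<bar>inner_Omega (\<lambda>x. G x - G (x - v)) \<psi>\<bar> \<le> K2 * (norm v * 2 ^ k) / wav_scale TYPE('n) k"
    using coarse_coefficients[OF r] by (elim exE conjE)
  note coarse = this(2)[THEN spec, THEN spec, THEN spec, THEN spec, THEN mp, THEN mp, THEN mp, THEN mp]
  \<comment> \<open>\<open>32 ^ N\<close> stems from the bump parameter \<open>32 * m\<close>, and
    \<open>CARD('n)\<close> from the length of the shift.\<close>
  define K where "K = K1 * 32 ^ N + K2 * real CARD('n)"
  have K: "1 \<le> K" "K1 * 32 ^ N \<le> K" "K2 * real CARD('n) \<le> K"
  proof -
    have "1 * 1 \<le> K1 * (32::real) ^ N" using K1 by (intro mult_mono one_le_power) auto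
    moreover have "0 \<le> K2 * real CARD('n)" using K2 by simp
    ultimately show "1 \<le> K" "K1 * 32 ^ N \<le> K" "K2 * real CARD('n) \<le> K" unfolding K_def by linarith+
  qed
  show ?thesis
  proof (intro exI[of _ K] conjI K(1) allI impI)
    fix j k \<psi> and \<theta> :: "(real^'n) set" assume \<psi>: "\<psi> \<in> \<Psi> k"
    define m :: nat where "m = 2 ^ j"
    have m: "m \<ge> 1" "real m = 2 ^ j" by (auto simp: m_def)
    have w: "0 < wav_scale TYPE('n) k" by (rule wav_scale_pos)
    show "\<bar>inner_Omega (dipoles N (2 ^ j) \<theta>) \<psi>\<bar> \<le> K * (if k < j then 2 ^ k / 2 ^ j else (2 ^ j / 2 ^ k) ^ N) / wav_scale TYPE('n) k"
    proof (cases "k < j")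
      case True
      have "\<bar>inner_Omega (\<lambda>x. monopoles N m \<theta> x - monopoles N m \<theta> (x - lattice_shift m)) \<psi>\<bar>
        \<le> K2 * (norm (lattice_shift m :: real^'n) * 2 ^ k) / wav_scale TYPE('n) k"
        using monopoles_bound[OF m(1) N(1)] monopoles_support[OF m(1) N(1)]
        by (intro coarse[OF \<psi> continuous_on_monopoles]) blast+
      also have "\<dots> \<le> K2 * ((real CARD('n) / 2 ^ j) * 2 ^ k) / wav_scale TYPE('n) k"
      proof (intro divide_right_mono mult_left_mono mult_right_mono)
        have "norm (lattice_shift m :: real^'n) \<le> real CARD('n) / (8 * real m)" by (rule norm_lattice_shift)
        also have "\<dots> \<le> real CARD('n) / 2 ^ j" unfolding m(2) by (intro divide_left_mono) auto
        finally show "norm (lattice_shift m :: real^'n) \<le> real CARD('n) / 2 ^ j" .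
      qed (use K2 w in auto)
      also have "\<dots> = K2 * real CARD('n) * (2 ^ k / 2 ^ j) / wav_scale TYPE('n) k" by simp
      also have "\<dots> \<le> K * (2 ^ k / 2 ^ j) / wav_scale TYPE('n) k"
        using K(3) w by (intro divide_right_mono mult_right_mono) auto
      finally show ?thesis using True by (simp add: dipoles_def[abs_def] m_def)
    next
      case False
      have "\<bar>inner_Omega (\<lambda>x. \<Sum>c\<in>lattice2 m. dipole_sign m \<theta> c * bump c (32 * real m) N x) \<psi>\<bar>
        \<le> K1 * (32 * real m / 2 ^ k) ^ N / wav_scale TYPE('n) k"
        using lattice2_sep[OF m(1)] m(1) dipole_sign_bound by (intro fine[OF \<psi> finite_lattice2]) auto
      also have "\<dots> = K1 * 32 ^ N * (2 ^ j / 2 ^ k) ^ N / wav_scale TYPE('n) k"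
        unfolding m(2) by (simp add: power_mult_distrib power_divide)
      also have "\<dots> \<le> K * (2 ^ j / 2 ^ k) ^ N / wav_scale TYPE('n) k"
        using K(2) w by (intro divide_right_mono mult_right_mono) auto
      finally show ?thesis using False unfolding dipoles_eq[OF m(1), of N \<theta>, symmetric] by (simp add: m_def)
    qed
  qed
qed

text \<open>The bound \<open>main\<close> holds at every level with \<open>2^(j(d+s)) >= n\<close>
  and deteriorates as \<open>j\<close> grows, so the smallest such level is inserted at the
  end.\<close>

lemma lattice_lower_bound:
  assumes r: "1 < r" and s: "0 \<le> s" "s < r" and p: "1 \<le> p" and p': "1 \<le> p'" and q: "1 \<le> q"
  shows "\<exists>L0>0. \<exists>c>0. \<forall>L\<ge>L0. \<forall>n\<ge>1. \<forall>\<mu>'\<in>estimators n. \<exists>f\<in>besov_class \<Phi> \<Psi> s p' q L.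
    ennreal (c * real n powr (- ((1 + s / p) / (real CARD('n) + s))))
      \<le> (\<integral>\<^sup>+X. wasserstein p (law f) (\<mu>' X) \<partial>PiM {..<n} (\<lambda>_. law f))"
proof -
  define N where "N = nat \<lfloor>r\<rfloor> + 1"
  have N: "N \<ge> 1" "real N \<le> r + 1" "s < real N" using r s by (auto simp: N_def) linarith+
  obtain K where K: "K \<ge> 1" and "\<forall>k \<psi> (T :: (real^'n) set) \<theta> \<rho>. \<psi> \<in> \<Psi> k \<longrightarrow> finite T \<longrightarrow> 0 < \<rho> \<longrightarrow>
    (\<forall>c\<in>T. \<forall>c'\<in>T. c \<noteq> c' \<longrightarrow> 2 / \<rho> \<le> norm (c - c')) \<longrightarrow> (\<forall>c\<in>T. \<bar>\<theta> c\<bar> \<le> 1) \<longrightarrow>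
    \<bar>inner_Omega (\<lambda>x. \<Sum>c\<in>T. \<theta> c * bump c \<rho> N x) \<psi>\<bar> \<le> K * (\<rho> / 2 ^ k) ^ N / wav_scale TYPE('n) k"
    using fine_coefficients[OF r N(1,2)] by (elim exE conjE)
  note fine = this(2)[THEN spec, THEN spec, THEN spec, THEN spec, THEN spec, THEN mp, THEN mp, THEN mp, THEN mp, THEN mp]
  obtain K' where K': "K' \<ge> 1" and dip: "\<forall>j k \<psi> (\<theta> :: (real^'n) set). \<psi> \<in> \<Psi> k \<longrightarrow>
    \<bar>inner_Omega (dipoles N (2 ^ j) \<theta>) \<psi>\<bar> \<le> K' * (if k < j then 2 ^ k / 2 ^ j else (2 ^ j / 2 ^ k) ^ N) / wav_scale TYPE('n) k"
    using dipoles_coefficients[OF r N(1,2)] by (elim exE conjE)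
  obtain S where S: "S \<ge> 0" and lev: "\<forall>j n. (\<Sum>k<n. 2 powr (real k * s) * (if k < j then 2 ^ k / 2 ^ j else (2 ^ j / 2 ^ k) ^ N))
    \<le> S * 2 powr (real j * s)" using level_sum[OF s(1) N(3)] by (elim exE conjE)
  obtain KB where KB: "KB \<ge> 1" and "\<forall>p q f B a S. 1 \<le> p \<longrightarrow> 1 \<le> q \<longrightarrow> (\<forall>x\<in>Omega. \<bar>f x\<bar> \<le> B) \<longrightarrow> f \<in> borel_measurable leb_Omega \<longrightarrow>
     (\<forall>k. 0 \<le> a k \<and> (\<forall>\<psi>\<in>\<Psi> k. \<bar>inner_Omega f \<psi>\<bar> \<le> a k / wav_scale TYPE('n) k)) \<longrightarrow>
     (\<forall>n. (\<Sum>k<n. 2 powr (real k * s) * a k) \<le> S) \<longrightarrow>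
     besov_norm \<Phi> \<Psi> s p q f \<le> ennreal (KB * (B + S))"
    using besov_norm_le[OF r s(1)] by (elim exE conjE)
  note besov = this(2)[THEN spec, THEN spec, THEN spec, THEN spec, THEN spec, THEN spec, THEN mp, THEN mp, THEN mp, THEN mp, THEN mp, THEN mp]
  define d where "d = CARD('n)"
  have d1: "1 \<le> real d" by (simp add: d_def Suc_leI)
  define M where "M = bump_mass TYPE('n) 4 N"
  have M0: "0 < M" unfolding M_def by (rule bump_mass_pos) (use N in auto)
  define u :: "real^'n" where "u = (\<chi> i. 3 / 4)"
  have u_in: "1 / 4 \<le> u $ i \<and> u $ i \<le> 1 - 1 / 4" for i by (simp add: u_def)
  have Iu: "(\<integral>x. bump u 4 N x \<partial>leb_Omega) = M"
    unfolding M_def using u_in N by (intro integral_bump_Omega; simp)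
  \<comment> \<open>The factor 1/2 leaves mass at least 1/2 for the fixed bump, also for
    \<open>s = 0\<close>.\<close>
  define eps where "eps j = 2 powr (- (real j * s)) / 2" for j :: nat
  have eps: "0 < eps j" "eps j \<le> 1 / 2" for j
    using s powr_mono[of "- (real j * s)" 0 2] by (auto simp: eps_def)
  \<comment> \<open>The dipoles get half the height of the background. The density then stays above
    \<open>eps j / 2\<close>, by which the chi-square estimate divides, while a flip still changes
    it by the order of the background.\<close>
  define f where "f j \<theta> x = (1 - eps j) / M * bump u 4 N x + (eps j + eps j / 2 * dipoles N (2 ^ j) \<theta> x)" for j \<theta> x
  have m1: "(1::nat) \<le> 2 ^ j" for j by simp
  have fc: "continuous_on A (f j \<theta>)" for A j \<theta>
    unfolding f_def by (intro continuous_intros continuous_on_dipoles m1)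
  have fm: "f j \<theta> \<in> borel_measurable leb_Omega" for j \<theta> by (intro measurable_leb_Omega_continuous fc)
  have fi: "integrable leb_Omega (f j \<theta>)" for j \<theta> by (intro integrable_leb_Omega_continuous fc)
  have H1: "\<bar>dipoles N (2 ^ j) \<theta> x\<bar> \<le> 1" for j and \<theta> and x :: "real^'n" by (rule dipoles_bound[OF m1 N(1)])
  have g0: "0 \<le> (1 - eps j) / M * bump u 4 N x" for j x
    using eps(2)[of j] M0 bump_nonneg[of u 4 N x] by (intro mult_nonneg_nonneg divide_nonneg_nonneg) auto
  have e_lo: "eps j / 2 \<le> eps j + eps j / 2 * dipoles N (2 ^ j) \<theta> x" for j and \<theta> and x :: "real^'n"
  proof -
    have "eps j / 2 * (- 1) \<le> eps j / 2 * dipoles N (2 ^ j) \<theta> x"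
      using H1[of j \<theta> x] eps(1)[of j] by (intro mult_left_mono) auto
    then show ?thesis by simp
  qed
  have f_lo: "eps j / 2 \<le> f j \<theta> x" for j \<theta> x
    using add_mono[OF g0[of j x] e_lo[of j \<theta> x]] by (simp only: f_def add_0_left)
  have f0: "0 \<le> f j \<theta> x" for j \<theta> x using f_lo[of j \<theta> x] eps(1)[of j] by linarith
  define B where "B = 1 / M + 1"
  have fB: "\<bar>f j \<theta> x\<bar> \<le> B" for j \<theta> x
  proof -
    have "(1 - eps j) / M * bump u 4 N x \<le> 1 / M * 1"
      using eps[of j] M0 bump_nonneg[of u 4 N x] bump_le_1[of u 4 N x] by (intro mult_mono divide_right_mono) auto
    moreover have "eps j / 2 * dipoles N (2 ^ j) \<theta> x \<le> eps j / 2 * 1"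
      using H1[of j \<theta> x] eps(1)[of j] by (intro mult_left_mono) auto
    ultimately have "f j \<theta> x \<le> B" unfolding f_def B_def using eps[of j] by linarith
    then show ?thesis using f0[of j \<theta> x] by simp
  qed
  interpret L: prob_space "leb_Omega :: (real^'n) measure" by (rule prob_space_leb_Omega)
  have ig: "integrable leb_Omega (\<lambda>x. (1 - eps j) / M * bump u 4 N x)" for j
    by (intro integrable_mult_right integrable_bump_Omega)
  have ih: "integrable leb_Omega (dipoles N (2 ^ j) \<theta> :: real^'n \<Rightarrow> real)" for j \<theta>
    by (intro integrable_leb_Omega_continuous continuous_on_dipoles m1)
  have f1: "(\<integral>x. f j \<theta> x \<partial>leb_Omega) = 1" for j \<theta>
  proof -
    have "(\<integral>x. f j \<theta> x \<partial>leb_Omega) = (1 - eps j) / M * M + (eps j + eps j / 2 * 0)"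
      unfolding f_def using ig[of j] ih[of j \<theta>] integral_dipoles[OF m1 N(1), of j \<theta>] L.prob_space
      by (simp add: Iu)
    then show ?thesis using M0 by simp
  qed
  define C where "C = K * 4 ^ N / M"
  have C0: "0 \<le> C" using K M0 by (simp add: C_def)
  \<comment> \<open>The fixed bump plus the dipoles. The constant background is a polynomial and has
    no wavelet coefficients.\<close>
  define a where "a j k = C * (1 / 2 ^ k) ^ N + eps j * (K' * (if k < j then 2 ^ k / 2 ^ j else (2 ^ j / 2 ^ k) ^ N))" for j k :: nat
  have a0: "0 \<le> a j k" for j k
    unfolding a_def using C0 eps(1)[of j] K' by (intro add_nonneg_nonneg mult_nonneg_nonneg) auto
  have fcoef: "\<bar>inner_Omega (f j \<theta>) \<psi>\<bar> \<le> a j k / wav_scale TYPE('n) k" if \<psi>: "\<psi> \<in> \<Psi> k" for j \<theta> k \<psi>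
  proof -
    define w where "w = wav_scale TYPE('n) k"
    have w: "0 < w" unfolding w_def by (rule wav_scale_pos)
    define Z where "Z = K' * (if k < j then 2 ^ k / 2 ^ j else (2 ^ j / 2 ^ k) ^ N) / w"
    have \<psi>c: "continuous_on Omega \<psi>" using \<psi> by (intro coarse_continuous[OF r, of _ "Suc k"]) auto
    have "\<bar>inner_Omega (\<lambda>x. \<Sum>c\<in>{u}. (1::real) * bump c 4 N x) \<psi>\<bar> \<le> K * (4 / 2 ^ k) ^ N / w"
      unfolding w_def by (intro fine[OF \<psi>]) auto
    then have b: "\<bar>inner_Omega (bump u 4 N) \<psi>\<bar> \<le> K * (4 / 2 ^ k) ^ N / w" by simp
    have one: "inner_Omega (\<lambda>x. 1) \<psi> = 0" using r by (intro inner_polys[OF r polys_const \<psi>]) simp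
    have hh: "\<bar>inner_Omega (dipoles N (2 ^ j) \<theta>) \<psi>\<bar> \<le> Z" using dip \<psi> unfolding Z_def w_def by blast
    have i1: "integrable leb_Omega (\<lambda>x. bump u 4 N x * \<psi> x)"
      and i2: "integrable leb_Omega (\<lambda>x. 1 * \<psi> x)"
      and i3: "integrable leb_Omega (\<lambda>x. dipoles N (2 ^ j) \<theta> x * \<psi> x)"
      using \<psi>c by (intro integrable_leb_Omega_continuous continuous_on_mult continuous_on_bump continuous_on_const continuous_on_dipoles m1; assumption)+
    have "inner_Omega (f j \<theta>) \<psi> = (\<integral>x. (1 - eps j) / M * (bump u 4 N x * \<psi> x)
        + (eps j * (1 * \<psi> x) + eps j / 2 * (dipoles N (2 ^ j) \<theta> x * \<psi> x)) \<partial>leb_Omega)"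
      unfolding f_def by (intro Bochner_Integration.integral_cong) (auto simp: algebra_simps)
    also have "\<dots> = (1 - eps j) / M * inner_Omega (bump u 4 N) \<psi> + (eps j * inner_Omega (\<lambda>x. 1) \<psi> + eps j / 2 * inner_Omega (dipoles N (2 ^ j) \<theta>) \<psi>)"
    proof -
      have "(\<integral>x. eps j * (1 * \<psi> x) + eps j / 2 * (dipoles N (2 ^ j) \<theta> x * \<psi> x) \<partial>leb_Omega)
        = eps j * inner_Omega (\<lambda>x. 1) \<psi> + eps j / 2 * inner_Omega (dipoles N (2 ^ j) \<theta>) \<psi>"
        by (subst Bochner_Integration.integral_add[OF integrable_mult_right[OF i2] integrable_mult_right[OF i3]])
          (simp only: integral_mult_right_zero)
      then show ?thesis
        by (subst Bochner_Integration.integral_add[OF integrable_mult_right[OF i1] Bochner_Integration.integrable_add[OF integrable_mult_right[OF i2] integrable_mult_right[OF i3]]])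
          (simp only: integral_mult_right_zero)
    qed
    also have "\<bar>\<dots>\<bar> \<le> 1 / M * (K * (4 / 2 ^ k) ^ N / w) + eps j * Z"
    proof -
      have "\<bar>(1 - eps j) / M * inner_Omega (bump u 4 N) \<psi>\<bar> \<le> 1 / M * (K * (4 / 2 ^ k) ^ N / w)"
        unfolding abs_mult using b eps[of j] M0 by (intro mult_mono) (auto simp: divide_right_mono)
      moreover have "\<bar>eps j / 2 * inner_Omega (dipoles N (2 ^ j) \<theta>) \<psi>\<bar> \<le> eps j * Z"
        unfolding abs_mult using hh eps[of j] by (intro mult_mono) auto
      ultimately show ?thesis unfolding one by linarith
    qed
    also have "\<dots> = a j k / w"
      by (simp add: a_def C_def Z_def power_divide add_divide_distrib)
    finally show ?thesis unfolding w_def .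
  qed
  define L0 where "L0 = KB * (B + (C * S + K' * S))"
  have L0: "0 < L0" using KB M0 C0 S K' by (simp add: L0_def B_def add_pos_nonneg)
  have member: "f j \<theta> \<in> besov_class \<Phi> \<Psi> s p' q L" if L: "L0 \<le> L" for j \<theta> L
  proof -
    have "besov_norm \<Phi> \<Psi> s p' q (f j \<theta>) \<le> ennreal L0"
      unfolding L0_def
    proof (rule besov[of p' q "f j \<theta>" B "a j" "C * S + K' * S", OF p' q _ fm])
      show "\<forall>x\<in>Omega. \<bar>f j \<theta> x\<bar> \<le> B" using fB by auto
      show "\<forall>k. 0 \<le> a j k \<and> (\<forall>\<psi>\<in>\<Psi> k. \<bar>inner_Omega (f j \<theta>) \<psi>\<bar> \<le> a j k / wav_scale TYPE('n) k)"
        using fcoef a0 by auto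
      show "\<forall>n. (\<Sum>k<n. 2 powr (real k * s) * a j k) \<le> C * S + K' * S"
      proof
        fix n
        define W where "W k = 2 powr (real k * s) * (if k < j then 2 ^ k / 2 ^ j else (2 ^ j / 2 ^ k) ^ N)" for k
        have "(\<Sum>k<n. 2 powr (real k * s) * (1 / 2 ^ k) ^ N) \<le> S" using lev[rule_format, of 0 n] by simp
        then have 1: "C * (\<Sum>k<n. 2 powr (real k * s) * (1 / 2 ^ k) ^ N) \<le> C * S" using C0 by (rule mult_left_mono)
        \<comment> \<open>The height \<open>eps j\<close> absorbs the growth \<open>2^(js)\<close>
          of the level sum, so one Besov ball serves all \<open>j\<close>.\<close>
        have "eps j * K' * (\<Sum>k<n. W k) \<le> eps j * K' * (S * 2 powr (real j * s))"
          using lev eps(1)[of j] K' unfolding W_def by (intro mult_left_mono) auto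
        also have "\<dots> = K' * S / 2" by (simp add: eps_def powr_minus)
        also have "\<dots> \<le> K' * S" using K' S by simp
        finally have 2: "eps j * K' * (\<Sum>k<n. W k) \<le> K' * S" .
        have "(\<Sum>k<n. 2 powr (real k * s) * a j k)
          = (\<Sum>k<n. C * (2 powr (real k * s) * (1 / 2 ^ k) ^ N) + eps j * K' * W k)"
          unfolding a_def W_def distrib_left by (intro sum.cong refl) (simp only: mult_ac)
        also have "\<dots> = C * (\<Sum>k<n. 2 powr (real k * s) * (1 / 2 ^ k) ^ N) + eps j * K' * (\<Sum>k<n. W k)"
          by (simp only: sum.distrib sum_distrib_left)
        also have "\<dots> \<le> C * S + K' * S" using 1 2 by (rule add_mono)
        finally show "(\<Sum>k<n. 2 powr (real k * s) * a j k) \<le> C * S + K' * S" .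
      qed
    qed
    also have "\<dots> \<le> ennreal L" using L by (rule ennreal_leI)
    finally have "besov_norm \<Phi> \<Psi> s p' q (f j \<theta>) \<le> ennreal L" .
    moreover have "f j \<theta> \<in> Lspace p' leb_Omega" using fm fB p' by (intro Lspace_bounded) auto
    ultimately show ?thesis using f1 f0 by (simp add: besov_class_def)
  qed
  \<comment> \<open>\<open>\<eta>\<close> is so small that the background mass gained by enlarging a ball by the factor \<open>1 + \<eta>\<close> is at most
    half of the mass that the bump adds to the ball.\<close>
  define qq :: real where "qq = (3 / 4) ^ N / 4"
  have qq: "0 < qq" "qq \<le> 1 / 4" "(3 / 4) ^ N = 4 * qq" by (auto simp: qq_def power_le_one)
  define \<eta> where "\<eta> = qq / (2 * real d)"
  have \<eta>: "0 < \<eta>" "\<eta> \<le> 1"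
  proof -
    show "0 < \<eta>" using qq d1 by (simp add: \<eta>_def)
    have "\<eta> \<le> qq / 1" unfolding \<eta>_def using qq d1 by (intro divide_left_mono) auto
    then show "\<eta> \<le> 1" using qq by simp
  qed
  have \<eta>q: "(1 + \<eta>) ^ d \<le> 1 + qq"
  proof -
    have "(1 + \<eta>) ^ d \<le> exp \<eta> ^ d" using \<eta> by (intro power_mono exp_ge_add_one_self) auto
    also have "\<dots> = exp (real d * \<eta>)" by (simp add: exp_of_nat_mult)
    also have "real d * \<eta> = qq / 2" using d1 by (simp add: \<eta>_def)
    also have "exp (qq / 2) \<le> 1 + 2 * (qq / 2)"
      using exp_bound_lemma[of "qq / 2"] qq by simp
    finally show ?thesis by simp
  qed
  define V where "V = unit_ball_vol (real d)"
  have V: "0 < V" by (simp add: V_def)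
  have vol: "measure lborel (ball x \<rho>) = V * \<rho> ^ d" if "0 \<le> \<rho>" for x :: "real^'n" and \<rho>
    using content_ball[OF that, of x] by (simp add: V_def d_def)
  define \<kappa> where "\<kappa> = (1 - exp (1::real) / 4) / 2"
  have \<kappa>: "0 < \<kappa>" using exp_1_less_4 by (simp add: \<kappa>_def)
  \<comment> \<open>Chosen so that \<Delta>/2 times the number of cells is
    \<open>A0 * 2^(-js)\<close>: \<Delta> is \<open>qq\<close> times the background mass of a ball
    of radius \<open>1 / (64 * 2^j)\<close>, and there are \<open>2^(jd)\<close> cells.\<close>
  define A0 where "A0 = qq / 4 * V / 64 ^ d"
  have A0: "0 < A0" using qq V by (simp add: A0_def)
  \<comment> \<open>The last factor pays for rounding the scale up to a power of two.\<close>
  define c where "c = \<eta> / 128 * A0 powr (1 / p) * \<kappa> * 2 powr (- (1 + s / p))"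
  have c0: "0 < c" using \<eta> A0 \<kappa> by (simp add: c_def)
  have ds: "0 < real d + s" using d1 s by linarith
  have main: "\<exists>\<theta>. ennreal (\<eta> / (128 * 2 ^ j) * (A0 * 2 powr (- (real j * s))) powr (1 / p) * \<kappa>)
      \<le> (\<integral>\<^sup>+X. wasserstein p (law (f j \<theta>)) (\<mu>' X) \<partial>PiM {..<n} (\<lambda>_. law (f j \<theta>)))"
    if n: "n \<ge> 1" and \<mu>': "\<mu>' \<in> estimators n" and j: "real n \<le> (2 ^ j) powr (real d + s)" for n :: nat and j \<mu>'
  proof -
    define m :: nat where "m = 2 ^ j"
    have m: "m \<ge> 1" "real m = 2 ^ j" by (auto simp: m_def)
    define \<rho> where "\<rho> = 32 * real m"
    have \<rho>: "0 < \<rho>" using m by (simp add: \<rho>_def)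
    \<comment> \<open>Half the radius of the bump, where \<open>bump_ge\<close> gives the value
      \<open>4 * qq\<close> at least.\<close>
    define R where "R = 1 / (2 * \<rho>)"
    have R: "0 < R" "2 * R = 1 / \<rho>" using \<rho> by (auto simp: R_def)
    define e where "e = eps j"
    have e: "0 < e" using eps(1)[of j] by (simp add: e_def)
    \<comment> \<open>The background mass of a ball of radius \<open>R\<close>. The two states are
      opposite dipoles, which push the mass of the ball above or below this value, so it serves as
      the threshold.\<close>
    define \<tau> where "\<tau> = e * (V * R ^ d)"
    have \<tau>: "0 < \<tau>" using e V R by (simp add: \<tau>_def)
    \<comment> \<open>The radii \<open>R\<close>, \<open>R1\<close>, \<open>R2\<close> leave gaps of
      \<open>\<eta> * R / 2\<close>, and \<open>R2 <= 2 * R\<close> keeps the largest ball within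
      the support of its bump.\<close>
    define R1 where "R1 = (1 + \<eta> / 2) * R"
    define R2 where "R2 = (1 + \<eta>) * R"
    have R12: "R1 - R = \<eta> * R / 2" "R2 - R1 = \<eta> * R / 2" by (simp_all add: R1_def R2_def algebra_simps)
    have \<eta>R: "0 < \<eta> * R" "\<eta> * R \<le> R" using \<eta> R by auto
    have "R2 = R + \<eta> * R" by (simp add: R2_def distrib_right)
    then have R2\<rho>: "R2 \<le> 1 / \<rho>" using \<eta>R(2) R(2) by linarith
    have RR: "R \<le> R1" "R1 \<le> R2" "R \<le> R2" "0 \<le> R2" using R12 \<eta>R R by linarith+
    have l2: "c \<in> lattice2 m" if "c \<in> lattice m" for c :: "real^'n" using that by (simp add: lattice2_def)
    have sub: "ball c \<sigma> \<subseteq> Omega" if "c \<in> lattice m" "\<sigma> \<le> 1 / \<rho>" for c :: "real^'n" and \<sigma>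
    proof
      fix x assume "x \<in> ball c \<sigma>"
      then have "norm (x - c) \<le> 1 / (32 * real m)" using that(2) by (simp add: dist_norm norm_minus_commute \<rho>_def)
      then show "x \<in> Omega" by (rule lattice2_support(1)[OF m(1) N(1) l2[OF that(1)]])
    qed
    have near: "f j \<theta> x = e + e / 2 * ((if c \<in> \<theta> then 1 else -1) * bump c \<rho> N x)"
      if c: "c \<in> lattice m" and x: "norm (x - c) \<le> 1 / \<rho>" for c x \<theta>
    proof -
      define i :: 'n where "i = undefined"
      have "\<bar>(x - c) $ i\<bar> \<le> 1 / \<rho>" using component_le_norm_cart[of "x - c" i] x by linarith
      moreover have "c $ i \<le> 1 / 4 - 1 / \<rho>" using lattice2_bounds(2)[OF m(1) l2[OF c], of i] by (simp only: \<rho>_def)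
      ultimately have "x $ i \<le> 1 / 4" by simp
      moreover have "\<bar>(x - u) $ i\<bar> \<le> norm (x - u)" by (rule component_le_norm_cart)
      ultimately have "1 / 4 \<le> norm (x - u)" by (simp add: u_def)
      then have "bump u 4 N x = 0" using N by (intro bump_eq_0) auto
      then show ?thesis using dipoles_at[OF m(1) N(1) c, of x \<theta>] x by (simp add: f_def e_def \<rho>_def m_def)
    qed
    have ind: "(\<integral>x. k * indicator (ball c \<sigma>) x \<partial>leb_Omega) = k * (V * \<sigma> ^ d)"
      if "c \<in> lattice m" "0 \<le> \<sigma>" "\<sigma> \<le> 1 / \<rho>" for c :: "real^'n" and \<sigma> k
    proof -
      have "(\<lambda>x. indicator Omega x * (k * indicator (ball c \<sigma>) x)) = (\<lambda>x. k * indicator (ball c \<sigma>) x :: real)"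
      proof
        fix x
        show "indicator Omega x * (k * indicator (ball c \<sigma>) x) = (k * indicator (ball c \<sigma>) x :: real)"
          using subsetD[OF sub[OF that(1,3)], of x] by (cases "x \<in> ball c \<sigma>") simp_all
      qed
      then show ?thesis using vol[OF that(2), of c] unfolding integral_leb_Omega_eq by simp
    qed
    have ii: "integrable leb_Omega (\<lambda>x. k * indicator (ball c \<sigma>) x :: real)" for k \<sigma> and c :: "real^'n"
      by (rule integrable_indicator_Omega) auto
    have mass1: "\<tau> + qq * \<tau> \<le> measure (law (f j \<theta>)) (ball c R \<inter> Omega)" if c: "c \<in> lattice m" "c \<in> \<theta>" for c \<theta>
    proof -
      have "\<tau> + qq * \<tau> \<le> (e * (1 + 2 * qq)) * (V * R ^ d)"
      proof -
        have "(e * (1 + 2 * qq)) * (V * R ^ d) = \<tau> + 2 * (qq * \<tau>)" by (simp add: \<tau>_def algebra_simps)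
        moreover have "0 \<le> qq * \<tau>" using qq \<tau> by simp
        ultimately show ?thesis by linarith
      qed
      also have "\<dots> = (\<integral>x. e * (1 + 2 * qq) * indicator (ball c R) x \<partial>leb_Omega)"
        using c R RR R2\<rho> by (intro ind[symmetric]) auto
      also have "\<dots> \<le> (\<integral>x. f j \<theta> x * indicator (ball c R) x \<partial>leb_Omega)"
      proof (intro integral_mono ii integrable_indicator_Omega fi)
        fix x
        show "e * (1 + 2 * qq) * indicator (ball c R) x \<le> f j \<theta> x * indicator (ball c R) x"
        proof (cases "x \<in> ball c R")
          case True
          then have x: "norm (x - c) \<le> R" by (simp add: dist_norm norm_minus_commute)
          have "4 * qq \<le> bump c \<rho> N x" using bump_ge[OF \<rho>, of x c N] x qq(3) by (simp add: R_def)
          then have "e / 2 * (4 * qq) \<le> e / 2 * bump c \<rho> N x" using e by (intro mult_left_mono) auto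
          then have "e * (1 + 2 * qq) \<le> f j \<theta> x" using near[OF c(1), of x \<theta>] x RR R2\<rho> c(2) by (simp add: algebra_simps)
          then show ?thesis using True by simp
        qed simp
      qed simp
      also have "\<dots> = measure (law (f j \<theta>)) (ball c R \<inter> Omega)"
        using f0 by (intro measure_law[symmetric] fi) auto
      finally show ?thesis .
    qed
    have mass0: "measure (law (f j \<theta>)) (ball c R2 \<inter> Omega) \<le> \<tau> - qq * \<tau>" if c: "c \<in> lattice m" "c \<notin> \<theta>" for c \<theta>
    proof -
      have "measure (law (f j \<theta>)) (ball c R2 \<inter> Omega) = (\<integral>x. f j \<theta> x * indicator (ball c R2) x \<partial>leb_Omega)"
        using f0 by (intro measure_law fi) auto
      also have "\<dots> \<le> (\<integral>x. e * indicator (ball c R2) x - e * (2 * qq) * indicator (ball c R) x \<partial>leb_Omega)"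
      proof (intro integral_mono ii integrable_indicator_Omega fi Bochner_Integration.integrable_diff)
        fix x
        show "f j \<theta> x * indicator (ball c R2) x \<le> e * indicator (ball c R2) x - e * (2 * qq) * indicator (ball c R) x"
        proof (cases "x \<in> ball c R2")
          case True
          then have fx: "f j \<theta> x = e - e / 2 * bump c \<rho> N x"
            using near[OF c(1), of x \<theta>] R2\<rho> c(2) by (simp add: dist_norm norm_minus_commute)
          show ?thesis
          proof (cases "x \<in> ball c R")
            case True
            then have "4 * qq \<le> bump c \<rho> N x" using bump_ge[OF \<rho>, of x c N] qq(3) by (simp add: R_def dist_norm norm_minus_commute)
            then have "e / 2 * (4 * qq) \<le> e / 2 * bump c \<rho> N x" using e by (intro mult_left_mono) auto
            then show ?thesis using fx True \<open>x \<in> ball c R2\<close> by simp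
          next
            case False
            then show ?thesis using fx True e bump_nonneg[of c \<rho> N x] by simp
          qed
        next
          case False
          then show ?thesis using RR by auto
        qed
      qed simp
      also have "\<dots> = e * (V * R2 ^ d) - e * (2 * qq) * (V * R ^ d)"
        using ind[OF c(1), of R2 e] ind[OF c(1), of R "e * (2 * qq)"] ii RR R R2\<rho>
        by (subst Bochner_Integration.integral_diff) auto
      also have "e * (V * R2 ^ d) = (1 + \<eta>) ^ d * \<tau>" by (simp add: \<tau>_def R2_def power_mult_distrib)
      \<comment> \<open>Enlarging the ball adds at most \<open>qq * \<tau>\<close> of background,
        while the negative bump has removed \<open>2 * qq * \<tau>\<close>.\<close>
      also have "(1 + \<eta>) ^ d * \<tau> - e * (2 * qq) * (V * R ^ d) \<le> (1 + qq) * \<tau> - e * (2 * qq) * (V * R ^ d)"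
        using \<eta>q \<tau> by (intro diff_right_mono mult_right_mono) auto
      also have "\<dots> = \<tau> - qq * \<tau>" by (simp add: \<tau>_def algebra_simps)
      finally show ?thesis .
    qed
    have "\<exists>\<theta>\<subseteq>lattice m. ennreal (\<eta> * R / 2 * (qq * \<tau> / 2 * card (lattice m :: (real^'n) set)) powr (1 / p) * ((1 - exp 1 / 4) / 2))
      \<le> (\<integral>\<^sup>+X. wasserstein p (law (f j \<theta>)) (\<mu>' X) \<partial>PiM {..<n} (\<lambda>_. law (f j \<theta>)))"
    proof (rule assouad_wasserstein[where A = "\<lambda>c. ball c R" and N = "\<lambda>c. ball c R1"
          and N' = "\<lambda>c. ball c R2" and \<tau> = \<tau>, OF finite_lattice lattice_nonempty[OF m(1)] p n])
      show "prob_space (law (f j \<theta>))" for \<theta> using f0 f1 fi by (intro prob_space_law) auto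
      show "\<eta> * R / 2 \<le> norm (x - y)" if "x \<in> ball c R" "y \<notin> ball c R1" for x y and c :: "real^'n"
        using that dist_triangle[of c y x] R12 by (simp add: dist_norm)
      show "\<eta> * R / 2 \<le> norm (x - y)" if "x \<notin> ball c R2" "y \<in> ball c R1" for x y and c :: "real^'n"
        using that dist_triangle[of c x y] R12 by (simp add: dist_norm norm_minus_commute)
      show "ball c R \<subseteq> ball c R1" for c :: "real^'n" using RR by auto
      show "disjoint_family_on (\<lambda>c. ball c R1) (lattice m :: (real^'n) set)"
        unfolding disjoint_family_on_def
      proof (intro ballI impI)
        fix c c' :: "real^'n" assume c: "c \<in> lattice m" "c' \<in> lattice m" "c \<noteq> c'"
        have "2 / \<rho> \<le> norm (c - c')" using lattice2_sep[OF m(1) l2[OF c(1)] l2[OF c(2)] c(3)] by (simp add: \<rho>_def)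
        then have d: "4 * R \<le> dist c c'" using R(2) by (simp add: dist_norm)
        show "ball c R1 \<inter> ball c' R1 = {}"
        proof (rule ccontr)
          assume "ball c R1 \<inter> ball c' R1 \<noteq> {}"
          then obtain y where "dist c y < R1" "dist c' y < R1" by auto
          then have "dist c c' < 2 * R1" using dist_triangle[of c c' y] by (simp add: dist_commute)
          then show False using d RR \<eta>R R12 R by linarith
        qed
      qed
      show "\<tau> + qq * \<tau> \<le> measure (law (f j \<theta>)) (ball c R \<inter> Omega)" if "\<theta> \<subseteq> lattice m" "c \<in> \<theta>" for \<theta> c
        using that by (intro mass1) auto
      show "measure (law (f j \<theta>)) (ball c R2 \<inter> Omega) \<le> \<tau> - qq * \<tau>" if "c \<in> lattice m - \<theta>" for \<theta> c
        using that by (intro mass0) auto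
      show "\<exists>h. h \<in> borel_measurable leb_Omega \<and> (\<forall>x. 0 \<le> h x) \<and> (\<forall>x\<in>Omega. f j (insert c \<theta>) x = f j \<theta> x * h x)
        \<and> (\<integral>\<^sup>+x. ennreal (f j \<theta> x * (h x)\<^sup>2) \<partial>leb_Omega) \<le> ennreal (1 + 1 / real n)"
        if c: "c \<in> lattice m" and \<theta>: "\<theta> \<subseteq> lattice m - {c}" for c \<theta>
      proof -
        define b where "b x = bump c \<rho> N x" for x
        define b' where "b' x = bump (c + lattice_shift m) \<rho> N x" for x
        define F0 where "F0 = f j \<theta>"
        define F1 where "F1 = f j (insert c \<theta>)"
        have F0: "e / 2 \<le> F0 x" for x using f_lo[of j \<theta> x] by (simp add: F0_def e_def)
        have F0p: "0 < F0 x" for x using F0[of x] e by linarith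
        have F1p: "0 \<le> F1 x" for x unfolding F1_def by (rule f0)
        have diff: "F1 x - F0 x = e * (b x - b' x)" for x
        proof -
          have "F1 x - F0 x = e / 2 * (dipoles N m (insert c \<theta>) x - dipoles N m \<theta> x)"
            by (simp add: F0_def F1_def f_def e_def m_def right_diff_distrib)
          also have "dipoles N m (insert c \<theta>) x - dipoles N m \<theta> x = 2 * (b x - b' x)"
            using dipoles_insert[OF c, of \<theta> N x] \<theta> by (auto simp: b_def b'_def \<rho>_def bump_shift)
          also have "e / 2 * (2 * (b x - b' x)) = e * (b x - b' x)" by simp
          finally show ?thesis .
        qed
        define h where "h x = F1 x / F0 x" for x
        have hm: "h \<in> borel_measurable leb_Omega"
          unfolding h_def F0_def F1_def by (intro borel_measurable_divide fm)
        have b01: "0 \<le> b x" "b x \<le> 1" "0 \<le> b' x" "b' x \<le> 1" for x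
          unfolding b_def b'_def by (rule bump_nonneg bump_le_1)+
        \<comment> \<open>\<open>F0 * h^2\<close> is \<open>2 * F1 - F0\<close>, which integrates to
          1, plus the chi-square integrand \<open>(F1 - F0)^2 / F0\<close>. As
          \<open>F0 >= e / 2\<close> and \<open>F1 - F0 = e * (b - b')\<close>, the latter is linear
          in the background height \<open>e\<close>.\<close>
        have pt: "F0 x * (h x)\<^sup>2 \<le> 2 * F1 x - F0 x + 2 * e * (b x + b' x)" for x
        proof -
          have "F0 x * (h x)\<^sup>2 = 2 * F1 x - F0 x + (F1 x - F0 x)\<^sup>2 / F0 x"
            using F0p[of x] by (simp add: h_def power2_eq_square field_simps)
          also have "(F1 x - F0 x)\<^sup>2 / F0 x \<le> (F1 x - F0 x)\<^sup>2 / (e / 2)"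
            using F0[of x] F0p[of x] e by (intro divide_left_mono) auto
          also have "\<dots> = 2 * e * (b x - b' x)\<^sup>2"
            using e unfolding diff by (simp add: power2_eq_square)
          also have "\<dots> \<le> 2 * e * (b x + b' x)"
          proof (intro mult_left_mono)
            have "\<bar>b x - b' x\<bar> * \<bar>b x - b' x\<bar> \<le> 1 * (b x + b' x)"
              using b01[of x] by (intro mult_mono) auto
            then show "(b x - b' x)\<^sup>2 \<le> b x + b' x" by (simp add: power2_eq_square abs_mult_self_eq)
          qed (use e in auto)
          finally show ?thesis by simp
        qed
        define J where "J = bump_mass TYPE('n) \<rho> N"
        have c2: "c + lattice_shift m \<in> lattice2 m" using c by (simp add: lattice2_def)
        have Ib: "(\<integral>x. b x \<partial>leb_Omega) = J" and Ib': "(\<integral>x. b' x \<partial>leb_Omega) = J"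
          unfolding b_def b'_def J_def \<rho>_def by (rule lattice2_support(3)[OF m(1) N(1) l2[OF c]] lattice2_support(3)[OF m(1) N(1) c2])+
        have ib: "integrable leb_Omega b" and ib': "integrable leb_Omega b'"
          unfolding b_def b'_def by (rule integrable_bump_Omega)+
        have iF: "integrable leb_Omega F0" "integrable leb_Omega F1" unfolding F0_def F1_def by (rule fi)+
        have IF: "(\<integral>x. F0 x \<partial>leb_Omega) = 1" "(\<integral>x. F1 x \<partial>leb_Omega) = 1" unfolding F0_def F1_def by (rule f1)+
        have "(\<integral>\<^sup>+x. ennreal (F0 x * (h x)\<^sup>2) \<partial>leb_Omega) \<le> (\<integral>\<^sup>+x. ennreal (2 * F1 x - F0 x + 2 * e * (b x + b' x)) \<partial>leb_Omega)"
          using pt by (intro nn_integral_mono ennreal_leI)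
        also have "\<dots> = ennreal (\<integral>x. 2 * F1 x - F0 x + 2 * e * (b x + b' x) \<partial>leb_Omega)"
        proof (rule nn_integral_eq_integral)
          show "integrable leb_Omega (\<lambda>x. 2 * F1 x - F0 x + 2 * e * (b x + b' x))"
            using iF ib ib' by simp
          show "AE x in leb_Omega. 0 \<le> 2 * F1 x - F0 x + 2 * e * (b x + b' x)"
          proof (intro AE_I2)
            fix x
            have "0 \<le> F0 x * (h x)\<^sup>2" using F0p[of x] by simp
            then show "0 \<le> 2 * F1 x - F0 x + 2 * e * (b x + b' x)" using pt[of x] by linarith
          qed
        qed
        also have "(\<integral>x. 2 * F1 x - F0 x + 2 * e * (b x + b' x) \<partial>leb_Omega) = 1 + 4 * e * J"
          using iF ib ib' IF Ib Ib' by simp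
        also have "ennreal (1 + 4 * e * J) \<le> ennreal (1 + 1 / real n)"
        proof (intro ennreal_leI add_left_mono)
          \<comment> \<open>The volume is of order \<open>2^(-jd)\<close> and \<open>e\<close> of
            order \<open>2^(-js)\<close>, so the assumption on \<open>j\<close> bounds the product
            by \<open>1/n\<close>. The 32 in \<rho> leaves room for the factor 4.\<close>
          have "J \<le> (2 / \<rho>) ^ d" unfolding J_def d_def by (rule bump_mass_le[OF \<rho> N(1)])
          also have "\<dots> = (1 / 16) ^ d * (1 / 2 ^ j) ^ d" by (simp add: \<rho>_def m(2) power_mult_distrib[symmetric])
          also have "\<dots> \<le> (1 / 16) ^ 1 * (1 / 2 ^ j) ^ d"
            using d1 by (intro mult_right_mono power_decreasing) auto
          finally have J: "J \<le> 1 / 16 * (1 / 2 ^ j) ^ d" by simp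
          have "4 * e * J \<le> 4 * e * (1 / 16 * (1 / 2 ^ j) ^ d)" using J e by (intro mult_left_mono) auto
          also have "\<dots> = 1 / 8 * (2 powr (- (real j * s)) * (1 / 2 ^ j) ^ d)" by (simp add: e_def eps_def)
          also have "2 powr (- (real j * s)) * (1 / 2 ^ j) ^ d = 1 / (2 ^ j) powr (real d + s)"
          proof -
            have "(2 ^ j) powr (real d + s) = (2 ^ j) powr real d * (2 powr real j) powr s"
              by (simp add: powr_add powr_realpow)
            also have "\<dots> = (2 ^ j) ^ d * 2 powr (real j * s)" by (simp only: powr_powr) (simp add: powr_realpow)
            finally show ?thesis by (simp add: powr_minus_divide power_one_over)
          qed
          also have "1 / 8 * (1 / (2 ^ j) powr (real d + s)) \<le> 1 * (1 / (2 ^ j) powr (real d + s))"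
            by (intro mult_right_mono) auto
          also have "\<dots> \<le> 1 / real n" using j n by (simp add: frac_le)
          finally show "4 * e * J \<le> 1 / real n" .
        qed
        finally have "(\<integral>\<^sup>+x. ennreal (F0 x * (h x)\<^sup>2) \<partial>leb_Omega) \<le> ennreal (1 + 1 / real n)" .
        moreover have "F1 x = F0 x * h x" "0 \<le> h x" for x using F0p[of x] F1p[of x] by (auto simp: h_def)
        ultimately show ?thesis using hm unfolding F0_def F1_def by blast
      qed
      show "\<mu>' \<in> estimators n" by (rule \<mu>')
    qed (use \<eta>R \<tau> qq fm f0 in auto)
    then obtain \<theta> where \<theta>: "ennreal (\<eta> * R / 2 * (qq * \<tau> / 2 * card (lattice m :: (real^'n) set)) powr (1 / p) * ((1 - exp 1 / 4) / 2))
      \<le> (\<integral>\<^sup>+X. wasserstein p (law (f j \<theta>)) (\<mu>' X) \<partial>PiM {..<n} (\<lambda>_. law (f j \<theta>)))" by (elim exE conjE)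
    have "R ^ d * (2 ^ j) ^ d = 1 / 64 ^ d"
      by (simp add: R_def \<rho>_def m(2) power_mult_distrib[symmetric] power_one_over[symmetric])
    moreover have "qq * \<tau> / 2 * card (lattice m :: (real^'n) set) = qq / 4 * V * (R ^ d * (2 ^ j) ^ d) * 2 powr (- (real j * s))"
      unfolding \<tau>_def e_def eps_def card_lattice[OF m(1)] of_nat_power m(2) d_def[symmetric] by simp
    ultimately have "qq * \<tau> / 2 * card (lattice m :: (real^'n) set) = A0 * 2 powr (- (real j * s))"
      unfolding A0_def by simp
    moreover have "\<eta> * R / 2 = \<eta> / (128 * 2 ^ j)" by (simp add: R_def \<rho>_def m(2))
    ultimately show ?thesis using \<theta> unfolding \<kappa>_def by auto
  qed
  show ?thesis
  proof (rule exI[of _ L0], intro conjI L0, rule exI[of _ c], intro conjI c0 allI impI ballI)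
    fix L and n :: nat and \<mu>' :: "(nat \<Rightarrow> real^'n) \<Rightarrow> (real^'n) measure"
    assume L: "L0 \<le> L" and n: "1 \<le> n" and \<mu>': "\<mu>' \<in> estimators n"
    define P where "P j \<longleftrightarrow> real n \<le> (2 ^ j) powr (real d + s)" for j :: nat
    have "\<exists>j. P j"
    proof -
      have "real n \<le> 2 ^ n" by (rule less_imp_le[OF of_nat_less_two_power])
      also have "\<dots> = (2 ^ n) powr 1" by simp
      also have "\<dots> \<le> (2 ^ n) powr (real d + s)" using d1 s by (intro powr_mono) auto
      finally show ?thesis unfolding P_def by blast
    qed
    \<comment> \<open>The coarsest level at which a single flip cannot be detected. By minimality
      \<open>2^j\<close> is at most twice \<open>n^(1/(d+s))\<close>.\<close>
    define j where "j = (LEAST j. P j)"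
    have Pj: "P j" unfolding j_def using \<open>\<exists>j. P j\<close> by (rule LeastI_ex)
    define y where "y = real n powr (1 / (real d + s))"
    have y: "1 \<le> y" unfolding y_def using n ds by (intro ge_one_powr_ge_zero) auto
    have jy: "2 ^ j \<le> 2 * y"
    proof (cases j)
      case 0
      then show ?thesis using y by simp
    next
      case (Suc i)
      then have "\<not> P i" using not_less_Least[of i P] by (simp add: j_def[symmetric])
      then have "(2 ^ i) powr (real d + s) \<le> real n" by (simp add: P_def)
      then have "((2 ^ i) powr (real d + s)) powr (1 / (real d + s)) \<le> y"
        unfolding y_def using ds by (intro powr_mono2) auto
      then have "2 ^ i \<le> y" using ds by (simp add: powr_powr)
      then show ?thesis by (simp add: Suc)
    qed
    obtain \<theta> where \<theta>: "ennreal (\<eta> / (128 * 2 ^ j) * (A0 * 2 powr (- (real j * s))) powr (1 / p) * \<kappa>)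
      \<le> (\<integral>\<^sup>+X. wasserstein p (law (f j \<theta>)) (\<mu>' X) \<partial>PiM {..<n} (\<lambda>_. law (f j \<theta>)))"
      using main[OF n \<mu>'] Pj unfolding P_def by blast
    have "c * real n powr (- ((1 + s / p) / (real CARD('n) + s))) \<le> \<eta> / (128 * 2 ^ j) * (A0 * 2 powr (- (real j * s))) powr (1 / p) * \<kappa>"
    proof -
      have e: "0 \<le> 1 + s / p" using s p by simp
      have "real n powr (- ((1 + s / p) / (real CARD('n) + s))) = y powr (- (1 + s / p))"
        unfolding y_def powr_powr d_def by (simp only: mult_minus_right times_divide_eq_left mult_1)
      then have "2 powr (- (1 + s / p)) * real n powr (- ((1 + s / p) / (real CARD('n) + s))) = (2 * y) powr (- (1 + s / p))"
        by (simp only: powr_mult)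
      also have "\<dots> \<le> (2 ^ j) powr (- (1 + s / p))"
        using jy y e by (intro powr_mono2') auto
      also have "\<dots> = 1 / 2 ^ j * (2 powr (- (real j * s))) powr (1 / p)"
      proof -
        have "(2 ^ j) powr (- (1 + s / p)) = (2 powr real j) powr (- (1 + s / p))" by (simp add: powr_realpow)
        also have "\<dots> = 2 powr (- real j) * 2 powr (- (real j * s) * (1 / p))"
          unfolding powr_powr powr_add[symmetric] by (simp add: algebra_simps)
        also have "2 powr (- real j) = 1 / (2::real) ^ j" by (simp add: powr_minus_divide powr_realpow)
        finally show ?thesis by (simp only: powr_powr)
      qed
      finally have le: "2 powr (- (1 + s / p)) * real n powr (- ((1 + s / p) / (real CARD('n) + s)))
        \<le> 1 / 2 ^ j * (2 powr (- (real j * s))) powr (1 / p)" .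
      have "c * real n powr (- ((1 + s / p) / (real CARD('n) + s)))
        = \<eta> / 128 * A0 powr (1 / p) * \<kappa> * (2 powr (- (1 + s / p)) * real n powr (- ((1 + s / p) / (real CARD('n) + s))))"
        by (simp only: c_def mult.assoc)
      also have "\<dots> \<le> \<eta> / 128 * A0 powr (1 / p) * \<kappa> * (1 / 2 ^ j * (2 powr (- (real j * s))) powr (1 / p))"
        using le \<eta> A0 \<kappa> by (intro mult_left_mono) auto
      also have "\<dots> = \<eta> / (128 * 2 ^ j) * (A0 * 2 powr (- (real j * s))) powr (1 / p) * \<kappa>"
        by (simp add: powr_mult)
      finally show ?thesis .
    qed
    then have "ennreal (c * real n powr (- ((1 + s / p) / (real CARD('n) + s))))
      \<le> (\<integral>\<^sup>+X. wasserstein p (law (f j \<theta>)) (\<mu>' X) \<partial>PiM {..<n} (\<lambda>_. law (f j \<theta>)))"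
      using \<theta> by (meson ennreal_leI order_trans)
    then show "\<exists>f\<in>besov_class \<Phi> \<Psi> s p' q L. ennreal (c * real n powr (- ((1 + s / p) / (real CARD('n) + s))))
      \<le> (\<integral>\<^sup>+X. wasserstein p (law f) (\<mu>' X) \<partial>PiM {..<n} (\<lambda>_. law f))"
      using member[OF L, of j \<theta>] by blast
  qed
qed

end

section \<open>Combination of the two rates\<close>

theorem theorem5:
  fixes p s r :: real and p' q :: ennreal
    and \<Phi> :: "(real^'n \<Rightarrow> real) set"
    and \<Psi> :: "nat \<Rightarrow> (real^'n \<Rightarrow> real) set"
  defines "d \<equiv> real CARD('n)"
  assumes "1 \<le> p" and "1 \<le> p'" and "1 \<le> q" and "0 \<le> s"
    and "r > max s 1"
    and "wavelet_system r \<Phi> \<Psi>"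
  shows "\<exists>L0>0. \<forall>L\<ge>L0. \<exists>c>0. \<forall>n\<ge>1.
    (INF \<mu>'\<in>estimators n. SUP f\<in>besov_class \<Phi> \<Psi> s p' q L.
       \<integral>\<^sup>+X. wasserstein p (law f) (\<mu>' X) \<partial>PiM {..<n} (\<lambda>_. law f))
    \<ge> ennreal (c * (if d - s \<ge> 2 * p
                    then real n powr (- ((1 + s / p) / (d + s)))
                    else real n powr (- (1 / (2 * p)))))"
proof -
  interpret wavelet_system r \<Phi> \<Psi> by fact
  have r: "1 < r" "s < r" using assms(6) by auto
  define rate where "rate n = (if d - s \<ge> 2 * p
      then real n powr (- ((1 + s / p) / (d + s))) else real n powr (- (1 / (2 * p))))" for n
  \<comment> \<open>Here \<open>c\<close> is chosen before \<open>L\<close>: the constructed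
    densities lie in the class of radius \<open>L0\<close> and hence in every larger one.\<close>
  have "\<exists>L0>0. \<exists>c>0. \<forall>L\<ge>L0. \<forall>n\<ge>1. \<forall>\<mu>'\<in>estimators n. \<exists>f\<in>besov_class \<Phi> \<Psi> s p' q L.
    ennreal (c * rate n) \<le> (\<integral>\<^sup>+X. wasserstein p (law f) (\<mu>' X) \<partial>PiM {..<n} (\<lambda>_. law f))"
  proof (cases "d - s \<ge> 2 * p")
    case True
    then show ?thesis
      using lattice_lower_bound[OF r(1) assms(5) r(2) assms(2,3,4)] by (simp add: rate_def d_def)
  next
    case False
    then show ?thesis
      using two_point_lower_bound[OF r(1) assms(5) r(2) assms(2,3,4)] by (simp add: rate_def)
  qed
  then obtain L0 c where L0: "L0 > 0" and c: "c > 0"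
    and lower: "\<forall>L\<ge>L0. \<forall>n\<ge>1. \<forall>\<mu>'\<in>estimators n. \<exists>f\<in>besov_class \<Phi> \<Psi> s p' q L.
      ennreal (c * rate n) \<le> (\<integral>\<^sup>+X. wasserstein p (law f) (\<mu>' X) \<partial>PiM {..<n} (\<lambda>_. law f))"
    by (elim exE conjE)
  have "ennreal (c * rate n) \<le> (INF \<mu>'\<in>estimators n. SUP f\<in>besov_class \<Phi> \<Psi> s p' q L.
      \<integral>\<^sup>+X. wasserstein p (law f) (\<mu>' X) \<partial>PiM {..<n} (\<lambda>_. law f))" if Ln: "L0 \<le> L" "1 \<le> n" for L n
  proof (rule INF_greatest)
    fix \<mu>' :: "(nat \<Rightarrow> real^'n) \<Rightarrow> (real^'n) measure" assume "\<mu>' \<in> estimators n"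
    then obtain f where f: "f \<in> besov_class \<Phi> \<Psi> s p' q L"
      "ennreal (c * rate n) \<le> (\<integral>\<^sup>+X. wasserstein p (law f) (\<mu>' X) \<partial>PiM {..<n} (\<lambda>_. law f))"
      using lower[rule_format, OF Ln] by blast
    show "ennreal (c * rate n) \<le> (SUP f\<in>besov_class \<Phi> \<Psi> s p' q L.
        \<integral>\<^sup>+X. wasserstein p (law f) (\<mu>' X) \<partial>PiM {..<n} (\<lambda>_. law f))"
      using SUP_upper[OF f(1), of "\<lambda>f. \<integral>\<^sup>+X. wasserstein p (law f) (\<mu>' X) \<partial>PiM {..<n} (\<lambda>_. law f)"] f(2)
      by (rule order_trans[rotated])
  qed
  then show ?thesis using L0 c unfolding rate_def by blast
qed

end
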